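(* Let $\Gamma$ be a metric graph and let $\Sigma\subseteq R(D)$ be a matroidal linear series with parametrization $\pi\colon\mathcal V\to\Sigma$. (1) There is a unique continuous section $\sigma$ of $\pi$ over $\{\varphi\in\Sigma: D+\mathrm{div}(\varphi)\text{ is nondegenerate in }|\Sigma|\}$. (2) For $\varphi\in\Sigma$ with $D+\mathrm{div}(\varphi)$ nondegenerate, set $\Sigma_\varphi:=\{\varphi':\varphi+\varphi'\in\Sigma\}\subseteq R(D+\mathrm{div}(\varphi))$. Then the simplified local matroid $\overline M_{\Sigma_\varphi}$ is isomorphic to a submatroid of the initial matroid $\mathcal V^{\sigma(\varphi)}$.
   Context: A metric graph is the metric space of a finite connected graph (loops and multiple edges allowed) with positive real edge lengths; the valence of a point is its number of tangent directions. A divisor $D$ is a finite formal $\mathbb Z$-combination of points; effective ($\ge0$) means all coefficients are nonnegative; $\mathrm{supp}(D)$ is the set of points with nonzero coefficient. $\mathrm{PL}(\Gamma)$ is the set of continuous piecewise-linear functions with integer slopes (with the uniform topology); $\mathrm{div}(\varphi)$ has multiplicity at $p$ the sum of the incoming slopes (minus the sum of the outgoing slopes) of $\varphi$ at $p$; $R(D)=\{\varphi\in\mathrm{PL}(\Gamma):D+\mathrm{div}(\varphi)\ge0\}$. A tropical submodule of $R(D)$ is a subset closed under pointwise minimum and addition of real constants (a zero element $\infty$ is tacitly adjoined); it is finitely generated if it consists of all finite combinations $\min_i\{\varphi_i+a_i\}$ of a finite set. $r_{\mathrm{BN}}(\Sigma)$ is the largest integer $r$ such that for every effective $D'$ of degree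 $r$ there is $\varphi\in\Sigma$ with $D-D'+\mathrm{div}(\varphi)\ge0$. A finite set $\{\varphi_0,\dots,\varphi_s\}$ is tropically dependent if there are reals $a_i$ such that at every point of $\Gamma$ the minimum $\min_i\{\varphi_i+a_i\}$ is achieved at least twice, and independent otherwise; $r_{\mathrm{ind}}(\Sigma)$ is the size of the largest independent subset. A tropical linear series of dimension $r$ is a finitely generated $\Sigma\subseteq R(D)$ with $r_{\mathrm{BN}}(\Sigma)=r$, $r_{\mathrm{ind}}(\Sigma)=r+1$. A valuated matroid is a tropical submodule $\mathcal V\subseteq\overline{\mathbb R}^N$, $\overline{\mathbb R}=\mathbb R\cup\{\infty\}$ (closed under coordinatewise $\min$ and adding scalars), such that whenever $w,w'\in\mathcal V$ and $w_i=w'_i$ there is $w''\in\mathcal V$ with $w''_i=\infty$ and $w''_j\ge\min\{w_j,w'_j\}$ for $j\ne i$, with equality when $w_j\neq w'_j$. Its rank is the rank of the matroid whose covectors (complements of flats) are the sets $\{i:w_i\ne\infty\}$, $w\in\mathcal V$. For $w\in\mathcal V\cap\mathbb R^N$, the initial matroid $\mathcal V^w$ is the loopless matroid on the $N$ coordinates with flats $\{\mathrm{supp}(w'-w): w'\in\mathcal V,\ w'-w\in\mathbb R_{\ge0}^N\}$, where $\mathrm{supp}$ is the set of nonzero coordinates. (Coordinates in which every element of $\mathcal V$ is $\infty$ are discarded before forming $\mathcal V^w$.) A tropical linear series $\Sigma$ of dimension $r$ is matroidal if there is a surjective homomorphism of tropical modules $\pi\colon\mathcal V\twoheadrightarrow\Sigma$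 from a valuated matroid of rank $r+1$; such a surjection is a parametrization. $|\Sigma|=\{D+\mathrm{div}(\varphi):\varphi\in\Sigma\}\subseteq\mathrm{Sym}^d(\Gamma)=\Gamma^d/S_d$, $d=\deg D$. A divisor $D'\in|\Sigma|$ is nondegenerate if $\#\mathrm{supp}$ has a local maximum on $|\Sigma|$ at $D'$ and the sum of the multiplicities at valence 1 points of $\Gamma$ has a local minimum on $|\Sigma|$ at $D'$. If $\Sigma'\subseteq R(D')$ is a tropical linear series and $D'\in|\Sigma'|$ is nondegenerate, let $E$ be the set of connected components of $\Gamma\smallsetminus\mathrm{supp}(D')$; the local matroid $M_{\Sigma'}$ is the matroid on $E$ whose flats are $E$ and the sets $F_\psi=\{S\in E:S\not\subseteq\psi_{\min}\}$, $\psi\in\Sigma'$, where $\psi_{\min}$ is the set of points at which $\psi$ attains its minimum (this collection is the lattice of flats of a matroid). In (2) this is applied with $\Sigma'=\Sigma_\varphi$ and $D'=D+\mathrm{div}(\varphi)$. The simplification $\overline M$ of a matroid $M$ is obtained by deleting loops and identifying parallel elements. A submatroid of a matroid $M$ on $E$ is the restriction of $M$ to a subset $E'\subseteq E$ that contains a basis of $M$. *)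

theory Defs
  imports "HOL-Analysis.Analysis"
begin

section \<open>Metric graphs\<close>

text \<open>
  The metric graph is the whole type \<open>'p\<close> with its class metric. The record is a combinatorial
  model of it: vertices, edges with lengths, and for each edge \<open>e\<close> the unit-speed
  parametrization \<open>chart e\<close>, relevant only on \<open>{0..len e}\<close>.
\<close>

record ('p, 'e) mgraph =
  verts :: "'p set"
  edges :: "'e set"
  len   :: "'e \<Rightarrow> real"
  chart :: "'e \<Rightarrow> real \<Rightarrow> 'p"

text \<open>\<open>walk G x y L\<close>: there is a path of length \<open>L\<close> from \<open>x\<close> to \<open>y\<close>, made of finitely many
  segments each lying in one edge.\<close>

inductive walk :: "('p, 'e) mgraph \<Rightarrow> 'p \<Rightarrow> 'p \<Rightarrow> real \<Rightarrow> bool" for G where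
  refl: "walk G x x 0"
| step: "walk G x (chart G e s) L \<Longrightarrow> e \<in> edges G \<Longrightarrow> s \<in> {0..len G e} \<Longrightarrow> t \<in> {0..len G e}
          \<Longrightarrow> walk G x (chart G e t) (L + \<bar>t - s\<bar>)"

text \<open>Loops and multiple edges are allowed, as is the graph with one vertex and no edge.
  Connectedness is the existence of walks; the metric is the path metric.\<close>

definition metric_graph :: "('p::metric_space, 'e) mgraph \<Rightarrow> bool" where
  "metric_graph G \<longleftrightarrow>
     finite (verts G) \<and> finite (edges G) \<and>
     (\<forall>e\<in>edges G. 0 < len G e \<and> chart G e 0 \<in> verts G \<and> chart G e (len G e) \<in> verts G) \<and>
     inj_on (\<lambda>(e, t). chart G e t) (SIGMA e:edges G. {0<..<len G e}) \<and>
     verts G \<inter> (\<Union>e\<in>edges G. chart G e ` {0<..<len G e}) = {} \<and>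
     verts G \<union> (\<Union>e\<in>edges G. chart G e ` {0<..<len G e}) = UNIV \<and>
     (\<forall>x y. (\<exists>L. walk G x y L) \<and> dist x y = Inf {L. walk G x y L})"

text \<open>A tangent direction at \<open>p\<close> is a triple \<open>(e, t, d)\<close>: one stands at \<open>chart e t = p\<close> and moves
  along \<open>e\<close> with increasing (\<open>d = 1\<close>) or decreasing (\<open>d = -1\<close>) parameter.\<close>

definition tangents :: "('p, 'e) mgraph \<Rightarrow> 'p \<Rightarrow> ('e \<times> real \<times> real) set" where
  "tangents G p = {(e, t, d). e \<in> edges G \<and> 0 \<le> t \<and> t \<le> len G e \<and> chart G e t = p \<and>
                              (d = 1 \<and> t < len G e \<or> d = -1 \<and> 0 < t)}"

definition valence :: "('p, 'e) mgraph \<Rightarrow> 'p \<Rightarrow> nat" where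
  "valence G p = card (tangents G p)"

section \<open>Divisors and piecewise linear functions\<close>

definition supp :: "('p \<Rightarrow> int) \<Rightarrow> 'p set" where
  "supp D = {p. D p \<noteq> 0}"

definition divisor :: "('p \<Rightarrow> int) \<Rightarrow> bool" where
  "divisor D \<longleftrightarrow> finite (supp D)"

definition degree :: "('p \<Rightarrow> int) \<Rightarrow> int" where
  "degree D = (\<Sum>p\<in>supp D. D p)"

definition effective :: "('p \<Rightarrow> int) \<Rightarrow> bool" where
  "effective D \<longleftrightarrow> (\<forall>p. 0 \<le> D p)"

text \<open>\<open>B\<close> is the set of break points along the edge.\<close>

definition PL :: "('p::metric_space, 'e) mgraph \<Rightarrow> ('p \<Rightarrow> real) set" where
  "PL G = {\<phi>. continuous_on UNIV \<phi> \<and>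
     (\<forall>e\<in>edges G. \<exists>B. finite B \<and>
        (\<forall>s t. 0 \<le> s \<and> s < t \<and> t \<le> len G e \<and> {s<..<t} \<inter> B = {} \<longrightarrow>
           (\<exists>k::int. \<forall>u\<in>{s..t}. \<phi> (chart G e u) = \<phi> (chart G e s) + of_int k * (u - s))))}"

definition out_slope :: "('p, 'e) mgraph \<Rightarrow> ('p \<Rightarrow> real) \<Rightarrow> 'e \<times> real \<times> real \<Rightarrow> int" where
  "out_slope G \<phi> = (\<lambda>(e, t, d). THE k::int.
     \<forall>\<^sub>F h in at_right 0. \<phi> (chart G e (t + d * h)) = \<phi> (chart G e t) + of_int k * h)"

text \<open>The incoming slope along a tangent direction is minus the outgoing one, so concave kinks,
  as created by minima, contribute positively.\<close>

definition div_of :: "('p, 'e) mgraph \<Rightarrow> ('p \<Rightarrow> real) \<Rightarrow> 'p \<Rightarrow> int" where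
  "div_of G \<phi> p = (\<Sum>\<tau>\<in>tangents G p. - out_slope G \<phi> \<tau>)"

definition plus_div :: "('p, 'e) mgraph \<Rightarrow> ('p \<Rightarrow> int) \<Rightarrow> ('p \<Rightarrow> real) \<Rightarrow> 'p \<Rightarrow> int" where
  "plus_div G D \<phi> = (\<lambda>p. D p + div_of G \<phi> p)"

definition RD :: "('p::metric_space, 'e) mgraph \<Rightarrow> ('p \<Rightarrow> int) \<Rightarrow> ('p \<Rightarrow> real) set" where
  "RD G D = {\<phi> \<in> PL G. effective (plus_div G D \<phi>)}"

section \<open>Tropical linear series\<close>

text \<open>Submodules of \<open>R(D)\<close> are represented by their sets of real-valued functions; the tacit zero
  element is not a member, and is made explicit by \<open>adjoin_infty\<close> where it matters.\<close>

definition tropical_submodule ::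
    "('p::metric_space, 'e) mgraph \<Rightarrow> ('p \<Rightarrow> int) \<Rightarrow> ('p \<Rightarrow> real) set \<Rightarrow> bool" where
  "tropical_submodule G D \<Sigma> \<longleftrightarrow> \<Sigma> \<subseteq> RD G D \<and>
     (\<forall>\<phi>\<in>\<Sigma>. \<forall>\<psi>\<in>\<Sigma>. (\<lambda>x. min (\<phi> x) (\<psi> x)) \<in> \<Sigma>) \<and>
     (\<forall>\<phi>\<in>\<Sigma>. \<forall>c. (\<lambda>x. \<phi> x + c) \<in> \<Sigma>)"

definition finitely_generated :: "('p \<Rightarrow> real) set \<Rightarrow> bool" where
  "finitely_generated \<Sigma> \<longleftrightarrow> (\<exists>B. finite B \<and>
     \<Sigma> = {(\<lambda>x. Min ((\<lambda>\<phi>. \<phi> x + a \<phi>) ` S)) | S a. S \<subseteq> B \<and> S \<noteq> {}})"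

definition bn_property ::
    "('p, 'e) mgraph \<Rightarrow> ('p \<Rightarrow> int) \<Rightarrow> ('p \<Rightarrow> real) set \<Rightarrow> int \<Rightarrow> bool" where
  "bn_property G D \<Sigma> k \<longleftrightarrow>
     (\<forall>D'. divisor D' \<and> effective D' \<and> degree D' = k \<longrightarrow>
        (\<exists>\<phi>\<in>\<Sigma>. effective (\<lambda>p. D p - D' p + div_of G \<phi> p)))"

definition is_r_BN ::
    "('p, 'e) mgraph \<Rightarrow> ('p \<Rightarrow> int) \<Rightarrow> ('p \<Rightarrow> real) set \<Rightarrow> int \<Rightarrow> bool" where
  "is_r_BN G D \<Sigma> r \<longleftrightarrow> bn_property G D \<Sigma> r \<and> (\<forall>k. bn_property G D \<Sigma> k \<longrightarrow> k \<le> r)"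

definition tropically_dependent :: "('p \<Rightarrow> real) set \<Rightarrow> bool" where
  "tropically_dependent S \<longleftrightarrow> (\<exists>a :: ('p \<Rightarrow> real) \<Rightarrow> real. \<forall>x.
     \<exists>\<phi>\<in>S. \<exists>\<psi>\<in>S. \<phi> \<noteq> \<psi> \<and> \<phi> x + a \<phi> = \<psi> x + a \<psi> \<and>
       (\<forall>\<theta>\<in>S. \<phi> x + a \<phi> \<le> \<theta> x + a \<theta>))"

definition is_r_ind :: "('p \<Rightarrow> real) set \<Rightarrow> int \<Rightarrow> bool" where
  "is_r_ind \<Sigma> n \<longleftrightarrow>
     (\<exists>S \<subseteq> \<Sigma>. finite S \<and> \<not> tropically_dependent S \<and> int (card S) = n) \<and>
     (\<forall>S \<subseteq> \<Sigma>. finite S \<and> \<not> tropically_dependent S \<longrightarrow> int (card S) \<le> n)"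

definition tropical_linear_series ::
    "('p::metric_space, 'e) mgraph \<Rightarrow> ('p \<Rightarrow> int) \<Rightarrow> ('p \<Rightarrow> real) set \<Rightarrow> int \<Rightarrow> bool" where
  "tropical_linear_series G D \<Sigma> r \<longleftrightarrow>
     tropical_submodule G D \<Sigma> \<and> finitely_generated \<Sigma> \<and> is_r_BN G D \<Sigma> r \<and> is_r_ind \<Sigma> (r + 1)"

section \<open>Matroids in terms of flats\<close>

text \<open>A matroid is given by its ground set and its collection of flats. The lattice-of-flats axioms
  are not built into the type.\<close>

record 'a flat_matroid =
  ground :: "'a set"
  flats  :: "'a set set"

definition mclosure :: "'a flat_matroid \<Rightarrow> 'a set \<Rightarrow> 'a set" where
  "mclosure M A = ground M \<inter> \<Inter>{F \<in> flats M. A \<subseteq> F}"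

definition mindep :: "'a flat_matroid \<Rightarrow> 'a set \<Rightarrow> bool" where
  "mindep M I \<longleftrightarrow> I \<subseteq> ground M \<and> (\<forall>x\<in>I. x \<notin> mclosure M (I - {x}))"

definition mbasis :: "'a flat_matroid \<Rightarrow> 'a set \<Rightarrow> bool" where
  "mbasis M B \<longleftrightarrow> mindep M B \<and> (\<forall>I. mindep M I \<and> B \<subseteq> I \<longrightarrow> I = B)"

definition mrank :: "'a flat_matroid \<Rightarrow> nat" where
  "mrank M = Max {card I | I. mindep M I}"

definition nonloops :: "'a flat_matroid \<Rightarrow> 'a set" where
  "nonloops M = ground M - mclosure M {}"

definition parallel_class :: "'a flat_matroid \<Rightarrow> 'a \<Rightarrow> 'a set" where
  "parallel_class M x = {y \<in> nonloops M. mclosure M {y} = mclosure M {x}}"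

definition simplification :: "'a flat_matroid \<Rightarrow> 'a set flat_matroid" where
  "simplification M =
     \<lparr>ground = parallel_class M ` nonloops M,
      flats = {{P \<in> parallel_class M ` nonloops M. P \<subseteq> F} | F. F \<in> flats M}\<rparr>"

definition mrestrict :: "'a flat_matroid \<Rightarrow> 'a set \<Rightarrow> 'a flat_matroid" where
  "mrestrict M A = \<lparr>ground = A, flats = {F \<inter> A | F. F \<in> flats M}\<rparr>"

definition submatroid :: "'a flat_matroid \<Rightarrow> 'a flat_matroid \<Rightarrow> bool" where
  "submatroid N M \<longleftrightarrow>
     (\<exists>A \<subseteq> ground M. (\<exists>B \<subseteq> A. mbasis M B) \<and> N = mrestrict M A)"

definition matroid_iso :: "'a flat_matroid \<Rightarrow> 'b flat_matroid \<Rightarrow> bool" where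
  "matroid_iso M N \<longleftrightarrow>
     (\<exists>f. bij_betw f (ground M) (ground N) \<and> (\<lambda>F. f ` F) ` flats M = flats N)"

section \<open>Valuated matroids\<close>

text \<open>The semifield \<open>\<real> \<union> {\<infinity>}\<close> is \<open>ereal\<close> without \<open>-\<infinity>\<close>, and the coordinates are the elements of
  a finite type.\<close>

definition valuated_matroid :: "('n::finite \<Rightarrow> ereal) set \<Rightarrow> bool" where
  "valuated_matroid V \<longleftrightarrow>
     (\<forall>w\<in>V. \<forall>i. w i \<noteq> -\<infinity>) \<and>
     (\<lambda>_. \<infinity>) \<in> V \<and>
     (\<forall>w\<in>V. \<forall>w'\<in>V. (\<lambda>i. min (w i) (w' i)) \<in> V) \<and>
     (\<forall>w\<in>V. \<forall>c::real. (\<lambda>i. w i + ereal c) \<in> V) \<and>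
     (\<forall>w\<in>V. \<forall>w'\<in>V. \<forall>i. w i = w' i \<longrightarrow>
        (\<exists>w''\<in>V. w'' i = \<infinity> \<and>
           (\<forall>j. j \<noteq> i \<longrightarrow> min (w j) (w' j) \<le> w'' j \<and>
                  (w j \<noteq> w' j \<longrightarrow> w'' j = min (w j) (w' j)))))"

definition underlying_matroid :: "('n \<Rightarrow> ereal) set \<Rightarrow> 'n flat_matroid" where
  "underlying_matroid V = \<lparr>ground = UNIV, flats = {- {i. w i \<noteq> \<infinity>} | w. w \<in> V}\<rparr>"

definition vm_rank :: "('n \<Rightarrow> ereal) set \<Rightarrow> nat" where
  "vm_rank V = mrank (underlying_matroid V)"

text \<open>The coordinates that remain after discarding those in which all of \<open>V\<close> is infinite.\<close>

definition live_coords :: "('n \<Rightarrow> ereal) set \<Rightarrow> 'n set" where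
  "live_coords V = {i. \<exists>w\<in>V. w i \<noteq> \<infinity>}"

text \<open>Only meaningful for \<open>w \<in> V\<close> that is finite on \<open>live_coords V\<close>. The conditions on \<open>w'\<close> say
  that \<open>w' - w\<close> has finite nonnegative entries there.\<close>

definition initial_matroid :: "('n \<Rightarrow> ereal) set \<Rightarrow> ('n \<Rightarrow> ereal) \<Rightarrow> 'n flat_matroid" where
  "initial_matroid V w =
     \<lparr>ground = live_coords V,
      flats = {{i \<in> live_coords V. w' i \<noteq> w i} | w'.
                 w' \<in> V \<and> (\<forall>i\<in>live_coords V. w i \<le> w' i \<and> w' i \<noteq> \<infinity>)}\<rparr>"

section \<open>Parametrizations\<close>

definition embed :: "('p \<Rightarrow> real) \<Rightarrow> 'p \<Rightarrow> ereal" where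
  "embed \<phi> = (\<lambda>x. ereal (\<phi> x))"

definition adjoin_infty :: "('p \<Rightarrow> real) set \<Rightarrow> ('p \<Rightarrow> ereal) set" where
  "adjoin_infty \<Sigma> = insert (\<lambda>_. \<infinity>) (embed ` \<Sigma>)"

definition tropical_hom ::
    "('n \<Rightarrow> ereal) set \<Rightarrow> (('n \<Rightarrow> ereal) \<Rightarrow> 'p \<Rightarrow> ereal) \<Rightarrow> bool" where
  "tropical_hom V \<pi> \<longleftrightarrow>
     (\<forall>w\<in>V. \<forall>w'\<in>V. \<pi> (\<lambda>i. min (w i) (w' i)) = (\<lambda>x. min (\<pi> w x) (\<pi> w' x))) \<and>
     (\<forall>w\<in>V. \<forall>c::real. \<pi> (\<lambda>i. w i + ereal c) = (\<lambda>x. \<pi> w x + ereal c)) \<and>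
     \<pi> (\<lambda>_. \<infinity>) = (\<lambda>_. \<infinity>)"

definition parametrization ::
    "('n::finite \<Rightarrow> ereal) set \<Rightarrow> (('n \<Rightarrow> ereal) \<Rightarrow> 'p \<Rightarrow> ereal) \<Rightarrow> ('p \<Rightarrow> real) set
      \<Rightarrow> int \<Rightarrow> bool" where
  "parametrization V \<pi> \<Sigma> r \<longleftrightarrow>
     valuated_matroid V \<and> int (vm_rank V) = r + 1 \<and>
     tropical_hom V \<pi> \<and> \<pi> ` V = adjoin_infty \<Sigma>"

text \<open>The subset carries the uniform topology, which is the topology of bounded continuous
  functions; the function type itself would carry the topology of pointwise convergence. The
  target carries the product topology.\<close>

definition continuous_wrt_uniform ::
    "('p::metric_space \<Rightarrow> real) set \<Rightarrow> (('p \<Rightarrow> real) \<Rightarrow> 'n \<Rightarrow> ereal) \<Rightarrow> bool" where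
  "continuous_wrt_uniform S \<sigma> \<longleftrightarrow>
     continuous_on {f :: 'p \<Rightarrow>\<^sub>C real. apply_bcontfun f \<in> S} (\<lambda>f. \<sigma> (apply_bcontfun f))"

definition continuous_section ::
    "('n \<Rightarrow> ereal) set \<Rightarrow> (('n \<Rightarrow> ereal) \<Rightarrow> 'p::metric_space \<Rightarrow> ereal) \<Rightarrow> ('p \<Rightarrow> real) set
      \<Rightarrow> (('p \<Rightarrow> real) \<Rightarrow> 'n \<Rightarrow> ereal) \<Rightarrow> bool" where
  "continuous_section V \<pi> S \<sigma> \<longleftrightarrow>
     (\<forall>\<phi>\<in>S. \<sigma> \<phi> \<in> V \<and> \<pi> (\<sigma> \<phi>) = embed \<phi>) \<and> continuous_wrt_uniform S \<sigma>"

section \<open>Nondegenerate divisors and local matroids\<close>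

text \<open>The quotient topology on \<open>Sym\<^sup>d\<close>, whose points are the divisors that are sums of \<open>d\<close> points.\<close>

definition divisor_of_tuple :: "nat \<Rightarrow> (nat \<Rightarrow> 'p) \<Rightarrow> 'p \<Rightarrow> int" where
  "divisor_of_tuple d x = (\<lambda>p. int (card {i \<in> {..<d}. x i = p}))"

definition power_topology :: "nat \<Rightarrow> (nat \<Rightarrow> 'p::topological_space) topology" where
  "power_topology d = product_topology (\<lambda>_. euclidean) {..<d}"

definition Sym_topology :: "nat \<Rightarrow> ('p::topological_space \<Rightarrow> int) topology" where
  "Sym_topology d = topology (\<lambda>U.
     U \<subseteq> divisor_of_tuple d ` topspace (power_topology d) \<and>
     openin (power_topology d) {x \<in> topspace (power_topology d). divisor_of_tuple d x \<in> U})"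

lemma openin_Sym_topology:
  fixes U :: "('p::topological_space \<Rightarrow> int) set"
  shows "openin (Sym_topology d) U \<longleftrightarrow>
     U \<subseteq> divisor_of_tuple d ` topspace (power_topology d) \<and>
     openin (power_topology d) {x \<in> topspace (power_topology d). divisor_of_tuple d x \<in> U}"
proof -
  let ?X = "power_topology d :: (nat \<Rightarrow> 'p) topology"
    and ?q = "divisor_of_tuple d :: (nat \<Rightarrow> 'p) \<Rightarrow> 'p \<Rightarrow> int"
  have "istopology (\<lambda>U. U \<subseteq> ?q ` topspace ?X \<and> openin ?X {x \<in> topspace ?X. ?q x \<in> U})"
    unfolding istopology_def
  proof (intro conjI allI impI)
    fix S T
    assume "S \<subseteq> ?q ` topspace ?X \<and> openin ?X {x \<in> topspace ?X. ?q x \<in> S}"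
       and "T \<subseteq> ?q ` topspace ?X \<and> openin ?X {x \<in> topspace ?X. ?q x \<in> T}"
    moreover have "{x \<in> topspace ?X. ?q x \<in> S \<inter> T} =
        {x \<in> topspace ?X. ?q x \<in> S} \<inter> {x \<in> topspace ?X. ?q x \<in> T}" by blast
    ultimately show "S \<inter> T \<subseteq> ?q ` topspace ?X"
      and "openin ?X {x \<in> topspace ?X. ?q x \<in> S \<inter> T}" by auto
  next
    fix K
    assume K: "\<forall>S\<in>K. S \<subseteq> ?q ` topspace ?X \<and> openin ?X {x \<in> topspace ?X. ?q x \<in> S}"
    then show "\<Union>K \<subseteq> ?q ` topspace ?X" by blast
    have "{x \<in> topspace ?X. ?q x \<in> \<Union>K} = (\<Union>S\<in>K. {x \<in> topspace ?X. ?q x \<in> S})" by blast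
    with K show "openin ?X {x \<in> topspace ?X. ?q x \<in> \<Union>K}" by auto
  qed
  then show ?thesis
    unfolding Sym_topology_def by (simp add: topology_inverse')
qed

lemma topspace_Sym_topology:
  "topspace (Sym_topology d :: ('p::topological_space \<Rightarrow> int) topology) = divisor_of_tuple d ` topspace (power_topology d)"
proof -
  let ?X = "power_topology d :: (nat \<Rightarrow> 'p) topology"
    and ?q = "divisor_of_tuple d :: (nat \<Rightarrow> 'p) \<Rightarrow> 'p \<Rightarrow> int"
  have "{x \<in> topspace ?X. ?q x \<in> ?q ` topspace ?X} = topspace ?X" by auto
  then have "openin (Sym_topology d) (?q ` topspace ?X)"
    unfolding openin_Sym_topology by (metis openin_topspace order_refl)
  then show ?thesis
    by (metis openin_Sym_topology openin_subset openin_topspace subset_antisym)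
qed

lemma quotient_map_Sym_topology:
  "quotient_map (power_topology d) (Sym_topology d) (divisor_of_tuple d)"
  unfolding quotient_map_def topspace_Sym_topology by (auto simp: openin_Sym_topology)

definition local_max_on :: "'a topology \<Rightarrow> 'a set \<Rightarrow> ('a \<Rightarrow> 'b::linorder) \<Rightarrow> 'a \<Rightarrow> bool" where
  "local_max_on T A f a \<longleftrightarrow>
     a \<in> A \<and> (\<exists>U. openin (subtopology T A) U \<and> a \<in> U \<and> (\<forall>b\<in>U. f b \<le> f a))"

definition local_min_on :: "'a topology \<Rightarrow> 'a set \<Rightarrow> ('a \<Rightarrow> 'b::linorder) \<Rightarrow> 'a \<Rightarrow> bool" where
  "local_min_on T A f a \<longleftrightarrow>
     a \<in> A \<and> (\<exists>U. openin (subtopology T A) U \<and> a \<in> U \<and> (\<forall>b\<in>U. f a \<le> f b))"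

definition linear_system ::
    "('p, 'e) mgraph \<Rightarrow> ('p \<Rightarrow> int) \<Rightarrow> ('p \<Rightarrow> real) set \<Rightarrow> ('p \<Rightarrow> int) set" where
  "linear_system G D \<Sigma> = plus_div G D ` \<Sigma>"

definition nondegenerate ::
    "('p::metric_space, 'e) mgraph \<Rightarrow> ('p \<Rightarrow> int) \<Rightarrow> ('p \<Rightarrow> real) set \<Rightarrow> ('p \<Rightarrow> int) \<Rightarrow> bool" where
  "nondegenerate G D \<Sigma> D' \<longleftrightarrow>
     local_max_on (Sym_topology (nat (degree D))) (linear_system G D \<Sigma>) (\<lambda>D''. card (supp D'')) D' \<and>
     local_min_on (Sym_topology (nat (degree D))) (linear_system G D \<Sigma>)
       (\<lambda>D''. \<Sum>p | valence G p = 1. D'' p) D'"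

definition min_set :: "('p \<Rightarrow> real) \<Rightarrow> 'p set" where
  "min_set \<psi> = {x. \<forall>y. \<psi> x \<le> \<psi> y}"

definition local_matroid ::
    "('p::metric_space \<Rightarrow> int) \<Rightarrow> ('p \<Rightarrow> real) set \<Rightarrow> 'p set flat_matroid" where
  "local_matroid D' \<Sigma>' =
     \<lparr>ground = components (- supp D'),
      flats = insert (components (- supp D'))
                {{S \<in> components (- supp D'). \<not> S \<subseteq> min_set \<psi>} | \<psi>. \<psi> \<in> \<Sigma>'}\<rparr>"

definition shifted_series :: "('p \<Rightarrow> real) set \<Rightarrow> ('p \<Rightarrow> real) \<Rightarrow> ('p \<Rightarrow> real) set" where
  "shifted_series \<Sigma> \<phi> = {\<phi>'. (\<lambda>x. \<phi> x + \<phi>' x) \<in> \<Sigma>}"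

definition nondegenerate_locus ::
    "('p::metric_space, 'e) mgraph \<Rightarrow> ('p \<Rightarrow> int) \<Rightarrow> ('p \<Rightarrow> real) set \<Rightarrow> ('p \<Rightarrow> real) set" where
  "nondegenerate_locus G D \<Sigma> = {\<phi> \<in> \<Sigma>. nondegenerate G D \<Sigma> (plus_div G D \<phi>)}"

end

theory Submission
  imports Defs
begin

text \<open>
  The section sends \<open>\<phi>\<close> to the coordinatewise least \<open>w\<close> with \<open>\<pi> w \<ge> \<phi>\<close>; it exists and is continuous
  on all of \<open>\<Sigma>\<close> because \<open>V\<close> is generated by finitely many vectors. Evaluation of \<open>\<pi>\<close> at a point \<open>x\<close>
  is a tropical linear functional, so near \<open>w\<close> it is the minimum over a nonempty set \<open>I(x)\<close> of
  coordinates, and the flats of the local matroid are the sets of components \<open>S\<close> with \<open>I(x\<^sub>S) \<subseteq> F\<close>, where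
  \<open>F\<close> runs over the flats of the initial matroid.

  At a nondegenerate divisor a function \<open>\<psi> \<ge> 0\<close> of the shifted series with a zero vanishes on a
  whole component: otherwise the small truncation \<open>min \<psi> t\<close> would split a chip or push one off a
  leaf. With the Baker--Norine condition, any \<open>r\<close> of the sets \<open>I(x\<^sub>S)\<close> lie in a flat that does not
  contain all of them. As the initial matroid has rank at most \<open>r + 1\<close>, every \<open>I(x\<^sub>S)\<close> has
  rank one, and together they contain a basis. This gives the submatroid. For uniqueness, a coordinate
  \<open>j\<close> is avoided by a hyperplane spanned by all but one element of such a basis; moving along this
  hyperplane by \<open>t\<close> pins coordinate \<open>j\<close> of any other section, and \<open>t\<close> tends to \<open>0\<close>.
\<close>

section \<open>Matroids given by flats\<close>

text \<open>\<open>\<pi>\<close> is any surjection and may send vectors with finite entries to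
  \<open>\<infinity>\<close>. Such entries (\<open>kernel_coords\<close>) are invisible to
  \<open>\<pi>\<close>, so the section is least only off them, and the matroid argument has to run
  on the remaining live coordinates, although the theorem speaks of all of them.

  The rank of the initial matroid is bounded by carrying its independent sets over to
  \<open>underlying_matroid V\<close>, through tropical Gaussian elimination.

  Nondegeneracy enters through chip firing. Passing from \<open>\<phi>\<close> to
  \<open>\<phi> + min \<psi> t\<close> moves, for every direction in which \<open>\<psi>\<close>
  leaves its zero set with slope \<open>s\<close>, exactly \<open>s\<close> chips from the zero set
  to height \<open>t\<close>. The same count shows that for small \<open>t\<close> these truncations
  are themselves nondegenerate, so a competing section is defined along them; otherwise the limit
  \<open>t \<rightarrow> 0\<close> would say nothing about it.

  A one-point graph carrying a chip has no direction to fire in. It is excluded by comparing its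
  Baker-Norine rank with its independence rank.\<close>

lemma mclosure_iff: "x \<in> mclosure M A \<longleftrightarrow> x \<in> ground M \<and> (\<forall>F\<in>flats M. A \<subseteq> F \<longrightarrow> x \<in> F)"
  unfolding mclosure_def by auto

lemma mclosure_mono: "A \<subseteq> B \<Longrightarrow> mclosure M A \<subseteq> mclosure M B"
  unfolding mclosure_def by blast

lemma mclosure_idem: "A \<subseteq> mclosure M B \<Longrightarrow> mclosure M A \<subseteq> mclosure M B"
  unfolding subset_iff mclosure_iff by meson

lemma subset_mclosure: "A \<subseteq> ground M \<Longrightarrow> A \<subseteq> mclosure M A"
  by (auto simp: mclosure_iff)

text \<open>\<open>mclosure\<close> is an intersection of flats within the ground set, so it is
  monotone and idempotent for any collection of sets; exchange is the matroid axiom with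
  content.\<close>

locale exchange_matroid =
  fixes M :: "'a flat_matroid"
  assumes finite_ground: "finite (ground M)"
    and exchange: "\<lbrakk>A \<subseteq> ground M; x \<in> ground M; y \<in> mclosure M (insert x A); y \<notin> mclosure M A\<rbrakk>
          \<Longrightarrow> x \<in> mclosure M (insert y A)"
    and loopless: "{} \<in> flats M"
begin

lemma mclosure_empty: "mclosure M {} = {}"
  using loopless by (auto simp: mclosure_iff)

lemma mindep_insert:
  assumes "mindep M I" "x \<in> ground M" "x \<notin> mclosure M I"
  shows "mindep M (insert x I)"
  unfolding mindep_def
proof (intro conjI ballI)
  have I: "I \<subseteq> ground M" using assms by (auto simp: mindep_def)
  show "insert x I \<subseteq> ground M" using I assms by auto
  fix y assume y: "y \<in> insert x I"
  show "y \<notin> mclosure M (insert x I - {y})"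
  proof (cases "y = x")
    case True
    then show ?thesis using assms(3) mclosure_mono[of "insert x I - {x}" I M] by auto
  next
    case False
    then have yI: "y \<in> I" using y by auto
    have xI: "x \<notin> I" using subset_mclosure[OF I] assms(3) by auto
    have "insert x I - {y} = insert x (I - {y})" using False by auto
    moreover have "insert y (I - {y}) = I" using yI by auto
    moreover have "y \<notin> mclosure M (I - {y})" using assms(1) yI by (auto simp: mindep_def)
    ultimately show ?thesis using exchange[of "I - {y}" x y] assms I by auto
  qed
qed

text \<open>Take \<open>C \<subseteq> B\<close> minimal with \<open>j\<close> in its closure; it is
  nonempty as there are no loops. For \<open>b \<in> C\<close>, exchange puts \<open>b\<close> into
  the closure of \<open>j\<close> and \<open>C - {b}\<close>, so \<open>j\<close> in the closure of
  \<open>B - {b}\<close> would make \<open>B\<close> dependent. This provides the hyperplane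
  avoiding \<open>j\<close> in the uniqueness proof.\<close>

lemma mindep_exchange_out:
  assumes B: "mindep M B" and j: "j \<in> mclosure M B"
  obtains b where "b \<in> B" "j \<notin> mclosure M (B - {b})"
proof -
  have BG: "B \<subseteq> ground M" using B by (auto simp: mindep_def)
  have fB: "finite B" using BG finite_ground finite_subset by blast
  have "\<exists>C\<subseteq>B. j \<in> mclosure M C \<and> (\<forall>c\<in>C. j \<notin> mclosure M (C - {c}))"
    using fB j
  proof (induction B rule: finite_psubset_induct)
    case (psubset B)
    show ?case
    proof (cases "\<exists>c\<in>B. j \<in> mclosure M (B - {c})")
      case True
      then obtain c where c: "c \<in> B" "j \<in> mclosure M (B - {c})" by blast
      have "B - {c} \<subset> B" using c by auto
      then have "\<exists>C\<subseteq>B - {c}. j \<in> mclosure M C \<and> (\<forall>c\<in>C. j \<notin> mclosure M (C - {c}))"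
        using psubset.IH c(2) by blast
      then show ?thesis by blast
    qed (use psubset.prems in blast)
  qed
  then obtain C where C: "C \<subseteq> B" "j \<in> mclosure M C" "\<forall>c\<in>C. j \<notin> mclosure M (C - {c})" by blast
  have "C \<noteq> {}" using C(2) mclosure_empty by auto
  then obtain b where b: "b \<in> C" by blast
  have "insert b (C - {b}) = C" using b by auto
  then have "b \<in> mclosure M (insert j (C - {b}))"
    using exchange[of "C - {b}" b j] C b BG by auto
  moreover have "insert j (C - {b}) \<subseteq> mclosure M (B - {b})" if "j \<in> mclosure M (B - {b})"
    using that subset_mclosure[of "B - {b}" M] BG C(1) by auto
  moreover have "b \<notin> mclosure M (B - {b})" using B b C(1) by (auto simp: mindep_def)
  ultimately have "j \<notin> mclosure M (B - {b})"
    using mclosure_idem[of "insert j (C - {b})" M "B - {b}"] by blast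
  then show ?thesis using that b C(1) by blast
qed

end

text \<open>\<open>E\<close> will be the set of components, \<open>J S\<close> the set
  \<open>I(x)\<close> at a point of \<open>S\<close>, and \<open>n\<close> the number
  \<open>r + 1\<close>; \<open>flat_extend\<close> is the Baker-Norine condition as seen by flats. A
  second instance takes the singletons \<open>{rep S}\<close> as \<open>J S\<close>.\<close>

locale indexed_matroid = exchange_matroid M for M :: "'a flat_matroid" +
  fixes E :: "'b set" and J :: "'b \<Rightarrow> 'a set" and n :: nat
  assumes J: "S \<in> E \<Longrightarrow> J S \<subseteq> ground M" "S \<in> E \<Longrightarrow> J S \<noteq> {}"
    and rank_le: "mindep M I \<Longrightarrow> card I \<le> n"
    and flat_extend: "\<lbrakk>\<S> \<subseteq> E; finite \<S>; card \<S> < n\<rbrakk>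
          \<Longrightarrow> \<exists>F\<in>flats M. (\<forall>S\<in>\<S>. J S \<subseteq> F) \<and> (\<exists>S\<in>E. \<not> J S \<subseteq> F)"
begin

text \<open>A flat that contains \<open>J S\<close> for all \<open>S\<close> in \<open>\<S>\<close>
  contains \<open>I\<close>; an element of a further \<open>J S\<close> outside it enlarges
  \<open>I\<close>, and that \<open>S\<close> joins \<open>\<S>\<close>. Both cardinalities grow by
  one until \<open>card \<S> = n\<close>, so a head start of \<open>I\<close> over
  \<open>\<S>\<close> survives to the end.\<close>

lemma greedy:
  assumes "\<S> \<subseteq> E" "finite \<S>" "card \<S> \<le> n" "mindep M I" "I \<subseteq> (\<Union>S\<in>\<S>. J S)"
  shows "\<exists>I'. mindep M I' \<and> I' \<subseteq> (\<Union>S\<in>E. J S) \<and> card I' = card I + (n - card \<S>)"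
  using assms
proof (induction "n - card \<S>" arbitrary: \<S> I)
  case 0
  then have "I \<subseteq> (\<Union>S\<in>E. J S)" by blast
  then show ?case using 0 by (intro exI[of _ I]) simp
next
  case (Suc k)
  then have "card \<S> < n" by linarith
  then obtain F S where F: "F \<in> flats M" "\<forall>S\<in>\<S>. J S \<subseteq> F" "S \<in> E" "\<not> J S \<subseteq> F"
    using flat_extend[OF Suc.prems(1,2)] by blast
  then obtain x where x: "x \<in> J S" "x \<notin> F" by blast
  have IF: "I \<subseteq> F" using Suc.prems(5) F(2) by blast
  then have "x \<notin> mclosure M I" using F(1) x by (auto simp: mclosure_iff)
  then have ind: "mindep M (insert x I)" using mindep_insert Suc.prems(4) J(1) F(3) x(1) by blast
  have "S \<notin> \<S>" using F by blast
  then have c: "card (insert S \<S>) = Suc (card \<S>)" using Suc.prems by simp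
  have "finite I" using Suc.prems(4) finite_ground finite_subset by (auto simp: mindep_def)
  then have ci: "card (insert x I) = Suc (card I)" using IF x(2) by (subst card_insert_disjoint) auto
  have "\<exists>I'. mindep M I' \<and> I' \<subseteq> (\<Union>S\<in>E. J S) \<and>
      card I' = card (insert x I) + (n - card (insert S \<S>))"
    using Suc.hyps(2) Suc.prems F x c ind by (intro Suc.hyps(1)) auto
  then show ?case using c ci Suc.hyps(2) by auto
qed

text \<open>If some \<open>J S\<close> had rank at least two, the greedy construction started from two independent
  elements of \<open>J S\<close> would exceed the rank bound.\<close>

lemma J_rank_one:
  assumes S: "S \<in> E" and i: "i \<in> J S"
  shows "J S \<subseteq> mclosure M {i}"
proof
  fix j assume j: "j \<in> J S"
  show "j \<in> mclosure M {i}"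
  proof (rule ccontr)
    assume nj: "j \<notin> mclosure M {i}"
    have e: "mindep M {}" by (simp add: mindep_def)
    have 1: "mindep M {i}" using mindep_insert[OF e, of i] J S i mclosure_empty by auto
    then have 2: "mindep M {j, i}" using mindep_insert[of "{i}" j] J S j nj by auto
    have "i \<noteq> j" using nj subset_mclosure[of "{i}" M] J S i by auto
    then have c: "card {j, i} = 2" by auto
    have "1 \<le> n" using rank_le[OF 1] by simp
    then have "\<exists>I'. mindep M I' \<and> I' \<subseteq> (\<Union>S\<in>E. J S) \<and> card I' = card {j, i} + (n - card {S})"
      using S i j 2 by (intro greedy) auto
    then show False using rank_le c \<open>1 \<le> n\<close> by fastforce
  qed
qed

text \<open>The outer choice depends on \<open>S\<close> only through the closure of one element of
  \<open>J S\<close>, so all \<open>S\<close> with the same closure receive the same representative.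
  This is what makes \<open>rep_eq_iff\<close> true.\<close>

definition rep :: "'b \<Rightarrow> 'a" where
  "rep S = (SOME i. i \<in> ground M \<and> mclosure M {i} = mclosure M {SOME i. i \<in> J S})"

lemma rep:
  assumes "S \<in> E"
  shows "rep S \<in> ground M" "mclosure M {rep S} = mclosure M {SOME i. i \<in> J S}"
proof -
  have "(SOME i. i \<in> J S) \<in> J S" using J(2)[OF assms] by (simp add: some_in_eq)
  then have "\<exists>i. i \<in> ground M \<and> mclosure M {i} = mclosure M {SOME i. i \<in> J S}"
    using J(1)[OF assms] by blast
  from someI_ex[OF this] show "rep S \<in> ground M" "mclosure M {rep S} = mclosure M {SOME i. i \<in> J S}"
    unfolding rep_def by auto
qed

text \<open>As \<open>J S\<close> has rank one, a flat that contains one of its elements, or an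
  element parallel to it, contains all of them.\<close>

lemma rep_in_flat_iff:
  assumes "S \<in> E" "F \<in> flats M"
  shows "rep S \<in> F \<longleftrightarrow> J S \<subseteq> F"
proof -
  let ?i = "SOME i. i \<in> J S"
  have i: "?i \<in> J S" using J(2)[OF assms(1)] by (simp add: some_in_eq)
  then have "?i \<in> mclosure M {rep S}" "rep S \<in> mclosure M {?i}"
    using rep[OF assms(1)] subset_mclosure[of "{?i}" M] subset_mclosure[of "{rep S}" M]
      J(1)[OF assms(1)] by auto
  then have "rep S \<in> F \<longleftrightarrow> ?i \<in> F" using assms(2) by (auto simp: mclosure_iff)
  also have "\<dots> \<longleftrightarrow> J S \<subseteq> F"
    using i J_rank_one[OF assms(1) i] assms(2) by (auto simp: mclosure_iff subset_iff)
  finally show ?thesis .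
qed

lemma rep_eq_iff:
  assumes "S \<in> E" "S' \<in> E"
  shows "rep S = rep S' \<longleftrightarrow> mclosure M {rep S} = mclosure M {rep S'}"
proof
  assume "mclosure M {rep S} = mclosure M {rep S'}"
  then have "mclosure M {SOME i. i \<in> J S} = mclosure M {SOME i. i \<in> J S'}"
    using rep(2) assms by metis
  then show "rep S = rep S'" unfolding rep_def by (simp only:)
qed (simp only:)

lemma rep_basis:
  obtains B where "B \<subseteq> rep ` E" "mbasis M B" "card B = n" "mclosure M B = ground M"
proof -
  \<comment> \<open>The greedy construction is repeated with singletons, so that the basis it finds
    consists of representatives.\<close>
  interpret reps: indexed_matroid M E "\<lambda>S. {rep S}" n
  proof
    fix \<S> assume "\<S> \<subseteq> E" "finite \<S>" "card \<S> < n"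
    then show "\<exists>F\<in>flats M. (\<forall>S\<in>\<S>. {rep S} \<subseteq> F) \<and> (\<exists>S\<in>E. \<not> {rep S} \<subseteq> F)"
      using flat_extend[of \<S>] rep_in_flat_iff by (fastforce simp: subset_iff)
  qed (use rep rank_le in auto)
  have e: "mindep M {}" by (simp add: mindep_def)
  obtain B where B: "mindep M B" "B \<subseteq> (\<Union>S\<in>E. {rep S})" "card B = n"
    using reps.greedy[of "{}" "{}"] e by auto
  have "x \<in> mclosure M B" if "x \<in> ground M" for x
  proof (rule ccontr)
    assume x: "x \<notin> mclosure M B"
    have BG: "B \<subseteq> ground M" using B by (simp add: mindep_def)
    then have "x \<notin> B" using x subset_mclosure by blast
    moreover have "finite B" using BG finite_ground finite_subset by blast
    ultimately have "card (insert x B) = Suc n" using B(3) by simp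
    then show False using rank_le[OF mindep_insert[OF B(1) that x]] by simp
  qed
  then have cl: "mclosure M B = ground M" by (auto simp: mclosure_iff)
  have "mbasis M B" unfolding mbasis_def
  proof (intro conjI allI impI B(1))
    fix I assume I: "mindep M I \<and> B \<subseteq> I"
    then have "finite I" using finite_ground finite_subset by (auto simp: mindep_def)
    then show "I = B" using I B(3) rank_le[of I] card_seteq[of I B] by auto
  qed
  then show ?thesis using that[of B] B cl by auto
qed

text \<open>In terms of \<open>rep\<close>, closure in \<open>L\<close> is the preimage of closure
  in \<open>M\<close>. Hence \<open>L\<close> has no loops, its parallel classes are the fibres of
  \<open>rep\<close>, and sending a fibre to its value identifies the simplification with the
  restriction of \<open>M\<close> to the image of \<open>rep\<close>.\<close>

lemma simplification_iso:
  assumes LG: "ground L = E" and LF: "flats L = {{S \<in> E. J S \<subseteq> F} | F. F \<in> flats M}"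
  shows "\<exists>N. submatroid N M \<and> matroid_iso (simplification L) N"
proof (intro exI conjI)
  let ?A = "rep ` E"
  obtain B where "B \<subseteq> ?A" "mbasis M B" using rep_basis by blast
  then have "\<exists>B\<subseteq>?A. mbasis M B" by blast
  moreover have "?A \<subseteq> ground M" using rep(1) by blast
  ultimately show "submatroid (mrestrict M ?A) M"
    unfolding submatroid_def by - (rule exI[of _ ?A], simp)
  have "{S \<in> E. J S \<subseteq> F} = {S \<in> E. rep S \<in> F}" if "F \<in> flats M" for F
    using rep_in_flat_iff that by blast
  then have LF': "flats L = (\<lambda>F. {S \<in> E. rep S \<in> F}) ` flats M"
    unfolding LF Setcompr_eq_image by (intro image_cong) simp_all
  have cl: "mclosure L X = {S \<in> E. rep S \<in> mclosure M (rep ` X)}" if X: "X \<subseteq> E" for X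
  proof -
    have "X \<subseteq> {S \<in> E. rep S \<in> F} \<longleftrightarrow> rep ` X \<subseteq> F" for F using X by auto
    then show ?thesis
      unfolding set_eq_iff mclosure_iff LF' LG by (simp add: rep(1) cong: conj_cong)
  qed
  have nl: "nonloops L = E" unfolding nonloops_def LG using cl[of "{}"] mclosure_empty by auto
  have rin: "rep S \<in> mclosure M {rep S}" if "S \<in> E" for S
    using subset_mclosure[of "{rep S}" M] rep(1)[OF that] by auto
  have par: "parallel_class L S = {S' \<in> E. rep S' = rep S}" if S: "S \<in> E" for S
  proof -
    have "mclosure L {S'} = mclosure L {S} \<longleftrightarrow> rep S' = rep S" if S': "S' \<in> E" for S'
    proof
      assume eq: "mclosure L {S'} = mclosure L {S}"
      have "rep S' \<in> mclosure M {rep S}" "rep S \<in> mclosure M {rep S'}"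
        using eq cl[of "{S}"] cl[of "{S'}"] S S' rin by auto
      then have "mclosure M {rep S} = mclosure M {rep S'}"
        using mclosure_idem[of "{rep S}" M "{rep S'}"] mclosure_idem[of "{rep S'}" M "{rep S}"] by auto
      then show "rep S' = rep S" using rep_eq_iff[OF S S'] by simp
    qed (use cl[of "{S}"] cl[of "{S'}"] S S' in auto)
    then show ?thesis unfolding parallel_class_def nl by auto
  qed
  let ?P = "\<lambda>i. {S \<in> E. rep S = i}"
  have gr: "ground (simplification L) = ?P ` ?A"
    unfolding simplification_def nl using par by (auto simp: image_iff)
  have fl: "flats (simplification L) = (\<lambda>F. ?P ` (F \<inter> ?A)) ` flats M"
  proof -
    have "{P \<in> ?P ` ?A. P \<subseteq> {S \<in> E. rep S \<in> F}} = ?P ` (F \<inter> ?A)" for F by auto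
    then show ?thesis
      using gr unfolding simplification_def LF' Setcompr_eq_image by (simp add: image_image)
  qed
  have inj: "inj_on ?P ?A" by (auto simp: inj_on_def)
  let ?f = "inv_into ?A ?P"
  have "bij_betw ?f (?P ` ?A) ?A" using inj by (simp add: bij_betw_inv_into inj_on_imp_bij_betw)
  moreover have "?f ` ?P ` (F \<inter> ?A) = F \<inter> ?A" for F
    by (rule inv_into_image_cancel[OF inj Int_lower2])
  ultimately show "matroid_iso (simplification L) (mrestrict M ?A)"
    unfolding matroid_iso_def gr fl mrestrict_def
    by - (rule exI[of _ ?f], simp add: image_image[of "image ?f"] Setcompr_eq_image)
qed

end

section \<open>Valuated matroids\<close>

lemma ereal_finite_obtain:
  assumes "(x::ereal) \<noteq> \<infinity>" "x \<noteq> -\<infinity>"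
  obtains a where "x = ereal a"
  using assms by (cases x) auto

locale valuated =
  fixes V :: "('n::finite \<Rightarrow> ereal) set"
  assumes vm: "valuated_matroid V"
begin

lemma not_MInf [simp]: "w \<in> V \<Longrightarrow> w i \<noteq> -\<infinity>"
  and infty_mem: "(\<lambda>_. \<infinity>) \<in> V"
  and min_mem: "w \<in> V \<Longrightarrow> w' \<in> V \<Longrightarrow> (\<lambda>i. min (w i) (w' i)) \<in> V"
  and shift_mem: "w \<in> V \<Longrightarrow> (\<lambda>i. w i + ereal c) \<in> V"
proof -
  have "\<forall>w\<in>V. \<forall>i. w i \<noteq> -\<infinity>"
    using vm unfolding valuated_matroid_def by (elim conjE)
  moreover have "(\<lambda>_. \<infinity>) \<in> V"
    using vm unfolding valuated_matroid_def by (elim conjE)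
  moreover have "\<forall>w\<in>V. \<forall>w'\<in>V. (\<lambda>i. min (w i) (w' i)) \<in> V"
    using vm unfolding valuated_matroid_def by (elim conjE)
  moreover have "\<forall>w\<in>V. \<forall>c::real. (\<lambda>i. w i + ereal c) \<in> V"
    using vm unfolding valuated_matroid_def by (elim conjE)
  ultimately show "w \<in> V \<Longrightarrow> w i \<noteq> -\<infinity>" "(\<lambda>_. \<infinity>) \<in> V"
    "w \<in> V \<Longrightarrow> w' \<in> V \<Longrightarrow> (\<lambda>i. min (w i) (w' i)) \<in> V" "w \<in> V \<Longrightarrow> (\<lambda>i. w i + ereal c) \<in> V"
    by simp_all
qed

lemma elim:
  assumes "w \<in> V" "w' \<in> V" "w i = w' i"
  obtains u where "u \<in> V" "u i = \<infinity>" "\<And>j. j \<noteq> i \<Longrightarrow> min (w j) (w' j) \<le> u j"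
    "\<And>j. j \<noteq> i \<Longrightarrow> w j \<noteq> w' j \<Longrightarrow> u j = min (w j) (w' j)"
proof -
  have "\<forall>w\<in>V. \<forall>w'\<in>V. \<forall>i. w i = w' i \<longrightarrow>
        (\<exists>w''\<in>V. w'' i = \<infinity> \<and>
           (\<forall>j. j \<noteq> i \<longrightarrow> min (w j) (w' j) \<le> w'' j \<and>
                  (w j \<noteq> w' j \<longrightarrow> w'' j = min (w j) (w' j))))"
    using vm unfolding valuated_matroid_def by (elim conjE)
  then show ?thesis using assms that by metis
qed

lemma value_cases:
  assumes "w \<in> V" "w i \<noteq> \<infinity>"
  obtains a where "w i = ereal a"
  using assms not_MInf ereal_finite_obtain by metis

section \<open>Generation by vectors of minimal support\<close>

definition fsupp :: "('n \<Rightarrow> ereal) \<Rightarrow> 'n set" where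
  "fsupp w = {i. w i \<noteq> \<infinity>}"

lemma fsupp_cases:
  assumes "w \<in> V" "k \<in> fsupp w"
  obtains a where "w k = ereal a"
  using assms value_cases[of w k] unfolding fsupp_def by auto

text \<open>Shift \<open>v\<close> until it just touches \<open>w\<close> from above, at
  \<open>j\<close>. If it also touches at \<open>i\<close>, the shift is \<open>u\<close>. Otherwise
  eliminating \<open>j\<close> between the two keeps \<open>w i\<close>, since the entries at
  \<open>i\<close> differ, and removes \<open>j\<close> from the support.\<close>

lemma decompose:
  assumes w: "w \<in> V" and v: "v \<in> V" "fsupp v \<subset> fsupp w" "fsupp v \<noteq> {}" and i: "w i \<noteq> \<infinity>"
  obtains u where "u \<in> V" "w \<le> u" "u i = w i" "fsupp u \<subset> fsupp w"
proof -
  define m where "m = Max ((\<lambda>k. real_of_ereal (w k) - real_of_ereal (v k)) ` fsupp v)"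
  have "m \<in> (\<lambda>k. real_of_ereal (w k) - real_of_ereal (v k)) ` fsupp v"
    unfolding m_def using v(3) by (intro Max_in) auto
  then obtain j where j: "j \<in> fsupp v" "m = real_of_ereal (w j) - real_of_ereal (v j)" by blast
  let ?v = "\<lambda>k. v k + ereal m"
  have vV: "?v \<in> V" using shift_mem v by blast
  have fv: "fsupp ?v = fsupp v" unfolding fsupp_def by simp
  have le: "w k \<le> ?v k" for k
  proof (cases "k \<in> fsupp v")
    case True
    then have "k \<in> fsupp w" using v(2) by auto
    then obtain a b where "v k = ereal a" "w k = ereal b"
      using fsupp_cases[OF v(1) True] fsupp_cases[OF w] by metis
    moreover have "real_of_ereal (w k) - real_of_ereal (v k) \<le> m" unfolding m_def using True by auto
    ultimately show ?thesis by simp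
  qed (simp add: fsupp_def)
  have jw: "w j = ?v j"
  proof -
    have "j \<in> fsupp w" using v(2) j by auto
    then obtain a b where "v j = ereal a" "w j = ereal b"
      using fsupp_cases[OF v(1) j(1)] fsupp_cases[OF w] by metis
    then show ?thesis using j by simp
  qed
  show ?thesis
  proof (cases "w i = ?v i")
    case True
    then show ?thesis using that[OF vV] le fv v(2) by (auto simp: le_fun_def)
  next
    case False
    obtain u where u: "u \<in> V" "u j = \<infinity>" "\<And>k. k \<noteq> j \<Longrightarrow> min (w k) (?v k) \<le> u k"
      "\<And>k. k \<noteq> j \<Longrightarrow> w k \<noteq> ?v k \<Longrightarrow> u k = min (w k) (?v k)"
      using elim[OF w vV jw] by blast
    have wu: "w \<le> u"
    proof (rule le_funI)
      fix k show "w k \<le> u k" using u(2) u(3)[of k] le[of k] by (cases "k = j") (auto simp: min_def)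
    qed
    moreover have "u i = w i" using u(4)[of i] False jw le[of i] by (cases "i = j") (auto simp: min_def)
    moreover have "fsupp u \<subset> fsupp w"
    proof -
      have "fsupp u \<subseteq> fsupp w" using wu unfolding fsupp_def le_fun_def
        by (metis (mono_tags, lifting) mem_Collect_eq subsetI ereal_infty_less_eq(1))
      moreover have "j \<in> fsupp w" "j \<notin> fsupp u" using j v(2) u(2) unfolding fsupp_def by auto
      ultimately show ?thesis by blast
    qed
    ultimately show ?thesis using that u(1) by blast
  qed
qed

text \<open>Make the two vectors agree at \<open>i\<close> by a shift and eliminate
  \<open>i\<close>: the result is supported strictly inside \<open>fsupp w\<close>, hence nowhere. A
  coordinate in which the two differ would have kept a finite entry.\<close>

lemma minimal_unique:
  assumes w: "w \<in> V" and c: "c \<in> V" "fsupp c = fsupp w"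
    and min: "\<And>v. v \<in> V \<Longrightarrow> fsupp v \<subset> fsupp w \<Longrightarrow> fsupp v = {}" and i: "w i \<noteq> \<infinity>"
  shows "\<exists>a::real. w = (\<lambda>j. c j + ereal a)"
proof -
  have "i \<in> fsupp w" "i \<in> fsupp c" using c(2) i unfolding fsupp_def by auto
  then obtain x y where xy: "w i = ereal x" "c i = ereal y"
    using fsupp_cases[OF w] fsupp_cases[OF c(1)] by metis
  let ?c = "\<lambda>j. c j + ereal (x - y)"
  have e: "w i = ?c i" using xy by simp
  obtain u where u: "u \<in> V" "u i = \<infinity>" "\<And>k. k \<noteq> i \<Longrightarrow> min (w k) (?c k) \<le> u k"
      "\<And>k. k \<noteq> i \<Longrightarrow> w k \<noteq> ?c k \<Longrightarrow> u k = min (w k) (?c k)"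
    using elim[OF w shift_mem[OF c(1)] e] by blast
  have "k \<in> fsupp w" if "k \<in> fsupp u" for k
  proof (rule ccontr)
    assume "k \<notin> fsupp w"
    then have "w k = \<infinity>" "c k = \<infinity>" using c(2) unfolding fsupp_def by auto
    then show False using u(2) u(3)[of k] that unfolding fsupp_def by (cases "k = i") auto
  qed
  moreover have "i \<in> fsupp w" "i \<notin> fsupp u" using i u(2) unfolding fsupp_def by auto
  ultimately have "fsupp u = {}" using min[OF u(1)] by blast
  then have inf: "u k = \<infinity>" for k unfolding fsupp_def by auto
  have "w k = ?c k" for k
  proof (rule ccontr)
    assume ne: "w k \<noteq> ?c k"
    then have "k \<noteq> i" using e by auto
    then show False using u(4)[of k] ne inf[of k] by (auto simp: min_def split: if_splits)
  qed
  then show ?thesis by blast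
qed

text \<open>The generators are the vectors of minimal support, one per support.\<close>

lemma generators_exist:
  "\<exists>C. finite C \<and> C \<subseteq> V \<and> (\<forall>w\<in>V. \<forall>i. w i \<noteq> \<infinity> \<longrightarrow>
         (\<exists>c\<in>C. \<exists>a::real. w \<le> (\<lambda>j. c j + ereal a) \<and> w i = c i + ereal a))"
proof -
  define c where "c A = (SOME w. w \<in> V \<and> fsupp w = A)" for A
  define C where "C = c ` (fsupp ` V)"
  have c: "c A \<in> V" "fsupp (c A) = A" if "A \<in> fsupp ` V" for A
  proof -
    have "\<exists>w. w \<in> V \<and> fsupp w = A" using that by auto
    from someI_ex[OF this] show "c A \<in> V" "fsupp (c A) = A" unfolding c_def by auto
  qed
  have "\<exists>c\<in>C. \<exists>a::real. w \<le> (\<lambda>j. c j + ereal a) \<and> w i = c i + ereal a"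
    if "w \<in> V" "w i \<noteq> \<infinity>" for w i
    using that
  \<comment> \<open>If the support is not minimal, \<open>decompose\<close> gives a larger vector
    with the same entry at \<open>i\<close> and smaller support; a shifted generator above that
    vector is above \<open>w\<close> too and still touches it at \<open>i\<close>.\<close>
  proof (induction "card (fsupp w)" arbitrary: w rule: less_induct)
    case less
    show ?case
    proof (cases "\<exists>v\<in>V. fsupp v \<subset> fsupp w \<and> fsupp v \<noteq> {}")
      case True
      then obtain v where v: "v \<in> V" "fsupp v \<subset> fsupp w" "fsupp v \<noteq> {}" by blast
      obtain u where u: "u \<in> V" "w \<le> u" "u i = w i" "fsupp u \<subset> fsupp w"
        using decompose[OF less(2) v less(3)] by blast
      have "card (fsupp u) < card (fsupp w)" using u(4) by (intro psubset_card_mono) auto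
      then obtain d a where "d \<in> C" "u \<le> (\<lambda>j. d j + ereal a)" "u i = d i + ereal a"
        using less(1)[of u] u less(3) by auto
      then show ?thesis using u order_trans by metis
    next
      case False
      then have "\<And>v. v \<in> V \<Longrightarrow> fsupp v \<subset> fsupp w \<Longrightarrow> fsupp v = {}" by blast
      then obtain a where "w = (\<lambda>j. c (fsupp w) j + ereal a)"
        using minimal_unique[OF less(2), of "c (fsupp w)" i] c[of "fsupp w"] less by blast
      then show ?thesis unfolding C_def using less(2) by (intro bexI[of _ "c (fsupp w)"] exI[of _ a]) (auto dest: fun_cong)
    qed
  qed
  moreover have "finite C" unfolding C_def using finite_subset[of "fsupp ` V" UNIV] by auto
  moreover have "C \<subseteq> V" unfolding C_def using c by auto
  ultimately show ?thesis by blast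
qed

text \<open>The generating property in pointwise form: for every finite entry of \<open>w\<close>
  some shifted generator lies above \<open>w\<close> and touches it there, so \<open>w\<close> is a
  minimum of shifted generators.\<close>

definition generators :: "('n \<Rightarrow> ereal) set" where
  "generators = (SOME C. finite C \<and> C \<subseteq> V \<and> (\<forall>w\<in>V. \<forall>i. w i \<noteq> \<infinity> \<longrightarrow>
         (\<exists>c\<in>C. \<exists>a::real. w \<le> (\<lambda>j. c j + ereal a) \<and> w i = c i + ereal a)))"

lemma finite_generators: "finite generators"
  and generators_subset: "generators \<subseteq> V"
  and generatorsE: "w \<in> V \<Longrightarrow> w i \<noteq> \<infinity> \<Longrightarrow>
         \<exists>c\<in>generators. \<exists>a::real. w \<le> (\<lambda>j. c j + ereal a) \<and> w i = c i + ereal a"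
  using someI_ex[OF generators_exist] unfolding generators_def by blast+

lemma INF_mem:
  assumes "finite I" "\<And>k. k \<in> I \<Longrightarrow> g k \<in> V"
  shows "(\<lambda>i. INF k\<in>I. g k i) \<in> V"
  using assms
proof (induction I)
  case (insert k I)
  then show ?case using min_mem[of "g k" "\<lambda>i. INF k\<in>I. g k i"] by (simp add: inf_min)
\<comment> \<open>The empty infimum is the top element \<open>\<infinity>\<close>, which is the zero
  vector of \<open>V\<close>.\<close>
qed (simp add: infty_mem top_ereal_def)

end

section \<open>Initial matroids\<close>

text \<open>\<open>F\<close> will be \<open>live_coords V\<close> without the coordinates that \<open>\<pi>\<close> collapses to \<open>\<infinity>\<close>; only the
  rank count at the end shows that there are none.\<close>

definition initial_on :: "('n \<Rightarrow> ereal) set \<Rightarrow> ('n \<Rightarrow> ereal) \<Rightarrow> 'n set \<Rightarrow> 'n flat_matroid" where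
  "initial_on V w F =
     \<lparr>ground = F, flats = {{i \<in> F. w' i \<noteq> w i} | w'. w' \<in> V \<and> (\<forall>i\<in>F. w i \<le> w' i \<and> w' i \<noteq> \<infinity>)}\<rparr>"

lemma initial_matroid_eq: "initial_matroid V w = initial_on V w (live_coords V)"
  by (simp add: initial_matroid_def initial_on_def)

lemma ground_initial_on [simp]: "ground (initial_on V w F) = F"
  by (simp add: initial_on_def)

locale initial = valuated V for V :: "('n::finite \<Rightarrow> ereal) set" +
  fixes w :: "'n \<Rightarrow> ereal" and F :: "'n set"
  assumes w: "w \<in> V" and w_finite: "i \<in> F \<Longrightarrow> w i \<noteq> \<infinity>"
begin

text \<open>Flats are defined by vectors that are finite on \<open>F\<close>. Capping
  \<open>u\<close> by \<open>w + 1\<close> makes it finite there without changing the set where it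
  exceeds \<open>w\<close>.\<close>

lemma flatI:
  assumes u: "u \<in> V" "\<And>i. i \<in> F \<Longrightarrow> w i \<le> u i"
  shows "{i \<in> F. w i < u i} \<in> flats (initial_on V w F)"
proof -
  let ?u = "\<lambda>i. min (u i) (w i + ereal 1)"
  have "?u \<in> V" using u(1) w by (intro min_mem shift_mem)
  moreover have "w i \<le> ?u i \<and> ?u i \<noteq> \<infinity> \<and> (?u i \<noteq> w i \<longleftrightarrow> w i < u i)" if i: "i \<in> F" for i
  proof -
    obtain a where "w i = ereal a" using value_cases[OF w w_finite[OF i]] by blast
    then show ?thesis using u(2)[OF i] by (cases "u i") (auto simp: min_def)
  qed
  ultimately show ?thesis unfolding initial_on_def
    by (simp, intro exI[of _ ?u]) auto
qed

lemma flatE: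
  assumes "G \<in> flats (initial_on V w F)"
  obtains u where "u \<in> V" "\<And>i. i \<in> F \<Longrightarrow> w i \<le> u i" "\<And>i. i \<in> F \<Longrightarrow> u i \<noteq> \<infinity>" "G = {i \<in> F. w i < u i}"
proof -
  obtain u where u: "u \<in> V" "\<forall>i\<in>F. w i \<le> u i \<and> u i \<noteq> \<infinity>" "G = {i \<in> F. u i \<noteq> w i}"
    using assms unfolding initial_on_def by auto
  then have "G = {i \<in> F. w i < u i}" by force
  then show ?thesis using that u by blast
qed

sublocale exchange_matroid "initial_on V w F"
proof
  show "finite (ground (initial_on V w F))" by simp
  show "{} \<in> flats (initial_on V w F)" using flatI[OF w] by simp
  fix A x y
  let ?cl = "mclosure (initial_on V w F)"
  assume A: "A \<subseteq> ground (initial_on V w F)" and x: "x \<in> ground (initial_on V w F)"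
    and y: "y \<in> ?cl (insert x A)" "y \<notin> ?cl A"
  show "x \<in> ?cl (insert y A)"
  proof (rule ccontr)
    assume nx: "x \<notin> ?cl (insert y A)"
    have yF: "y \<in> F" using y by (simp add: mclosure_iff)
    obtain G1 where G1: "G1 \<in> flats (initial_on V w F)" "A \<subseteq> G1" "y \<notin> G1"
      using y(2) yF by (auto simp: mclosure_iff)
    obtain u1 where u1: "u1 \<in> V" "\<And>i. i \<in> F \<Longrightarrow> w i \<le> u1 i" "G1 = {i \<in> F. w i < u1 i}"
      using flatE[OF G1(1)] by metis
    obtain G2 where G2: "G2 \<in> flats (initial_on V w F)" "insert y A \<subseteq> G2" "x \<notin> G2"
      using nx x unfolding mclosure_iff by blast
    obtain u2 where u2: "u2 \<in> V" "\<And>i. i \<in> F \<Longrightarrow> w i \<le> u2 i" "G2 = {i \<in> F. w i < u2 i}"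
      using flatE[OF G2(1)] by metis
    have xF: "x \<in> F" using x by simp
    have "x \<notin> G1" using y(1) G1 by (auto simp: mclosure_iff)
    then have x1: "u1 x = w x" using u1(2)[OF xF] u1(3) xF by simp
    have x2: "u2 x = w x" using u2(2)[OF xF] u2(3) xF G2(3) by simp
    have y1: "u1 y = w y" using u1(2)[OF yF] u1(3) yF G1(3) by simp
    have y2: "w y < u2 y" using u2(3) G2(2) by simp
    \<comment> \<open>\<open>u1\<close> and \<open>u2\<close> both touch \<open>w\<close> at
      \<open>x\<close>. Eliminating \<open>x\<close> gives a flat through \<open>A\<close> and
      \<open>x\<close>; it misses \<open>y\<close>, because at \<open>y\<close> only
      \<open>u1\<close> touches \<open>w\<close>, so the smaller entry \<open>w y\<close> is
      kept.\<close>
    obtain u where u: "u \<in> V" "u x = \<infinity>" "\<And>j. j \<noteq> x \<Longrightarrow> min (u1 j) (u2 j) \<le> u j"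
      "\<And>j. j \<noteq> x \<Longrightarrow> u1 j \<noteq> u2 j \<Longrightarrow> u j = min (u1 j) (u2 j)"
      using elim[OF u1(1) u2(1), of x] x1 x2 by auto
    have "w i \<le> u i" if "i \<in> F" for i
      using u(2) u(3)[of i] u1(2)[OF that] u2(2)[OF that] by (cases "i = x") (auto simp: min_def split: if_splits)
    then have fl: "{i \<in> F. w i < u i} \<in> flats (initial_on V w F)" using flatI[OF u(1)] by blast
    moreover have "insert x A \<subseteq> {i \<in> F. w i < u i}"
    proof
      fix i assume i: "i \<in> insert x A"
      have "w i < u i"
      proof (cases "i = x")
        case True
        then show ?thesis using u(2) w_finite[of x] x by auto
      next
        case False
        then have "i \<in> G1" "i \<in> G2" using i G1 G2 by auto
        then have "w i < min (u1 i) (u2 i)" using u1 u2 by auto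
        then show ?thesis using u(3)[OF False] by (rule less_le_trans)
      qed
      then show "i \<in> {i \<in> F. w i < u i}" using i A x by auto
    qed
    ultimately have "w y < u y" using y(1) by (auto simp: mclosure_iff)
    moreover have "y \<noteq> x" using y2 x2 by auto
    then have "u y = w y" using u(4)[of y] y1 y2 by (simp add: min_def less_imp_le)
    ultimately show False by simp
  qed
qed

end

text \<open>Gaussian elimination: a family with unit diagonal and positive off-diagonal entries (relative
  to \<open>w\<close>) is tropically nonsingular.\<close>

lemma eliminate_family:
  fixes W :: "('n \<Rightarrow> ereal) set" and w :: "'n \<Rightarrow> real"
  assumes "finite J" "x \<notin> J"
    and "\<And>v i. v \<in> W \<Longrightarrow> v i \<noteq> -\<infinity>"
    and "\<And>v c. v \<in> W \<Longrightarrow> (\<lambda>i. v i + ereal c) \<in> W"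
    and "\<And>v v' i. v \<in> W \<Longrightarrow> v' \<in> W \<Longrightarrow> v i = v' i \<Longrightarrow> \<exists>u\<in>W. u i = \<infinity> \<and>
           (\<forall>j. j \<noteq> i \<longrightarrow> min (v j) (v' j) \<le> u j \<and> (v j \<noteq> v' j \<longrightarrow> u j = min (v j) (v' j)))"
    and "\<And>z. z \<in> insert x J \<Longrightarrow> g z \<in> W \<and> g z z = ereal (w z) \<and> (\<forall>j\<in>insert x J - {z}. ereal (w j) < g z j)"
  shows "\<exists>u\<in>W. u x \<noteq> \<infinity> \<and> (\<forall>j\<in>J. u j = \<infinity>)"
  using assms
proof (induction J arbitrary: W g)
  case empty
  then show ?case by (intro bexI[of _ "g x"]) auto
next
  case (insert y J)
  note noM = insert.prems(2) and sh = insert.prems(3) and el = insert.prems(4) and g = insert.prems(5)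
  \<comment> \<open>One column is cleared: the vectors with \<open>v y = \<infinity>\<close> are
    again closed under shifts and elimination. This is why the statement is about an arbitrary set
    \<open>W\<close>.\<close>
  let ?W = "{v \<in> W. v y = \<infinity>}"
  have gy: "g y \<in> W" "g y y = ereal (w y)" "\<And>j. j \<in> insert x J \<Longrightarrow> ereal (w j) < g y j"
    using g[of y] insert.hyps(2) insert.prems(1) by auto
  have ex: "\<exists>u. u \<in> ?W \<and> u z = ereal (w z) \<and> (\<forall>j\<in>insert x J - {z}. ereal (w j) < u j)"
    if z: "z \<in> insert x J" for z
  proof -
    have zy: "z \<noteq> y" using z insert.hyps(2) insert.prems(1) by auto
    have gz: "g z \<in> W" "g z z = ereal (w z)" "\<And>j. j \<in> insert x (insert y J) - {z} \<Longrightarrow> ereal (w j) < g z j"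
      using g[of z] z by auto
    show ?thesis
    proof (cases "g z y = \<infinity>")
      case True
      then show ?thesis using gz by (intro exI[of _ "g z"]) auto
    next
      case False
      then obtain b where b: "g z y = ereal b" using noM[OF gz(1)] ereal_finite_obtain by metis
      \<comment> \<open>Shifting \<open>g y\<close> by \<open>a\<close> makes it agree with
        \<open>g z\<close> at the pivot \<open>y\<close>. Since \<open>g z y > w y\<close>, the
        shift is positive, so the shifted row lies strictly above \<open>w\<close> on the remaining
        coordinates; elimination then keeps the diagonal entry at \<open>z\<close> and the
        off-diagonal inequalities.\<close>
      define a where "a = b - w y"
      have a: "a > 0" using gz(3)[of y] zy b unfolding a_def by auto
      let ?v = "\<lambda>i. g y i + ereal a"
      have "?v \<in> W" using sh gy by blast
      moreover have "g z y = ?v y" using b gy unfolding a_def by simp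
      ultimately obtain u where u: "u \<in> W" "u y = \<infinity>" "\<And>j. j \<noteq> y \<Longrightarrow> min (g z j) (?v j) \<le> u j"
        "\<And>j. j \<noteq> y \<Longrightarrow> g z j \<noteq> ?v j \<Longrightarrow> u j = min (g z j) (?v j)"
        using el[OF gz(1), of ?v y] by blast
      have v: "ereal (w j) < ?v j" if "j \<in> insert x J" for j
        using gy(3)[OF that] a by (cases "g y j") auto
      have "u z = ereal (w z)" using u(4)[OF zy] v[OF z] gz(2) by (auto simp: min_def)
      moreover have "ereal (w j) < u j" if j: "j \<in> insert x J - {z}" for j
      proof -
        have "j \<noteq> y" using j insert.hyps(2) insert.prems(1) by auto
        moreover have "ereal (w j) < min (g z j) (?v j)" using gz(3)[of j] v[of j] j by auto
        ultimately show ?thesis using u(3) less_le_trans by blast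
      qed
      ultimately show ?thesis using u by blast
    qed
  qed
  then have "\<forall>z\<in>insert x J. \<exists>u. u \<in> ?W \<and> u z = ereal (w z) \<and> (\<forall>j\<in>insert x J - {z}. ereal (w j) < u j)"
    by (rule ballI)
  from bchoice[OF this] obtain h where h: "\<forall>z\<in>insert x J. h z \<in> ?W \<and> h z z = ereal (w z) \<and> (\<forall>j\<in>insert x J - {z}. ereal (w j) < h z j)"
    by (elim exE)
  have "\<exists>u\<in>?W. u x \<noteq> \<infinity> \<and> (\<forall>j\<in>J. u j = \<infinity>)"
  proof (rule insert.IH[of ?W h])
    show "x \<notin> J" using insert.prems(1) by auto
    fix v v' i assume v: "v \<in> ?W" "v' \<in> ?W" "v i = v' i"
    then obtain u where u: "u \<in> W" "u i = \<infinity>" "\<And>j. j \<noteq> i \<Longrightarrow> min (v j) (v' j) \<le> u j"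
        "\<And>j. j \<noteq> i \<Longrightarrow> v j \<noteq> v' j \<Longrightarrow> u j = min (v j) (v' j)"
      using el[of v v' i] by blast
    have "u y = \<infinity>" using u(2) u(3)[of y] v by (cases "y = i") auto
    then show "\<exists>u\<in>?W. u i = \<infinity> \<and>
           (\<forall>j. j \<noteq> i \<longrightarrow> min (v j) (v' j) \<le> u j \<and> (v j \<noteq> v' j \<longrightarrow> u j = min (v j) (v' j)))"
      using u by blast
  qed (use noM sh h in auto)
  then show ?case by auto
qed

lemma mclosure_underlying:
  "x \<notin> mclosure (underlying_matroid V) A \<longleftrightarrow> (\<exists>u\<in>V. u x \<noteq> \<infinity> \<and> (\<forall>j\<in>A. u j = \<infinity>))"
  unfolding mclosure_iff underlying_matroid_def by (auto simp: subset_iff)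

lemma mindep_card_le_vm_rank:
  fixes V :: "('n::finite \<Rightarrow> ereal) set"
  assumes "mindep (underlying_matroid V) I"
  shows "card I \<le> vm_rank V"
  unfolding vm_rank_def mrank_def
proof (rule Max_ge)
  have "{card I |I. mindep (underlying_matroid V) I} \<subseteq> card ` (UNIV :: 'n set set)" by auto
  then show "finite {card I |I. mindep (underlying_matroid V) I}" by (rule finite_subset) auto
qed (use assms in auto)

text \<open>Independence provides for each \<open>z\<close> in \<open>I\<close> a flat through
  \<open>I - {z}\<close> missing \<open>z\<close>, that is, a row touching \<open>w\<close> on
  \<open>I\<close> exactly at \<open>z\<close>. Elimination turns such rows into vectors with a
  single finite entry on \<open>I\<close>. Hence the rank of the initial matroid is at most
  \<open>vm_rank V\<close>.\<close>

lemma (in initial) mindep_underlying: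
  assumes I: "mindep (initial_on V w F) I"
  shows "mindep (underlying_matroid V) I"
  unfolding mindep_def
proof (intro conjI ballI)
  show "I \<subseteq> ground (underlying_matroid V)" by (simp add: underlying_matroid_def)
  have IF: "I \<subseteq> F" using I by (simp add: mindep_def)
  have ex: "\<exists>u. u \<in> V \<and> u z = ereal (real_of_ereal (w z)) \<and> (\<forall>j\<in>I - {z}. ereal (real_of_ereal (w j)) < u j)"
    if z: "z \<in> I" for z
  proof -
    have "z \<notin> mclosure (initial_on V w F) (I - {z})" using I z by (simp add: mindep_def)
    then obtain G where G: "G \<in> flats (initial_on V w F)" "I - {z} \<subseteq> G" "z \<notin> G"
      using z IF unfolding mclosure_iff by auto
    obtain u where u: "u \<in> V" "\<And>i. i \<in> F \<Longrightarrow> w i \<le> u i" "G = {i \<in> F. w i < u i}"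
      using flatE[OF G(1)] by metis
    have r: "ereal (real_of_ereal (w j)) = w j" if "j \<in> I" for j
      using that IF w_finite not_MInf[OF w] by (intro ereal_real') auto
    have "u z = w z" using u(2)[of z] u(3) z IF G(3) by force
    moreover have "\<forall>j\<in>I - {z}. w j < u j" using G(2) u(3) by auto
    ultimately show ?thesis using u(1) r z by auto
  qed
  then have "\<forall>z\<in>I. \<exists>u. u \<in> V \<and> u z = ereal (real_of_ereal (w z)) \<and> (\<forall>j\<in>I - {z}. ereal (real_of_ereal (w j)) < u j)"
    by (rule ballI)
  from bchoice[OF this] obtain g where g: "\<forall>z\<in>I. g z \<in> V \<and> g z z = ereal (real_of_ereal (w z)) \<and>
      (\<forall>j\<in>I - {z}. ereal (real_of_ereal (w j)) < g z j)"
    by (elim exE)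
  fix x assume x: "x \<in> I"
  then have ins: "insert x (I - {x}) = I" by auto
  have "\<exists>u\<in>V. u x \<noteq> \<infinity> \<and> (\<forall>j\<in>I - {x}. u j = \<infinity>)"
  proof (rule eliminate_family[where w = "\<lambda>i. real_of_ereal (w i)" and g = g])
    fix v v' i assume "v \<in> V" "v' \<in> V" "v i = v' i"
    then obtain u where "u \<in> V" "u i = \<infinity>" "\<And>j. j \<noteq> i \<Longrightarrow> min (v j) (v' j) \<le> u j"
        "\<And>j. j \<noteq> i \<Longrightarrow> v j \<noteq> v' j \<Longrightarrow> u j = min (v j) (v' j)"
      using elim by metis
    then show "\<exists>u\<in>V. u i = \<infinity> \<and>
           (\<forall>j. j \<noteq> i \<longrightarrow> min (v j) (v' j) \<le> u j \<and> (v j \<noteq> v' j \<longrightarrow> u j = min (v j) (v' j)))"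
      by blast
  qed (use g ins shift_mem in auto)
  then show "x \<notin> mclosure (underlying_matroid V) (I - {x})" by (simp add: mclosure_underlying)
qed

section \<open>Parametrizations\<close>

locale parametrized = valuated V for V :: "('n::finite \<Rightarrow> ereal) set" +
  fixes \<pi> :: "('n \<Rightarrow> ereal) \<Rightarrow> 'p::metric_space \<Rightarrow> ereal" and \<Sigma> :: "('p \<Rightarrow> real) set"
  assumes hom: "tropical_hom V \<pi>" and surj: "\<pi> ` V = adjoin_infty \<Sigma>"
    and bounded: "\<phi> \<in> \<Sigma> \<Longrightarrow> bounded (range \<phi>)"
begin

lemma hom_min: "w \<in> V \<Longrightarrow> w' \<in> V \<Longrightarrow> \<pi> (\<lambda>i. min (w i) (w' i)) = (\<lambda>x. min (\<pi> w x) (\<pi> w' x))"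
  and hom_shift: "w \<in> V \<Longrightarrow> \<pi> (\<lambda>i. w i + ereal c) = (\<lambda>x. \<pi> w x + ereal c)"
  and hom_infty: "\<pi> (\<lambda>_. \<infinity>) = (\<lambda>_. \<infinity>)"
  using hom unfolding tropical_hom_def by blast+

lemma hom_mono:
  assumes "w \<in> V" "w' \<in> V" "w \<le> w'"
  shows "\<pi> w \<le> \<pi> w'"
proof -
  have "(\<lambda>i. min (w i) (w' i)) = w" using assms(3) by (auto simp: le_fun_def min_def)
  then have "\<pi> w x = min (\<pi> w x) (\<pi> w' x)" for x using hom_min[OF assms(1,2)] by metis
  then show ?thesis by (metis le_funI min.cobounded2)
qed

lemma hom_cases:
  assumes "w \<in> V"
  obtains "\<pi> w = (\<lambda>_. \<infinity>)" | \<phi> where "\<phi> \<in> \<Sigma>" "\<pi> w = embed \<phi>"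
  using surj assms unfolding adjoin_infty_def by blast

lemma hom_surj:
  assumes "\<phi> \<in> \<Sigma>"
  obtains w where "w \<in> V" "\<pi> w = embed \<phi>"
  using surj assms unfolding adjoin_infty_def by (metis image_eqI image_iff insertCI)

lemma hom_INF:
  assumes "finite I" "\<And>k. k \<in> I \<Longrightarrow> g k \<in> V"
  shows "\<pi> (\<lambda>i. INF k\<in>I. g k i) = (\<lambda>x. INF k\<in>I. \<pi> (g k) x)"
  using assms
proof (induction I)
  case (insert k I)
  then show ?case
    using hom_min[of "g k" "\<lambda>i. INF k\<in>I. g k i"] INF_mem[of I g] by (simp add: inf_min)
qed (simp add: hom_infty top_ereal_def)

definition kernel_coords :: "'n set" where
  "kernel_coords = {i. \<exists>v\<in>V. \<pi> v = (\<lambda>_. \<infinity>) \<and> v i \<noteq> \<infinity>}"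

text \<open>The kernel of \<open>\<pi>\<close> is closed under minima, so one kernel vector for each
  coordinate in \<open>kernel_coords\<close> combine into a single one finite on all of
  them.\<close>

lemma absorber: "\<exists>k. k \<in> V \<and> \<pi> k = (\<lambda>_. \<infinity>) \<and> (\<forall>i. k i \<noteq> \<infinity> \<longleftrightarrow> i \<in> kernel_coords)"
proof -
  have "\<forall>i\<in>kernel_coords. \<exists>v. v \<in> V \<and> \<pi> v = (\<lambda>_. \<infinity>) \<and> v i \<noteq> \<infinity>"
    unfolding kernel_coords_def by blast
  from bchoice[OF this] obtain g
    where g: "\<forall>i\<in>kernel_coords. g i \<in> V \<and> \<pi> (g i) = (\<lambda>_. \<infinity>) \<and> g i i \<noteq> \<infinity>" by (elim exE)
  let ?k = "\<lambda>i. INF j\<in>kernel_coords. g j i"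
  have "(INF j\<in>kernel_coords. \<infinity>) = (\<infinity>::ereal)"
    by (cases "kernel_coords = {}") (simp_all add: top_ereal_def)
  then have k: "?k \<in> V" "\<pi> ?k = (\<lambda>_. \<infinity>)"
    using g by (simp_all add: INF_mem hom_INF)
  moreover have "?k i \<noteq> \<infinity>" if i: "i \<in> kernel_coords" for i
  proof -
    have "?k i \<le> g i i" using i by (intro INF_lower)
    then show ?thesis using g i by auto
  qed
  moreover have "?k i = \<infinity>" if "i \<notin> kernel_coords" for i
    using that k unfolding kernel_coords_def by blast
  ultimately have "\<forall>i. ?k i \<noteq> \<infinity> \<longleftrightarrow> i \<in> kernel_coords" by blast
  then show ?thesis using k by (intro exI[of _ ?k]) simp
qed

text \<open>Very negative shifts of the absorber make the coordinates in \<open>kernel_coords\<close> irrelevant.\<close>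

lemma hom_mono_off_kernel:
  assumes w: "w \<in> V" and w': "w' \<in> V" and le: "\<And>i. i \<notin> kernel_coords \<Longrightarrow> w i \<le> w' i"
  shows "\<pi> w \<le> \<pi> w'"
proof -
  obtain k where k: "k \<in> V" "\<pi> k = (\<lambda>_. \<infinity>)" "\<forall>i. k i \<noteq> \<infinity> \<longleftrightarrow> i \<in> kernel_coords"
    using absorber by metis
  \<comment> \<open>A shift that puts \<open>k + a\<close> below \<open>w'\<close> at the finite
    entries of \<open>w'\<close> in \<open>kernel_coords\<close>; the infimum ranges over a finite
    type, and the other indices can only lower it. The minimum with \<open>k + a\<close> has the
    same image as \<open>w\<close>, since \<open>\<pi> k\<close> is constantly
    \<open>\<infinity>\<close>.\<close>
  define a where "a = (INF i. real_of_ereal (w' i) - real_of_ereal (k i))"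
  let ?u = "\<lambda>i. min (w i) (k i + ereal a)"
  have "?u i \<le> w' i" for i
  proof (cases "i \<in> kernel_coords \<and> w' i \<noteq> \<infinity>")
    case True
    have "a \<le> real_of_ereal (w' i) - real_of_ereal (k i)" unfolding a_def by (rule cINF_lower) auto
    moreover obtain x y where "w' i = ereal x" "k i = ereal y"
      using value_cases[OF w'] value_cases[OF k(1)] True k(3) by metis
    ultimately have "k i + ereal a \<le> w' i" by simp
    then show ?thesis by (simp add: min.coboundedI2)
  next
    case False
    then show ?thesis using le[of i] by (auto simp: min.coboundedI1)
  qed
  then have "\<pi> ?u \<le> \<pi> w'" using w w' k(1) by (intro hom_mono min_mem shift_mem le_funI)
  moreover have "\<pi> ?u = \<pi> w" using hom_min[OF w shift_mem[OF k(1)]] hom_shift[OF k(1)] k(2) by simp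
  ultimately show ?thesis by simp
qed

section \<open>The least section\<close>

definition rho :: "('n \<Rightarrow> ereal) \<Rightarrow> 'p \<Rightarrow> real" where
  "rho c = (\<lambda>x. real_of_ereal (\<pi> c x))"

definition proper_gens :: "('n \<Rightarrow> ereal) set" where
  "proper_gens = {c \<in> generators. \<pi> c \<noteq> (\<lambda>_. \<infinity>)}"

text \<open>The supremum of \<open>\<phi> - rho c\<close> is the least shift of \<open>c\<close>
  whose image lies above \<open>\<phi>\<close>, so this is the residual of \<open>\<pi>\<close>:
  each generator is shifted as little as possible and the minimum is taken. Generators in the kernel
  are left out, as every shift of them lies above \<open>\<phi>\<close> and there is no least
  one.\<close>

definition least_section :: "('p \<Rightarrow> real) \<Rightarrow> 'n \<Rightarrow> ereal" where
  "least_section \<phi> = (\<lambda>i. INF c\<in>proper_gens. c i + ereal (SUP x. \<phi> x - rho c x))"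

lemma proper_gens: "finite proper_gens" "c \<in> proper_gens \<Longrightarrow> c \<in> V"
  using finite_generators generators_subset unfolding proper_gens_def by auto

lemma rho:
  assumes "c \<in> proper_gens"
  shows "\<pi> c = embed (rho c)" "bounded (range (rho c))"
proof -
  have "c \<in> V" "\<pi> c \<noteq> (\<lambda>_. \<infinity>)" using assms generators_subset unfolding proper_gens_def by auto
  then obtain \<phi> where \<phi>: "\<phi> \<in> \<Sigma>" "\<pi> c = embed \<phi>" using hom_cases by metis
  then have "rho c = \<phi>" unfolding rho_def embed_def by simp
  then show "\<pi> c = embed (rho c)" "bounded (range (rho c))" using \<phi> bounded by auto
qed

lemma bdd_diff:
  assumes "c \<in> proper_gens" "bounded (range \<phi>)"
  shows "bdd_above (range (\<lambda>x. \<phi> x - rho c x))"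
proof -
  have "bounded (range (\<lambda>x. \<phi> x - rho c x))"
    using bounded_minus_comp[of \<phi> UNIV "rho c"] assms rho(2) by simp
  then show ?thesis by (rule bounded_imp_bdd_above)
qed

lemma least_section_mem: "least_section \<phi> \<in> V"
  unfolding least_section_def using proper_gens by (intro INF_mem shift_mem)

lemma hom_least_section_ge:
  assumes "bounded (range \<phi>)"
  shows "embed \<phi> \<le> \<pi> (least_section \<phi>)"
proof (rule le_funI)
  fix x
  have "embed \<phi> x \<le> \<pi> (\<lambda>i. c i + ereal (SUP x. \<phi> x - rho c x)) x" if c: "c \<in> proper_gens" for c
  proof -
    have "\<phi> x - rho c x \<le> (SUP x. \<phi> x - rho c x)"
      using bdd_diff[OF c assms] by (intro cSUP_upper) auto
    then show ?thesis using hom_shift proper_gens(2)[OF c] rho(1)[OF c] by (simp add: embed_def)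
  qed
  then show "embed \<phi> x \<le> \<pi> (least_section \<phi>) x"
    unfolding least_section_def using proper_gens
    by (subst hom_INF) (auto intro!: shift_mem INF_greatest)
qed

text \<open>A shifted generator \<open>c + a\<close> above \<open>v\<close> that touches it at
  \<open>i\<close> has image above \<open>\<pi> v\<close>, hence above \<open>\<phi>\<close>, so
  \<open>a\<close> is at least the supremum used for \<open>c\<close>. That \<open>i\<close> is off
  the kernel makes \<open>c\<close> a proper generator.\<close>

lemma least_section_le:
  assumes \<phi>: "bounded (range \<phi>)" and v: "v \<in> V" "embed \<phi> \<le> \<pi> v" and i: "i \<notin> kernel_coords"
  shows "least_section \<phi> i \<le> v i"
proof (cases "v i = \<infinity>")
  case False
  then obtain c a where c: "c \<in> generators" "v \<le> (\<lambda>j. c j + ereal a)" "v i = c i + ereal a"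
    using generatorsE[OF v(1)] by blast
  have cV: "c \<in> V" using c generators_subset by blast
  have "c i \<noteq> \<infinity>" using c(3) False by auto
  then have cp: "c \<in> proper_gens" using i c cV unfolding proper_gens_def kernel_coords_def by blast
  have "embed \<phi> \<le> (\<lambda>x. \<pi> c x + ereal a)"
    using hom_mono[OF v(1) shift_mem[OF cV] c(2)] v(2) hom_shift[OF cV] by simp
  then have "\<phi> x - rho c x \<le> a" for x
    using rho(1)[OF cp] by (auto simp: embed_def le_fun_def algebra_simps)
  then have "(SUP x. \<phi> x - rho c x) \<le> a" by (intro cSUP_least) auto
  then have "c i + ereal (SUP x. \<phi> x - rho c x) \<le> v i" unfolding c(3) by (intro add_left_mono) simp
  moreover have "least_section \<phi> i \<le> c i + ereal (SUP x. \<phi> x - rho c x)"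
    unfolding least_section_def by (rule INF_lower[OF cp])
  ultimately show ?thesis by simp
qed simp

text \<open>The image is at least \<open>\<phi>\<close> by construction. Any preimage of
  \<open>\<phi>\<close> dominates the section off the kernel, which gives the other
  inequality.\<close>

lemma hom_least_section:
  assumes "\<phi> \<in> \<Sigma>"
  shows "\<pi> (least_section \<phi>) = embed \<phi>"
proof -
  obtain v where v: "v \<in> V" "\<pi> v = embed \<phi>" by (rule hom_surj[OF assms])
  have "\<pi> (least_section \<phi>) \<le> \<pi> v"
    using least_section_le[OF bounded[OF assms] v(1)] v(2)
    by (intro hom_mono_off_kernel least_section_mem v(1)) simp
  then show ?thesis using hom_least_section_ge[OF bounded[OF assms]] v(2) by simp
qed

lemma least_section_finite:
  assumes "i \<in> live_coords V" "i \<notin> kernel_coords"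
  shows "least_section \<phi> i \<noteq> \<infinity>"
proof -
  obtain v where v: "v \<in> V" "v i \<noteq> \<infinity>" using assms(1) unfolding live_coords_def by blast
  then obtain c a where c: "c \<in> generators" "v i = c i + ereal a" using generatorsE by blast
  have "c i \<noteq> \<infinity>" "c \<in> V" using c v generators_subset by auto
  then have cp: "c \<in> proper_gens" using assms(2) c unfolding proper_gens_def kernel_coords_def by blast
  have "least_section \<phi> i \<le> c i + ereal (SUP x. \<phi> x - rho c x)"
    unfolding least_section_def by (rule INF_lower[OF cp])
  then show ?thesis using \<open>c i \<noteq> \<infinity>\<close> by auto
qed

lemma continuous_on_INF_ereal:
  fixes f :: "'k \<Rightarrow> 'a::topological_space \<Rightarrow> ereal"
  assumes "finite I" "\<And>k. k \<in> I \<Longrightarrow> continuous_on S (f k)"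
  shows "continuous_on S (\<lambda>x. INF k\<in>I. f k x)"
  using assms by (induction I) (auto simp: inf_min intro!: continuous_on_min continuous_on_const)

text \<open>The supremum is 1-Lipschitz for the uniform distance, because each of its terms
  is.\<close>

lemma continuous_SUP_diff:
  assumes c: "c \<in> proper_gens"
  shows "continuous_on UNIV (\<lambda>f::'p \<Rightarrow>\<^sub>C real. SUP x. apply_bcontfun f x - rho c x)"
proof -
  let ?s = "\<lambda>f::'p \<Rightarrow>\<^sub>C real. SUP x. apply_bcontfun f x - rho c x"
  have le: "?s f \<le> ?s g + dist f g" for f g
  proof (rule cSUP_least)
    fix x
    have "apply_bcontfun g x - rho c x \<le> ?s g"
      using bdd_diff[OF c bounded_apply_bcontfun[of g]] by (intro cSUP_upper) auto
    moreover have "\<bar>apply_bcontfun f x - apply_bcontfun g x\<bar> \<le> dist f g"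
      using dist_bounded[of f x g] by (simp add: dist_real_def)
    ultimately show "apply_bcontfun f x - rho c x \<le> ?s g + dist f g" by linarith
  qed simp
  have "dist (?s f) (?s g) \<le> 1 * dist f g" for f g
    using le[of f g] le[of g f] by (simp add: dist_real_def dist_commute abs_le_iff)
  then have "1-lipschitz_on UNIV ?s" by (intro lipschitz_onI) auto
  then show ?thesis by (rule lipschitz_on_continuous_on)
qed

lemma least_section_continuous: "continuous_wrt_uniform S least_section"
  unfolding continuous_wrt_uniform_def
proof (rule continuous_on_coordinatewise_then_product)
  fix i
  have "continuous_on UNIV (\<lambda>f::'p \<Rightarrow>\<^sub>C real. c i + ereal (SUP x. apply_bcontfun f x - rho c x))"
    if c: "c \<in> proper_gens" for c
  proof (cases "c i = \<infinity>")
    case False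
    then obtain a where "c i = ereal a" using value_cases[OF proper_gens(2)[OF c]] by blast
    then show ?thesis using continuous_SUP_diff[OF c]
      by (auto intro!: continuous_on_ereal continuous_on_add continuous_on_const)
  qed (simp add: continuous_on_const)
  then have "continuous_on UNIV (\<lambda>f::'p \<Rightarrow>\<^sub>C real. least_section (apply_bcontfun f) i)"
    unfolding least_section_def using proper_gens(1) by (intro continuous_on_INF_ereal)
  then show "continuous_on {f. apply_bcontfun f \<in> S} (\<lambda>f. least_section (apply_bcontfun f) i)"
    by (rule continuous_on_subset) simp
qed

section \<open>Evaluation at a point as a tropical linear functional\<close>

text \<open>Evaluation at \<open>x\<close> is a minimum of shifted coordinates, so some coordinate attains it.\<close>

lemma supporting_coordinate:
  assumes v: "v \<in> V" "\<pi> v x \<noteq> \<infinity>"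
  shows "\<exists>i. v i \<noteq> \<infinity> \<and> (\<forall>c\<in>V. \<pi> c x + v i \<le> \<pi> v x + c i)"
proof (rule ccontr)
  assume contra: "\<nexists>i. v i \<noteq> \<infinity> \<and> (\<forall>c\<in>V. \<pi> c x + v i \<le> \<pi> v x + c i)"
  obtain \<phi> where \<phi>: "\<pi> v = embed \<phi>" using hom_cases[OF v(1)] v(2) by metis
  \<comment> \<open>If every coordinate failed, each finite entry \<open>v i\<close> would be shared
    by a vector with strictly larger value at \<open>x\<close>. The minimum of these finitely many
    vectors lies below \<open>v\<close>, yet its value at \<open>x\<close> exceeds that of
    \<open>v\<close>.\<close>
  have "\<forall>i\<in>fsupp v. \<exists>d. d \<in> V \<and> d i = v i \<and> \<pi> v x < \<pi> d x"
  proof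
    fix i assume i: "i \<in> fsupp v"
    then obtain c where c: "c \<in> V" "\<pi> v x + c i < \<pi> c x + v i"
      using contra unfolding fsupp_def by (auto simp: not_le)
    obtain a where a: "v i = ereal a" using fsupp_cases[OF v(1) i] by blast
    have "c i \<noteq> \<infinity>" using c(2) by auto
    then obtain b where b: "c i = ereal b" using value_cases[OF c(1)] by blast
    let ?d = "\<lambda>j. c j + ereal (a - b)"
    have "?d i = v i" using a b by simp
    moreover have "\<pi> v x < \<pi> c x + ereal (a - b)"
      using c(2) a b \<phi> by (cases "\<pi> c x") (auto simp: embed_def)
    ultimately show "\<exists>d. d \<in> V \<and> d i = v i \<and> \<pi> v x < \<pi> d x"
      using shift_mem[OF c(1)] hom_shift[OF c(1)] by (intro exI[of _ ?d]) auto
  qed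
  from bchoice[OF this] obtain d
    where d: "\<forall>i\<in>fsupp v. d i \<in> V \<and> d i i = v i \<and> \<pi> v x < \<pi> (d i) x" by (elim exE)
  let ?u = "\<lambda>j. INF i\<in>fsupp v. d i j"
  have "?u j \<le> v j" for j
  proof (cases "j \<in> fsupp v")
    case True
    then have "?u j \<le> d j j" by (intro INF_lower)
    then show ?thesis using d True by simp
  qed (simp add: fsupp_def)
  then have "\<pi> ?u \<le> \<pi> v" using v(1) d by (intro hom_mono INF_mem) (auto simp: le_fun_def)
  moreover have "\<pi> ?u = (\<lambda>x. INF i\<in>fsupp v. \<pi> (d i) x)" using d by (intro hom_INF) auto
  ultimately have le: "(INF i\<in>fsupp v. \<pi> (d i) x) \<le> \<pi> v x" by (simp add: le_fun_def)
  have "fsupp v \<noteq> {}"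
  proof
    assume "fsupp v = {}"
    then have "v = (\<lambda>_. \<infinity>)" unfolding fsupp_def by auto
    then show False using v(2) hom_infty by simp
  qed
  then have "(INF i\<in>fsupp v. \<pi> (d i) x) \<in> (\<lambda>i. \<pi> (d i) x) ` fsupp v"
    by (metis Min_Inf Min_in finite finite_imageI image_is_empty)
  then show False using d le by auto
qed

text \<open>The set \<open>I(x)\<close> at \<open>w\<close>: the coefficient of coordinate
  \<open>i\<close> in the functional \<open>v \<mapsto> \<pi> v x\<close> is the supremum of
  \<open>\<pi> c x - c i\<close>, and membership says that \<open>w\<close> attains it. The additive
  form avoids subtracting infinities.\<close>

definition support_coords :: "('n \<Rightarrow> ereal) \<Rightarrow> 'p \<Rightarrow> 'n set" where
  "support_coords w x = {i \<in> live_coords V - kernel_coords. \<forall>c\<in>V. \<pi> c x + w i \<le> \<pi> w x + c i}"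

text \<open>If \<open>v i = w i\<close> at a supporting coordinate of \<open>w\<close>, the support
  inequality bounds \<open>\<pi> v x\<close> by \<open>\<pi> w x\<close>. Conversely, if
  \<open>\<pi> v x\<close> does not exceed \<open>\<pi> w x\<close>, the inequalities for a
  supporting coordinate of \<open>v\<close> collapse to equalities, so it supports \<open>w\<close>
  as well and \<open>v\<close> equals \<open>w\<close> there.\<close>

lemma support_coords_greater:
  assumes w: "w \<in> V" "\<pi> w x \<noteq> \<infinity>" and v: "v \<in> V"
    and le: "\<And>i. i \<in> live_coords V - kernel_coords \<Longrightarrow> w i \<le> v i"
    and fin: "\<And>i. i \<in> live_coords V - kernel_coords \<Longrightarrow> w i \<noteq> \<infinity>"
  shows "\<pi> w x < \<pi> v x \<longleftrightarrow> (\<forall>i\<in>support_coords w x. w i < v i)"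
proof
  obtain \<phi> where \<phi>: "\<pi> w = embed \<phi>" using hom_cases[OF w(1)] w(2) by metis
  show "\<forall>i\<in>support_coords w x. w i < v i" if lt: "\<pi> w x < \<pi> v x"
  proof
    fix i assume i: "i \<in> support_coords w x"
    then have iF: "i \<in> live_coords V - kernel_coords" unfolding support_coords_def by auto
    have s: "\<pi> v x + w i \<le> \<pi> w x + v i" using i v unfolding support_coords_def by auto
    obtain a where a: "w i = ereal a" using value_cases[OF w(1) fin[OF iF]] by blast
    have "w i \<noteq> v i"
    proof
      assume "w i = v i"
      then have "v i = ereal a" using a by simp
      then show False using s a lt \<phi> by (cases "\<pi> v x") (auto simp: embed_def)
    qed
    then show "w i < v i" using le[OF iF] by simp
  qed
  assume gt: "\<forall>i\<in>support_coords w x. w i < v i"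
  show "\<pi> w x < \<pi> v x"
  proof (rule ccontr)
    assume "\<not> \<pi> w x < \<pi> v x"
    then have vw: "\<pi> v x \<le> \<pi> w x" by simp
    then have vfin: "\<pi> v x \<noteq> \<infinity>" using w(2) by auto
    obtain \<psi> where \<psi>: "\<pi> v = embed \<psi>" using hom_cases[OF v] vfin by metis
    obtain i where i: "v i \<noteq> \<infinity>" "\<And>c. c \<in> V \<Longrightarrow> \<pi> c x + v i \<le> \<pi> v x + c i"
      using supporting_coordinate[OF v vfin] by blast
    obtain b where b: "v i = ereal b" using value_cases[OF v i(1)] by blast
    have "i \<notin> kernel_coords"
    proof
      assume "i \<in> kernel_coords"
      then obtain k where k: "k \<in> V" "\<pi> k = (\<lambda>_. \<infinity>)" "k i \<noteq> \<infinity>" unfolding kernel_coords_def by blast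
      then show False using i(2)[OF k(1)] \<psi> value_cases[OF k(1,3)] b by (auto simp: embed_def)
    qed
    then have iF: "i \<in> live_coords V - kernel_coords" using v i(1) unfolding live_coords_def by blast
    obtain a where a: "w i = ereal a" using value_cases[OF w(1) fin[OF iF]] by blast
    have "\<phi> x + b \<le> \<psi> x + a" using i(2)[OF w(1)] \<phi> \<psi> a b by (simp add: embed_def)
    moreover have "\<psi> x \<le> \<phi> x" using vw \<phi> \<psi> by (simp add: embed_def)
    moreover have "a \<le> b" using le[OF iF] a b by simp
    ultimately have eq: "a = b" "\<psi> x = \<phi> x" by auto
    have "i \<in> support_coords w x"
      unfolding support_coords_def using iF i(2) eq a b \<phi> \<psi> by (simp add: embed_def)
    then show False using gt a b eq by auto
  qed
qed

lemma support_coords_nonempty: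
  assumes "w \<in> V" "\<pi> w x \<noteq> \<infinity>" "\<And>i. i \<in> live_coords V - kernel_coords \<Longrightarrow> w i \<noteq> \<infinity>"
  shows "support_coords w x \<noteq> {}"
  \<comment> \<open>With \<open>v = w\<close> the strict inequality is false, so the universal
    statement over the supporting coordinates cannot hold vacuously.\<close>
  using support_coords_greater[OF assms(1,2,1) _ assms(3)] by auto

end

section \<open>Slopes on a metric graph\<close>

text \<open>The predicate under the definite description in \<open>out_slope\<close>; slopes are
  computed by exhibiting a \<open>k\<close> that satisfies it.\<close>

definition has_slope :: "('p, 'e) mgraph \<Rightarrow> ('p \<Rightarrow> real) \<Rightarrow> 'e \<Rightarrow> real \<Rightarrow> real \<Rightarrow> int \<Rightarrow> bool" where
  "has_slope G \<phi> e t d k \<longleftrightarrow>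
     (\<forall>\<^sub>F h in at_right 0. \<phi> (chart G e (t + d * h)) = \<phi> (chart G e t) + of_int k * h)"

lemma has_slope_unique:
  assumes "has_slope G \<phi> e t d k" "has_slope G \<phi> e t d l"
  shows "k = l"
proof -
  have "\<forall>\<^sub>F h::real in at_right 0. 0 < h" by (simp add: eventually_at_right_less)
  then have "\<forall>\<^sub>F h::real in at_right 0. real_of_int k = real_of_int l"
    using assms unfolding has_slope_def by eventually_elim auto
  then show ?thesis by (simp add: eventually_const_iff)
qed

lemma out_slope_eq:
  assumes "has_slope G \<phi> e t d k"
  shows "out_slope G \<phi> (e, t, d) = k"
proof -
  have "(THE k. has_slope G \<phi> e t d k) = k" using assms has_slope_unique by (intro the_equality) auto
  then show ?thesis unfolding out_slope_def has_slope_def by simp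
qed

lemma has_slope_add:
  assumes "has_slope G \<phi> e t d k" "has_slope G \<psi> e t d l"
  shows "has_slope G (\<lambda>x. \<phi> x + \<psi> x) e t d (k + l)"
  using assms unfolding has_slope_def by eventually_elim (simp add: algebra_simps)

lemma has_slope_minimum:
  assumes k: "has_slope G \<psi> e t d k" and min: "\<And>y. \<psi> (chart G e t) \<le> \<psi> y"
  shows "0 \<le> k"
proof (rule ccontr)
  assume neg: "\<not> 0 \<le> k"
  have "\<forall>\<^sub>F h::real in at_right 0. 0 < h" by (simp add: eventually_at_right_less)
  with k have "\<forall>\<^sub>F h::real in at_right 0. False"
    unfolding has_slope_def
  proof eventually_elim
    case (elim h)
    have "0 \<le> of_int k * h" using elim(1) min[of "chart G e (t + d * h)"] by simp
    then show False using neg elim(2) by (simp add: zero_le_mult_iff)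
  qed
  then show False by simp
qed

lemma has_slope_min_const:
  assumes k: "has_slope G \<psi> e t d k"
  shows "has_slope G (\<lambda>x. min (\<psi> x) c) e t d
    (if \<psi> (chart G e t) < c then k else if c < \<psi> (chart G e t) then 0 else min k 0)"
proof -
  let ?a = "\<psi> (chart G e t)"
  have pos: "\<forall>\<^sub>F h::real in at_right 0. 0 < h" by (simp add: eventually_at_right_less)
  have lim: "((\<lambda>h. ?a + of_int k * h) \<longlongrightarrow> ?a) (at_right 0)" by (auto intro!: tendsto_eq_intros)
  consider "?a < c" | "c < ?a" | "?a = c" by linarith
  then show ?thesis
  proof cases
    case 1
    then have "\<forall>\<^sub>F h in at_right 0. ?a + of_int k * h < c" using order_tendstoD(2)[OF lim] by simp
    with k show ?thesis unfolding has_slope_def by eventually_elim (use 1 in \<open>simp add: min_def\<close>)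
  next
    case 2
    then have "\<forall>\<^sub>F h in at_right 0. c < ?a + of_int k * h" using order_tendstoD(1)[OF lim] by simp
    with k show ?thesis unfolding has_slope_def by eventually_elim (use 2 in \<open>simp add: min_def\<close>)
  next
    case 3
    show ?thesis using pos k unfolding has_slope_def
      by eventually_elim (use 3 in \<open>auto simp: min_def mult_le_0_iff zero_le_mult_iff\<close>)
  qed
qed

locale graph =
  fixes G :: "('p::metric_space, 'e) mgraph"
  assumes mg: "metric_graph G"
begin

lemma finite_verts: "finite (verts G)"
  and finite_edges: "finite (edges G)"
  and len_pos: "e \<in> edges G \<Longrightarrow> 0 < len G e"
  and chart_0: "e \<in> edges G \<Longrightarrow> chart G e 0 \<in> verts G"
  and chart_len: "e \<in> edges G \<Longrightarrow> chart G e (len G e) \<in> verts G"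
  and inj_chart: "inj_on (\<lambda>(e, t). chart G e t) (SIGMA e:edges G. {0<..<len G e})"
  and verts_interior: "verts G \<inter> (\<Union>e\<in>edges G. chart G e ` {0<..<len G e}) = {}"
  and cover: "verts G \<union> (\<Union>e\<in>edges G. chart G e ` {0<..<len G e}) = UNIV"
  and connected_walk: "\<exists>L. walk G x y L"
  and dist_walk: "dist x y = Inf {L. walk G x y L}"
  using mg unfolding metric_graph_def by auto

lemma chart_eqD:
  assumes e: "e \<in> edges G" "0 < u" "u < len G e" and e': "e' \<in> edges G" "0 \<le> u'" "u' \<le> len G e'"
    and eq: "chart G e u = chart G e' u'"
  shows "e' = e \<and> u' = u"
proof -
  have nv: "chart G e u \<notin> verts G" using verts_interior e by force
  have "u' \<noteq> 0" "u' \<noteq> len G e'" using nv eq chart_0[OF e'(1)] chart_len[OF e'(1)] by auto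
  then have "(e', u') \<in> (SIGMA e:edges G. {0<..<len G e})" "(e, u) \<in> (SIGMA e:edges G. {0<..<len G e})"
    using e e' by auto
  from inj_onD[OF inj_chart _ this] show ?thesis using eq by simp
qed

lemma point_cases:
  obtains "x \<in> verts G" | e u where "e \<in> edges G" "0 < u" "u < len G e" "x = chart G e u"
proof -
  have "x \<in> verts G \<union> (\<Union>e\<in>edges G. chart G e ` {0<..<len G e})" using cover by simp
  then show ?thesis using that by auto
qed

lemma walk_nonneg: "walk G x y L \<Longrightarrow> 0 \<le> L"
  by (induction rule: walk.induct) auto

lemma dist_chart_le:
  assumes "e \<in> edges G" "s \<in> {0..len G e}" "t \<in> {0..len G e}"
  shows "dist (chart G e s) (chart G e t) \<le> \<bar>t - s\<bar>"
proof -
  have "walk G (chart G e s) (chart G e t) (0 + \<bar>t - s\<bar>)"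
    using assms by (intro walk.step[where s = s] walk.refl)
  then show ?thesis unfolding dist_walk
    by (intro cInf_lower) (auto intro!: bdd_belowI[of _ 0] walk_nonneg)
qed

lemma continuous_chart:
  assumes "e \<in> edges G"
  shows "continuous_on {0..len G e} (chart G e)"
proof -
  have "1-lipschitz_on {0..len G e} (chart G e)"
  proof (rule lipschitz_onI)
    fix s t assume "s \<in> {0..len G e}" "t \<in> {0..len G e}"
    then show "dist (chart G e s) (chart G e t) \<le> 1 * dist s t"
      using dist_chart_le[OF assms, of s t] by (simp add: dist_real_def abs_minus_commute)
  qed simp
  then show ?thesis by (rule lipschitz_on_continuous_on)
qed

lemma compact_graph: "compact (UNIV :: 'p set)"
proof -
  have "compact (verts G \<union> (\<Union>e\<in>edges G. chart G e ` {0..len G e}))"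
    using finite_verts finite_edges
    by (intro compact_Un finite_imp_compact[OF finite_verts] compact_UN compact_continuous_image
        continuous_chart compact_Icc)
  moreover have sub: "(\<Union>e\<in>edges G. chart G e ` {0<..<len G e}) \<subseteq> (\<Union>e\<in>edges G. chart G e ` {0..len G e})"
    by force
  have "verts G \<union> (\<Union>e\<in>edges G. chart G e ` {0..len G e}) = UNIV"
    using Un_mono[OF order_refl[of "verts G"] sub] unfolding cover by (rule top.extremum_uniqueI)
  ultimately show ?thesis by simp
qed

lemma tangents_interior:
  assumes "e \<in> edges G" "0 < u" "u < len G e"
  shows "tangents G (chart G e u) = {(e, u, 1), (e, u, -1)}"
proof -
  have "\<tau> \<in> tangents G (chart G e u) \<longleftrightarrow> \<tau> \<in> {(e, u, 1), (e, u, -1)}" for \<tau>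
  proof -
    obtain e' u' d where \<tau>: "\<tau> = (e', u', d)" by (cases \<tau>)
    show ?thesis using assms chart_eqD[OF assms, of e' u'] unfolding \<tau> by (auto simp: tangents_def)
  qed
  then show ?thesis by blast
qed

lemma valence_interior:
  assumes "e \<in> edges G" "0 < u" "u < len G e"
  shows "valence G (chart G e u) = 2"
  unfolding valence_def tangents_interior[OF assms] by simp

lemma finite_tangents: "finite (tangents G p)"
proof (cases p rule: point_cases)
  case 1
  have "t = 0 \<or> t = len G e" if "(e, t, d) \<in> tangents G p" for e t d
    using that 1 verts_interior by (force simp: tangents_def)
  then have "tangents G p \<subseteq> (SIGMA e:edges G. {0, len G e} \<times> {1, -1})"
    by (auto simp: tangents_def)
  then show ?thesis by (rule finite_subset) (auto intro: finite_edges)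
next
  case (2 e u)
  then show ?thesis using tangents_interior by simp
qed

lemma finite_valence_1: "finite {p. valence G p = 1}"
proof -
  have "{p. valence G p = 1} \<subseteq> verts G"
  proof
    fix p assume "p \<in> {p. valence G p = 1}"
    then show "p \<in> verts G" using valence_interior by (cases p rule: point_cases) auto
  qed
  then show ?thesis using finite_verts by (rule finite_subset)
qed

text \<open>A walk can leave \<open>p\<close> only along a tangent direction at
  \<open>p\<close>.\<close>

lemma single_point:
  assumes "tangents G p = {}"
  shows "UNIV = {p}"
proof -
  have "y = p" if "walk G x y L" "x = p" for x y L
    using that
  proof induction
    case (step x e s L t)
    then have "chart G e s = p" by simp
    moreover have "s < len G e \<or> 0 < s" using len_pos[OF step(2)] by linarith
    ultimately have "(e, s, if s < len G e then 1 else -1) \<in> tangents G p"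
      using step by (auto simp: tangents_def)
    then show ?case using assms by simp
  qed simp
  then show ?thesis using connected_walk[of p] by blast
qed

lemma continuous_bounded:
  assumes "continuous_on UNIV (\<phi> :: 'p \<Rightarrow> real)"
  shows "bounded (range \<phi>)"
  using compact_continuous_image[OF assms compact_graph] compact_imp_bounded by blast

lemma PL_has_slope:
  assumes \<phi>: "\<phi> \<in> PL G" and \<tau>: "(e, t, d) \<in> tangents G p"
  shows "has_slope G \<phi> e t d (out_slope G \<phi> (e, t, d))"
proof -
  have e: "e \<in> edges G" using \<tau> by (simp add: tangents_def)
  have "\<exists>B. finite B \<and> (\<forall>s t. 0 \<le> s \<and> s < t \<and> t \<le> len G e \<and> {s<..<t} \<inter> B = {} \<longrightarrow>
           (\<exists>k::int. \<forall>u\<in>{s..t}. \<phi> (chart G e u) = \<phi> (chart G e s) + of_int k * (u - s)))"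
    using \<phi> e unfolding PL_def by blast
  then obtain B where B: "finite B" "\<And>s t. 0 \<le> s \<Longrightarrow> s < t \<Longrightarrow> t \<le> len G e \<Longrightarrow> {s<..<t} \<inter> B = {} \<Longrightarrow>
           \<exists>k::int. \<forall>u\<in>{s..t}. \<phi> (chart G e u) = \<phi> (chart G e s) + of_int k * (u - s)"
    by blast
  have "\<exists>k. has_slope G \<phi> e t d k"
  proof (cases "d = 1")
    case True
    define t' where "t' = Min (insert (len G e) {b \<in> B. t < b})"
    have t': "t < t'" "t' \<le> len G e" "\<And>b. b \<in> B \<Longrightarrow> t < b \<Longrightarrow> t' \<le> b"
      unfolding t'_def using B(1) \<tau> True by (auto simp: tangents_def)
    have disj: "{t<..<t'} \<inter> B = {}" using t'(3) by (auto simp: not_less[symmetric])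
    have t0: "0 \<le> t" using \<tau> by (simp add: tangents_def)
    obtain k where k: "\<forall>u\<in>{t..t'}. \<phi> (chart G e u) = \<phi> (chart G e t) + of_int k * (u - t)"
      using B(2)[of t t'] t'(1,2) disj t0 by auto
    have "\<phi> (chart G e (t + h)) = \<phi> (chart G e t) + of_int k * h" if "0 < h" "h < t' - t" for h
      using bspec[OF k, of "t + h"] that by simp
    then have "has_slope G \<phi> e t d k"
      unfolding has_slope_def True eventually_at_right_field using t'(1)
      by (intro exI[of _ "t' - t"]) auto
    then show ?thesis ..
  next
    case False
    then have d: "d = -1" "0 < t" using \<tau> by (auto simp: tangents_def)
    define t' where "t' = Max (insert 0 {b \<in> B. b < t})"
    have t': "t' < t" "0 \<le> t'" "\<And>b. b \<in> B \<Longrightarrow> b < t \<Longrightarrow> b \<le> t'"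
      unfolding t'_def using B(1) d by auto
    have disj: "{t'<..<t} \<inter> B = {}" using t'(3) by (auto simp: not_less[symmetric])
    have t0: "t \<le> len G e" using \<tau> by (simp add: tangents_def)
    obtain k where k: "\<forall>u\<in>{t'..t}. \<phi> (chart G e u) = \<phi> (chart G e t') + of_int k * (u - t')"
      using B(2)[of t' t] t'(1,2) disj t0 by auto
    have "\<phi> (chart G e (t - h)) = \<phi> (chart G e t) + of_int (- k) * h" if "0 < h" "h < t - t'" for h
      using bspec[OF k, of "t - h"] bspec[OF k, of t] that by (simp add: algebra_simps)
    then have "has_slope G \<phi> e t d (- k)"
      unfolding has_slope_def d eventually_at_right_field using t'(1)
      by (intro exI[of _ "t - t'"]) auto
    then show ?thesis ..
  qed
  then show ?thesis using out_slope_eq by metis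
qed

lemma PL_diff:
  assumes "\<phi> \<in> PL G" "\<psi> \<in> PL G"
  shows "(\<lambda>x. \<phi> x - \<psi> x) \<in> PL G"
  unfolding PL_def
proof (intro CollectI conjI ballI)
  show "continuous_on UNIV (\<lambda>x. \<phi> x - \<psi> x)"
    using assms unfolding PL_def by (intro continuous_on_diff) auto
  fix e assume e: "e \<in> edges G"
  let ?lin = "\<lambda>\<phi> s t. \<exists>k::int. \<forall>u\<in>{s..t}. \<phi> (chart G e u) = \<phi> (chart G e s) + of_int k * (u - s)"
  have ex: "\<exists>B. finite B \<and> (\<forall>s t. 0 \<le> s \<and> s < t \<and> t \<le> len G e \<and> {s<..<t} \<inter> B = {} \<longrightarrow> ?lin \<theta> s t)"
    if "\<theta> \<in> PL G" for \<theta> using that e unfolding PL_def by blast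
  obtain B where B: "finite B" "\<forall>s t. 0 \<le> s \<and> s < t \<and> t \<le> len G e \<and> {s<..<t} \<inter> B = {} \<longrightarrow> ?lin \<phi> s t"
    using ex[OF assms(1)] by (elim exE conjE)
  obtain C where C: "finite C" "\<forall>s t. 0 \<le> s \<and> s < t \<and> t \<le> len G e \<and> {s<..<t} \<inter> C = {} \<longrightarrow> ?lin \<psi> s t"
    using ex[OF assms(2)] by (elim exE conjE)
  have "?lin (\<lambda>x. \<phi> x - \<psi> x) s t" if st: "0 \<le> s \<and> s < t \<and> t \<le> len G e \<and> {s<..<t} \<inter> (B \<union> C) = {}" for s t
  proof -
    have "{s<..<t} \<inter> B = {}" "{s<..<t} \<inter> C = {}" using st by auto
    then have "?lin \<phi> s t" "?lin \<psi> s t" using B(2) C(2) st by simp_all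
    then obtain k l where kl: "\<forall>u\<in>{s..t}. \<phi> (chart G e u) = \<phi> (chart G e s) + of_int k * (u - s)"
      "\<forall>u\<in>{s..t}. \<psi> (chart G e u) = \<psi> (chart G e s) + of_int l * (u - s)"
      by (elim exE)
    have "\<phi> (chart G e u) - \<psi> (chart G e u)
        = \<phi> (chart G e s) - \<psi> (chart G e s) + of_int (k - l) * (u - s)" if "u \<in> {s..t}" for u
      using bspec[OF kl(1) that] bspec[OF kl(2) that] by (simp add: algebra_simps)
    then show ?thesis by (intro exI[of _ "k - l"] ballI)
  qed
  then show "\<exists>B. finite B \<and> (\<forall>s t. 0 \<le> s \<and> s < t \<and> t \<le> len G e \<and> {s<..<t} \<inter> B = {} \<longrightarrow> ?lin (\<lambda>x. \<phi> x - \<psi> x) s t)"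
    using B(1) C(1) by (intro exI[of _ "B \<union> C"]) simp
qed

lemma div_of_add:
  assumes "\<And>e t d. (e, t, d) \<in> tangents G p \<Longrightarrow> has_slope G \<phi> e t d (out_slope G \<phi> (e, t, d))"
    and "\<And>e t d. (e, t, d) \<in> tangents G p \<Longrightarrow> has_slope G \<psi> e t d (out_slope G \<psi> (e, t, d))"
  shows "div_of G (\<lambda>x. \<phi> x + \<psi> x) p = div_of G \<phi> p + div_of G \<psi> p"
proof -
  have "out_slope G (\<lambda>x. \<phi> x + \<psi> x) \<tau> = out_slope G \<phi> \<tau> + out_slope G \<psi> \<tau>" if \<tau>: "\<tau> \<in> tangents G p" for \<tau>
  proof -
    obtain e t d where eq: "\<tau> = (e, t, d)" by (cases \<tau>)
    show ?thesis
      using out_slope_eq[OF has_slope_add[OF assms(1)[of e t d] assms(2)[of e t d]]] \<tau> eq by simp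
  qed
  then show ?thesis unfolding div_of_def by (simp add: sum.distrib[symmetric])
qed

lemma div_of_minimum:
  assumes \<psi>: "\<psi> \<in> PL G" and min: "\<And>y. \<psi> x \<le> \<psi> y"
  shows "div_of G \<psi> x \<le> 0"
  unfolding div_of_def
proof (rule sum_nonpos)
  fix \<tau> assume "\<tau> \<in> tangents G x"
  moreover obtain e t d where "\<tau> = (e, t, d)" by (cases \<tau>)
  ultimately show "- out_slope G \<psi> \<tau> \<le> 0"
    using has_slope_minimum[OF PL_has_slope[OF \<psi>, of e t d x]] min by (auto simp: tangents_def)
qed

end

section \<open>Truncations of a superharmonic function\<close>

definition base :: "('p, 'e) mgraph \<Rightarrow> 'e \<times> real \<times> real \<Rightarrow> 'p" where
  "base G = (\<lambda>(e, t, d). chart G e t)"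

definition along :: "('p, 'e) mgraph \<Rightarrow> 'e \<times> real \<times> real \<Rightarrow> real \<Rightarrow> 'p" where
  "along G = (\<lambda>(e, t, d) h. chart G e (t + d * h))"

text \<open>\<open>D\<close> will be \<open>D + div \<phi>\<close> at a nondegenerate
  \<open>\<phi>\<close>, and \<open>\<psi>\<close> a nonnegative member of the shifted series. Where
  there is no chip, effectivity of the new divisor says that \<open>div \<psi>\<close> is
  nonnegative.\<close>

locale truncation = graph G for G :: "('p::metric_space, 'e) mgraph" +
  fixes D :: "'p \<Rightarrow> int" and \<psi> :: "'p \<Rightarrow> real"
  assumes finite_supp: "finite (supp D)" and PL: "\<psi> \<in> PL G" and nonneg: "0 \<le> \<psi> x"
    and superharmonic: "x \<notin> supp D \<Longrightarrow> 0 \<le> div_of G \<psi> x"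
begin

abbreviation "slope \<equiv> out_slope G \<psi>"

text \<open>The directions in which \<open>\<psi>\<close> leaves its zero set. The first conjunct
  just says that the triple is a tangent direction at its own base.\<close>

definition exits :: "('e \<times> real \<times> real) set" where
  "exits = {\<tau>. \<tau> \<in> tangents G (base G \<tau>) \<and> \<psi> (base G \<tau>) = 0 \<and> 0 < slope \<tau>}"

lemma exits_iff:
  "(e, t, d) \<in> exits \<longleftrightarrow> (e, t, d) \<in> tangents G (chart G e t) \<and> \<psi> (chart G e t) = 0 \<and> 0 < slope (e, t, d)"
  by (simp add: exits_def base_def)

lemma slope_nonneg_at_zero:
  assumes "\<psi> x = 0" "\<tau> \<in> tangents G x"
  shows "0 \<le> slope \<tau>"
proof -
  obtain e t d where \<tau>: "\<tau> = (e, t, d)" by (cases \<tau>)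
  have "chart G e t = x" using assms \<tau> by (simp add: tangents_def)
  then show ?thesis
    using has_slope_minimum[OF PL_has_slope[OF PL, of e t d x]] assms nonneg \<tau> by simp
qed

text \<open>At a zero all outgoing slopes are nonnegative, so a positive one makes the divisor of
  \<open>\<psi>\<close> negative there, which superharmonicity permits only at a chip.\<close>

lemma base_exits:
  assumes "\<tau> \<in> exits"
  shows "base G \<tau> \<in> supp D"
proof (rule ccontr)
  assume "base G \<tau> \<notin> supp D"
  then have "0 \<le> div_of G \<psi> (base G \<tau>)" by (rule superharmonic)
  moreover have "0 < (\<Sum>\<sigma>\<in>tangents G (base G \<tau>). slope \<sigma>)"
    using assms slope_nonneg_at_zero finite_tangents unfolding exits_def
    by (intro sum_pos2[where i = \<tau>]) auto
  ultimately show False unfolding div_of_def by (simp add: sum_negf)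
qed

lemma finite_exits: "finite exits"
proof -
  have "exits \<subseteq> (\<Union>p\<in>supp D. tangents G p)" using base_exits unfolding exits_def by blast
  then show ?thesis by (rule finite_subset) (use finite_supp finite_tangents in auto)
qed

lemma eventually_exit:
  assumes \<tau>: "(e, t, d) \<in> exits"
  shows "\<forall>\<^sub>F h in at_right 0. 0 < t + d * h \<and> t + d * h < len G e \<and>
     \<psi> (chart G e (t + d * h)) = of_int (slope (e, t, d)) * h \<and> chart G e (t + d * h) \<notin> supp D"
proof -
  let ?s = "real_of_int (slope (e, t, d))"
  have tan: "(e, t, d) \<in> tangents G (chart G e t)" and z: "\<psi> (chart G e t) = 0" and s: "0 < ?s"
    using \<tau> by (auto simp: exits_iff)
  have sl: "\<forall>\<^sub>F h in at_right 0. \<psi> (chart G e (t + d * h)) = ?s * h"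
    using PL_has_slope[OF PL tan] z unfolding has_slope_def by simp
  have pos: "\<forall>\<^sub>F h::real in at_right 0. 0 < h" by (simp add: eventually_at_right_less)
  have lim: "((\<lambda>h. ?s * h) \<longlongrightarrow> 0) (at_right 0)" by (auto intro!: tendsto_eq_intros)
  \<comment> \<open>Each of the finitely many chips is avoided for small \<open>h\<close>: a chip
    where \<open>\<psi>\<close> vanishes because the ray has positive height, any other because the
    ray is still below it.\<close>
  have "\<forall>\<^sub>F h in at_right 0. chart G e (t + d * h) \<noteq> q" if q: "q \<in> supp D" for q
  proof (cases "\<psi> q = 0")
    case True
    show ?thesis using sl pos by eventually_elim (use True s in auto)
  next
    case False
    then have "\<forall>\<^sub>F h in at_right 0. ?s * h < \<psi> q"
      using order_tendstoD(2)[OF lim, of "\<psi> q"] nonneg[of q] by simp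
    then show ?thesis using sl by eventually_elim auto
  qed
  then have av: "\<forall>\<^sub>F h in at_right 0. \<forall>q\<in>supp D. chart G e (t + d * h) \<noteq> q"
    using finite_supp by (intro eventually_ball_finite) auto
  have d: "d = 1 \<and> 0 \<le> t \<and> t < len G e \<or> d = -1 \<and> 0 < t \<and> t \<le> len G e"
    using tan by (auto simp: tangents_def)
  have "\<forall>\<^sub>F h in at_right (0::real). 0 < h \<and> h < (if d = 1 then len G e - t else t)"
    unfolding eventually_at_right_field using d by (intro exI[of _ "if d = 1 then len G e - t else t"]) auto
  then show ?thesis using sl av by eventually_elim (use d in auto)
qed

lemma exit_length_exists:
  "\<exists>b>0. \<forall>(e, t, d)\<in>exits. \<forall>h. 0 < h \<and> h < b \<longrightarrow> 0 < t + d * h \<and> t + d * h < len G e \<and>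
     \<psi> (chart G e (t + d * h)) = of_int (slope (e, t, d)) * h \<and> chart G e (t + d * h) \<notin> supp D"
proof -
  have "\<forall>\<^sub>F h in at_right 0. \<forall>\<tau>\<in>exits. case \<tau> of (e, t, d) \<Rightarrow> 0 < t + d * h \<and> t + d * h < len G e \<and>
     \<psi> (chart G e (t + d * h)) = of_int (slope (e, t, d)) * h \<and> chart G e (t + d * h) \<notin> supp D"
    using finite_exits
  proof (rule eventually_ball_finite, intro ballI)
    fix \<tau> assume \<tau>: "\<tau> \<in> exits"
    obtain e t d where eq: "\<tau> = (e, t, d)" by (cases \<tau>)
    show "\<forall>\<^sub>F h in at_right 0. case \<tau> of (e, t, d) \<Rightarrow> 0 < t + d * h \<and> t + d * h < len G e \<and>
       \<psi> (chart G e (t + d * h)) = of_int (slope (e, t, d)) * h \<and> chart G e (t + d * h) \<notin> supp D"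
      unfolding eq prod.case using eventually_exit \<tau> eq by blast
  qed
  then obtain b where b: "b > 0" "\<And>h. 0 < h \<Longrightarrow> h < b \<Longrightarrow> \<forall>\<tau>\<in>exits. case \<tau> of (e, t, d) \<Rightarrow> 0 < t + d * h \<and> t + d * h < len G e \<and>
     \<psi> (chart G e (t + d * h)) = of_int (slope (e, t, d)) * h \<and> chart G e (t + d * h) \<notin> supp D"
    unfolding eventually_at_right_field by blast
  show ?thesis
  proof (intro exI[of _ b] conjI b(1) ballI)
    fix \<tau> assume \<tau>: "\<tau> \<in> exits"
    obtain e t d where eq: "\<tau> = (e, t, d)" by (cases \<tau>)
    show "case \<tau> of (e, t, d) \<Rightarrow> \<forall>h. 0 < h \<and> h < b \<longrightarrow> 0 < t + d * h \<and> t + d * h < len G e \<and>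
     \<psi> (chart G e (t + d * h)) = of_int (slope (e, t, d)) * h \<and> chart G e (t + d * h) \<notin> supp D"
      unfolding eq prod.case
    proof (intro allI impI)
      fix h assume "0 < h \<and> h < b"
      then show "0 < t + d * h \<and> t + d * h < len G e \<and>
        \<psi> (chart G e (t + d * h)) = of_int (slope (e, t, d)) * h \<and> chart G e (t + d * h) \<notin> supp D"
        using bspec[OF b(2) \<tau>, of h] unfolding eq prod.case by (elim conjE) simp
    qed
  qed
qed

definition exit_length :: real where
  "exit_length = (SOME b. b > 0 \<and> (\<forall>(e, t, d)\<in>exits. \<forall>h. 0 < h \<and> h < b \<longrightarrow> 0 < t + d * h \<and> t + d * h < len G e \<and>
     \<psi> (chart G e (t + d * h)) = of_int (slope (e, t, d)) * h \<and> chart G e (t + d * h) \<notin> supp D))"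

lemma exit_length_pos: "0 < exit_length"
  and along_exit: "(e, t, d) \<in> exits \<Longrightarrow> 0 < h \<Longrightarrow> h < exit_length \<Longrightarrow> 0 < t + d * h"
    "(e, t, d) \<in> exits \<Longrightarrow> 0 < h \<Longrightarrow> h < exit_length \<Longrightarrow> t + d * h < len G e"
    "(e, t, d) \<in> exits \<Longrightarrow> 0 < h \<Longrightarrow> h < exit_length \<Longrightarrow> \<psi> (chart G e (t + d * h)) = of_int (slope (e, t, d)) * h"
    "(e, t, d) \<in> exits \<Longrightarrow> 0 < h \<Longrightarrow> h < exit_length \<Longrightarrow> chart G e (t + d * h) \<notin> supp D"
proof -
  have "exit_length > 0 \<and> (\<forall>(e, t, d)\<in>exits. \<forall>h. 0 < h \<and> h < exit_length \<longrightarrow> 0 < t + d * h \<and> t + d * h < len G e \<and>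
     \<psi> (chart G e (t + d * h)) = of_int (slope (e, t, d)) * h \<and> chart G e (t + d * h) \<notin> supp D)"
    unfolding exit_length_def by (rule someI_ex[OF exit_length_exists])
  then have p: "exit_length > 0" and a: "\<And>e t d h. (e, t, d) \<in> exits \<Longrightarrow> 0 < h \<Longrightarrow> h < exit_length \<Longrightarrow>
     0 < t + d * h \<and> t + d * h < len G e \<and>
     \<psi> (chart G e (t + d * h)) = of_int (slope (e, t, d)) * h \<and> chart G e (t + d * h) \<notin> supp D"
    by (simp, elim conjE) (drule (1) bspec, simp)
  show "0 < exit_length" by (rule p)
  show "0 < t + d * h" "t + d * h < len G e" "\<psi> (chart G e (t + d * h)) = of_int (slope (e, t, d)) * h"
    "chart G e (t + d * h) \<notin> supp D"
    if "(e, t, d) \<in> exits" "0 < h" "h < exit_length"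
    using a[OF that] by simp_all
qed

lemma exit_dir:
  assumes "(e, t, d) \<in> exits"
  shows "e \<in> edges G" "0 \<le> t" "t \<le> len G e" "d = 1 \<or> d = -1" "0 < slope (e, t, d)" "\<psi> (chart G e t) = 0"
  using assms by (auto simp: exits_iff tangents_def)

text \<open>If two rays meet in the same direction at different distances from their bases, one base
  lies inside the other ray, where \<open>\<psi>\<close> is positive. Meeting in opposite directions
  would make \<open>\<psi>\<close> both increase and decrease along the edge.\<close>

lemma along_inj:
  assumes \<tau>: "(e, t, d) \<in> exits" "0 < h" "h < exit_length"
    and \<tau>': "(e', t', d') \<in> exits" "0 < h'" "h' < exit_length"
    and eq: "chart G e (t + d * h) = chart G e' (t' + d' * h')"
  shows "(e, t, d) = (e', t', d') \<and> h = h'"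
proof -
  have e: "e' = e" and u: "t' + d' * h' = t + d * h"
    using chart_eqD[OF exit_dir(1)[OF \<tau>(1)] along_exit(1,2)[OF \<tau>], of e' "t' + d' * h'"]
      exit_dir(1)[OF \<tau>'(1)] along_exit(1,2)[OF \<tau>'] eq by auto
  let ?s = "real_of_int (slope (e, t, d))" and ?s' = "real_of_int (slope (e', t', d'))"
  have s: "?s > 0" "?s' > 0" using exit_dir(5)[OF \<tau>(1)] exit_dir(5)[OF \<tau>'(1)] by auto
  have v: "?s * h = ?s' * h'" using along_exit(3)[OF \<tau>] along_exit(3)[OF \<tau>'] eq by simp
  show ?thesis
  proof (cases "d = d'")
    case True
    show ?thesis
    proof (rule ccontr)
      assume "\<not> ?thesis"
      then have "h \<noteq> h'" using True u e by auto
      then consider "h' < h" | "h < h'" by linarith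
      then show False
      proof cases
        case 1
        have "t + d * (h - h') = t'" using u True by (simp add: algebra_simps)
        then have "\<psi> (chart G e t') = ?s * (h - h')" using along_exit(3)[OF \<tau>(1), of "h - h'"] 1 \<tau> \<tau>' by simp
        then show False using exit_dir(6)[OF \<tau>'(1)] e s 1 by simp
      next
        case 2
        have "t' + d' * (h' - h) = t" using u True by (simp add: algebra_simps)
        then have "\<psi> (chart G e' t) = ?s' * (h' - h)" using along_exit(3)[OF \<tau>'(1), of "h' - h"] 2 \<tau> \<tau>' by simp
        then show False using exit_dir(6)[OF \<tau>(1)] e s 2 by simp
      qed
    qed
  next
    case False
    then have d': "d' = - d" using exit_dir(4)[OF \<tau>(1)] exit_dir(4)[OF \<tau>'(1)] by auto
    define c where "c = min (exit_length - h) h' / 2"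
    have c: "0 < c" "h + c < exit_length" "c < h'" using \<tau> \<tau>' unfolding c_def by (auto simp: min_def field_simps)
    have "t' + d' * (h' - c) = t + d * (h + c)" using u d' by (simp add: algebra_simps)
    then have "?s * (h + c) = ?s' * (h' - c)"
      using along_exit(3)[OF \<tau>(1), of "h + c"] along_exit(3)[OF \<tau>'(1), of "h' - c"] c \<tau> \<tau>' e by simp
    then have "(?s + ?s') * c = 0" using v by (simp add: algebra_simps)
    then show ?thesis using s c by simp
  qed
qed

definition on_exit :: "'p \<Rightarrow> bool" where
  "on_exit x \<longleftrightarrow> (\<exists>\<tau>\<in>exits. \<exists>h. 0 < h \<and> h < exit_length \<and> x = along G \<tau> h)"

text \<open>A direction at a zero of \<open>\<psi>\<close> is an exit or has slope zero, and in the
  latter case \<open>\<psi>\<close> vanishes for a while along it.\<close>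

lemma on_exit_or_zero_near:
  assumes e: "e \<in> edges G" "0 \<le> u" "u \<le> len G e" and z: "\<psi> (chart G e u) = 0"
  shows "\<exists>\<delta>>0. \<forall>v. 0 \<le> v \<and> v \<le> len G e \<and> \<bar>v - u\<bar> < \<delta> \<longrightarrow> \<psi> (chart G e v) = 0 \<or> on_exit (chart G e v)"
proof -
  have dir: "\<exists>\<delta>>0. \<forall>h. 0 < h \<and> h < \<delta> \<longrightarrow> \<psi> (chart G e (u + d * h)) = 0 \<or> on_exit (chart G e (u + d * h))"
    if tan: "(e, u, d) \<in> tangents G (chart G e u)" for d
  proof (cases "(e, u, d) \<in> exits")
    case True
    then show ?thesis using exit_length_pos
      by (intro exI[of _ exit_length]) (auto simp: on_exit_def along_def intro!: bexI[of _ "(e, u, d)"])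
  next
    case False
    then have "slope (e, u, d) = 0"
      using tan z slope_nonneg_at_zero[OF z tan] by (auto simp: exits_iff)
    then have "\<forall>\<^sub>F h in at_right 0. \<psi> (chart G e (u + d * h)) = 0"
      using PL_has_slope[OF PL tan] z unfolding has_slope_def by simp
    then show ?thesis unfolding eventually_at_right_field by auto
  qed
  obtain a where a: "a > 0" "\<And>h. 0 < h \<Longrightarrow> h < a \<Longrightarrow> u < len G e \<Longrightarrow>
      \<psi> (chart G e (u + h)) = 0 \<or> on_exit (chart G e (u + h))"
  proof (cases "u < len G e")
    case True
    then show ?thesis using dir[of 1] e that by (auto simp: tangents_def)
  qed (use that[of 1] in auto)
  obtain b where b: "b > 0" "\<And>h. 0 < h \<Longrightarrow> h < b \<Longrightarrow> 0 < u \<Longrightarrow>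
      \<psi> (chart G e (u - h)) = 0 \<or> on_exit (chart G e (u - h))"
  proof (cases "0 < u")
    case True
    then show ?thesis using dir[of "-1"] e that by (auto simp: tangents_def)
  qed (use that[of 1] in auto)
  show ?thesis
  proof (intro exI[of _ "min a b"] conjI allI impI)
    show "0 < min a b" using a b by simp
    fix v assume v: "0 \<le> v \<and> v \<le> len G e \<and> \<bar>v - u\<bar> < min a b"
    consider "v = u" | "u < v" | "v < u" by linarith
    then show "\<psi> (chart G e v) = 0 \<or> on_exit (chart G e v)"
    proof cases
      case 2
      then show ?thesis using a(2)[of "v - u"] v by simp
    next
      case 3
      then show ?thesis using b(2)[of "u - v"] v by simp
    qed (use z in simp)
  qed
qed

lemma continuous_psi: "continuous_on UNIV \<psi>"
  using PL unfolding PL_def by blast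

text \<open>Compactness: points that are neither zeros nor on exit rays, with values tending to
  zero, would accumulate at a zero, against \<open>on_exit_or_zero_near\<close>.\<close>

lemma sublevel_edge:
  assumes e: "e \<in> edges G"
  shows "\<exists>c>0. \<forall>u. 0 \<le> u \<and> u \<le> len G e \<and> \<psi> (chart G e u) < c \<longrightarrow>
     \<psi> (chart G e u) = 0 \<or> on_exit (chart G e u)"
proof (rule ccontr)
  assume contra: "\<not> ?thesis"
  have "\<exists>u. u \<in> {0..len G e} \<and> \<psi> (chart G e u) < 1 / real (Suc n) \<and>
      \<not> (\<psi> (chart G e u) = 0 \<or> on_exit (chart G e u))" for n
  proof -
    have "0 < 1 / real (Suc n)" by simp
    then show ?thesis using contra by (metis atLeastAtMost_iff)
  qed
  then obtain u where u: "\<And>n. u n \<in> {0..len G e}" "\<And>n. \<psi> (chart G e (u n)) < 1 / real (Suc n)"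
    "\<And>n. \<not> (\<psi> (chart G e (u n)) = 0 \<or> on_exit (chart G e (u n)))"
    by metis
  obtain l r where l: "l \<in> {0..len G e}" "strict_mono (r::nat \<Rightarrow> nat)" "(u \<circ> r) \<longlonglongrightarrow> l"
    using compact_Icc[of 0 "len G e"] u(1) unfolding compact_def by metis
  have cont: "continuous_on {0..len G e} (\<lambda>u. \<psi> (chart G e u))"
    using continuous_on_compose2[OF continuous_psi continuous_chart[OF e]] by simp
  have lim: "(\<lambda>n. \<psi> (chart G e ((u \<circ> r) n))) \<longlonglongrightarrow> \<psi> (chart G e l)"
    by (rule continuous_on_tendsto_compose[OF cont l(3,1)]) (use u(1) in \<open>simp del: atLeastAtMost_iff\<close>)
  have "(\<lambda>n. 1 / real (Suc n)) \<longlonglongrightarrow> 0" using LIMSEQ_inverse_real_of_nat by (simp add: inverse_eq_divide)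
  then have "((\<lambda>n. 1 / real (Suc n)) \<circ> r) \<longlonglongrightarrow> 0" using l(2) by (rule LIMSEQ_subseq_LIMSEQ)
  then have "\<psi> (chart G e l) \<le> 0"
    by (rule LIMSEQ_le[OF lim]) (use u(2) in \<open>force intro: less_imp_le\<close>)
  then have "\<psi> (chart G e l) = 0" using nonneg[of "chart G e l"] by simp
  then obtain \<delta> where \<delta>: "\<delta> > 0" "\<And>v. 0 \<le> v \<Longrightarrow> v \<le> len G e \<Longrightarrow> \<bar>v - l\<bar> < \<delta> \<Longrightarrow>
      \<psi> (chart G e v) = 0 \<or> on_exit (chart G e v)"
    using on_exit_or_zero_near[OF e, of l] l(1) by auto
  obtain n where "dist ((u \<circ> r) n) l < \<delta>"
    using l(3) \<delta>(1) unfolding lim_sequentially by blast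
  then show False using \<delta>(2)[of "u (r n)"] u(1)[of "r n"] u(3)[of "r n"] by (simp add: dist_real_def)
qed

lemma sublevel:
  "\<exists>c>0. \<forall>x. \<psi> x < c \<longrightarrow> \<psi> x = 0 \<or> on_exit x"
proof -
  have "\<forall>\<^sub>F c in at_right 0. \<forall>e\<in>edges G. \<forall>u. 0 \<le> u \<and> u \<le> len G e \<and> \<psi> (chart G e u) < c \<longrightarrow>
     \<psi> (chart G e u) = 0 \<or> on_exit (chart G e u)"
    using finite_edges
  proof (rule eventually_ball_finite, intro ballI)
    fix e assume "e \<in> edges G"
    then obtain c where "c > 0" "\<forall>u. 0 \<le> u \<and> u \<le> len G e \<and> \<psi> (chart G e u) < c \<longrightarrow>
        \<psi> (chart G e u) = 0 \<or> on_exit (chart G e u)"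
      using sublevel_edge by blast
    then show "\<forall>\<^sub>F c in at_right 0. \<forall>u. 0 \<le> u \<and> u \<le> len G e \<and> \<psi> (chart G e u) < c \<longrightarrow>
        \<psi> (chart G e u) = 0 \<or> on_exit (chart G e u)"
      unfolding eventually_at_right_field by (intro exI[of _ c]) auto
  qed
  moreover have "\<forall>\<^sub>F c in at_right 0. \<forall>x\<in>verts G. \<psi> x < c \<longrightarrow> \<psi> x = 0"
    using finite_verts
  proof (rule eventually_ball_finite, intro ballI)
    fix x
    show "\<forall>\<^sub>F c in at_right 0. \<psi> x < c \<longrightarrow> \<psi> x = 0"
      unfolding eventually_at_right_field using nonneg[of x]
      by (intro exI[of _ "if \<psi> x = 0 then 1 else \<psi> x"]) auto
  qed
  ultimately have "\<forall>\<^sub>F c in at_right 0. \<forall>x. \<psi> x < c \<longrightarrow> \<psi> x = 0 \<or> on_exit x"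
  proof eventually_elim
    case (elim c)
    show ?case
    proof (intro allI impI)
      fix x assume x: "\<psi> x < c"
      show "\<psi> x = 0 \<or> on_exit x"
      proof (cases x rule: point_cases)
        case (2 e u)
        then show ?thesis using elim(1) x by (meson less_imp_le)
      qed (use elim(2) x in blast)
    qed
  qed
  then obtain b where b: "b > 0" "\<And>c. 0 < c \<Longrightarrow> c < b \<Longrightarrow> \<forall>x. \<psi> x < c \<longrightarrow> \<psi> x = 0 \<or> on_exit x"
    unfolding eventually_at_right_field by blast
  show ?thesis using b(1) b(2)[of "b / 2"] by (intro exI[of _ "b / 2"] conjI) simp_all
qed

end

context truncation
begin

text \<open>The zero set is relatively open in the complement of the chips: points of small positive
  height lie in a compact set \<open>K\<close> of closed exit rays, and the zeros in
  \<open>K\<close> are chips. So \<open>Z\<close> is open, consists of zeros and catches all zeros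
  in \<open>S\<close>; connectedness of \<open>S\<close> does the rest.\<close>

lemma zero_set_component:
  assumes S: "S \<in> components (- supp D)" and x: "x \<in> S" "\<psi> x = 0"
  shows "S \<subseteq> {y. \<psi> y = 0}"
proof -
  obtain c where c: "c > 0" "\<And>x. \<psi> x < c \<Longrightarrow> \<psi> x = 0 \<or> on_exit x" using sublevel by blast
  define b where "b = exit_length / 2"
  \<comment> \<open>Slopes at exits are positive integers, so height below \<open>b\<close> on a ray
    forces distance below \<open>b\<close> from its base, which places the point in
    \<open>K\<close>.\<close>
  define c' where "c' = min c b"
  have b: "0 < b" "b < exit_length" using exit_length_pos by (auto simp: b_def)
  define K where "K = (\<Union>\<tau>\<in>exits. along G \<tau> ` {0..b})"
  have "compact (along G \<tau> ` {0..b})" if \<tau>: "\<tau> \<in> exits" for \<tau>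
  proof -
    obtain e t d where eq: "\<tau> = (e, t, d)" by (cases \<tau>)
    have "t + d * h \<in> {0..len G e}" if "h \<in> {0..b}" for h
    proof (cases "h = 0")
      case True
      then show ?thesis using exit_dir(2,3) \<tau> eq by auto
    next
      case False
      then show ?thesis using along_exit(1,2)[of e t d h] \<tau> eq that b by auto
    qed
    then have "continuous_on {0..b} (\<lambda>h. chart G e (t + d * h))"
      using exit_dir(1) \<tau> eq
      by (intro continuous_on_compose2[OF continuous_chart[of e]] continuous_intros) auto
    then show ?thesis unfolding along_def eq prod.case by (intro compact_continuous_image compact_Icc)
  qed
  then have "closed K" unfolding K_def using finite_exits by (intro closed_UN compact_imp_closed) auto
  have Kpos: "y \<in> supp D \<or> 0 < \<psi> y" if y: "y \<in> K" for y
  proof -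
    obtain e t d h where h: "(e, t, d) \<in> exits" "0 \<le> h" "h \<le> b" "y = chart G e (t + d * h)"
      using y unfolding K_def along_def by auto
    show ?thesis
    proof (cases "h = 0")
      case True
      then show ?thesis using base_exits[OF h(1)] h(4) by (simp add: base_def)
    next
      case False
      then show ?thesis using along_exit(3)[OF h(1), of h] h b exit_dir(5)[OF h(1)] by simp
    qed
  qed
  have inK: "y \<in> K" if "\<psi> y < c'" "\<psi> y \<noteq> 0" for y
  proof -
    have "on_exit y" using c(2)[of y] that unfolding c'_def by auto
    then obtain e t d h where h: "(e, t, d) \<in> exits" "0 < h" "h < exit_length" "y = chart G e (t + d * h)"
      unfolding on_exit_def along_def by auto
    have "1 * h \<le> of_int (slope (e, t, d)) * h" using exit_dir(5)[OF h(1)] h(2) by (intro mult_right_mono) auto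
    then have "h < b" using along_exit(3)[OF h(1-3)] h(4) that(1) unfolding c'_def by simp
    then show ?thesis unfolding K_def along_def using h by (intro UN_I[OF h(1)]) auto
  qed
  define Z where "Z = {y. \<psi> y < c'} - K"
  have "open Z" unfolding Z_def using \<open>closed K\<close> open_Collect_less[OF continuous_psi continuous_on_const]
    by (intro open_Diff)
  moreover have "open {y. 0 < \<psi> y}" by (intro open_Collect_less continuous_psi continuous_on_const)
  moreover have c': "0 < c'" unfolding c'_def using c(1) b(1) by simp
  have sub: "S \<subseteq> - supp D" and "connected S" using S in_components_subset in_components_connected by auto
  have Z0: "\<psi> y = 0" if "y \<in> Z" for y using inK that unfolding Z_def by blast
  have 0: "y \<in> Z" if "y \<in> S" "\<psi> y = 0" for y using Kpos[of y] that sub c' unfolding Z_def by auto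
  moreover have "S \<subseteq> Z \<union> {y. 0 < \<psi> y}"
  proof
    fix y assume "y \<in> S"
    then show "y \<in> Z \<union> {y. 0 < \<psi> y}" using 0[of y] nonneg[of y] by (cases "\<psi> y = 0") auto
  qed
  moreover have "Z \<inter> {y. 0 < \<psi> y} \<inter> S = {}" using Z0 by force
  moreover have "Z \<inter> S \<noteq> {}" using x 0 by blast
  ultimately have "{y. 0 < \<psi> y} \<inter> S = {}" using connectedD[OF \<open>connected S\<close>] by blast
  then show ?thesis using nonneg by (auto simp: less_le)
qed

section \<open>Divisors of truncations: firing the zero set\<close>

abbreviation "trunc t \<equiv> (\<lambda>x. min (\<psi> x) t)"

definition tip :: "real \<Rightarrow> 'e \<times> real \<times> real \<Rightarrow> 'p" where
  "tip t \<tau> = along G \<tau> (t / of_int (slope \<tau>))"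

definition small :: "real \<Rightarrow> bool" where
  "small t \<longleftrightarrow> 0 < t \<and> t < exit_length \<and> (\<forall>x. \<psi> x \<le> t \<longrightarrow> \<psi> x = 0 \<or> on_exit x)"

lemma eventually_small: "\<forall>\<^sub>F t in at_right 0. small t"
proof -
  obtain c where "c > 0" "\<And>x. \<psi> x < c \<Longrightarrow> \<psi> x = 0 \<or> on_exit x" using sublevel by blast
  then show ?thesis unfolding eventually_at_right_field small_def
    using exit_length_pos by (intro exI[of _ "min c exit_length"]) auto
qed

lemma trunc_has_slope:
  assumes "(e, u, d) \<in> tangents G x"
  shows "has_slope G (trunc t) e u d (if \<psi> x < t then slope (e, u, d) else if t < \<psi> x then 0 else min (slope (e, u, d)) 0)"
proof -
  have "chart G e u = x" using assms by (simp add: tangents_def)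
  then show ?thesis using has_slope_min_const[OF PL_has_slope[OF PL assms], of t] by (simp only:)
qed

lemma out_slope_trunc:
  assumes "\<tau> \<in> tangents G x"
  shows "out_slope G (trunc t) \<tau> = (if \<psi> x < t then slope \<tau> else if t < \<psi> x then 0 else min (slope \<tau>) 0)"
proof -
  obtain e u d where "\<tau> = (e, u, d)" by (cases \<tau>)
  then show ?thesis using out_slope_eq[OF trunc_has_slope] assms by simp
qed

lemma div_trunc_zero:
  assumes "0 < t" "\<psi> x = 0"
  shows "div_of G (trunc t) x = - (\<Sum>\<tau> | \<tau> \<in> exits \<and> base G \<tau> = x. slope \<tau>)"
proof -
  have "div_of G (trunc t) x = - (\<Sum>\<tau>\<in>tangents G x. slope \<tau>)"
    unfolding div_of_def using assms by (simp add: out_slope_trunc sum_negf)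
  also have "(\<Sum>\<tau>\<in>tangents G x. slope \<tau>) = (\<Sum>\<tau> | \<tau> \<in> exits \<and> base G \<tau> = x. slope \<tau>)"
  proof (rule sum.mono_neutral_right[OF finite_tangents])
    show "{\<tau>. \<tau> \<in> exits \<and> base G \<tau> = x} \<subseteq> tangents G x" unfolding exits_def by auto
    show "\<forall>\<tau>\<in>tangents G x - {\<tau>. \<tau> \<in> exits \<and> base G \<tau> = x}. slope \<tau> = 0"
    proof
      fix \<tau> assume \<tau>: "\<tau> \<in> tangents G x - {\<tau>. \<tau> \<in> exits \<and> base G \<tau> = x}"
      then have "base G \<tau> = x" by (auto simp: tangents_def base_def)
      then have "\<not> 0 < slope \<tau>" using \<tau> assms unfolding exits_def by auto
      moreover have "0 \<le> slope \<tau>" using slope_nonneg_at_zero[OF assms(2)] \<tau> by blast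
      ultimately show "slope \<tau> = 0" by linarith
    qed
  qed
  finally show ?thesis .
qed

lemma div_trunc_above:
  assumes "t < \<psi> x"
  shows "div_of G (trunc t) x = 0"
  unfolding div_of_def using assms by (simp add: out_slope_trunc)

lemma slope_along_exit:
  assumes \<tau>: "(e, t, d) \<in> exits" and h: "0 < h" "h < exit_length"
  shows "slope (e, t + d * h, d) = slope (e, t, d)" "slope (e, t + d * h, - d) = - slope (e, t, d)"
proof -
  let ?s = "real_of_int (slope (e, t, d))"
  have v: "\<psi> (chart G e (t + d * h')) = ?s * h'" if "0 < h'" "h' < exit_length" for h'
    using along_exit(3)[OF \<tau> that] .
  have "\<psi> (chart G e (t + d * h + d * k)) = \<psi> (chart G e (t + d * h)) + ?s * k"
    if "0 < k" "k < exit_length - h" for k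
    using v[of h] v[of "h + k"] h that by (simp add: algebra_simps)
  then have "has_slope G \<psi> e (t + d * h) d (slope (e, t, d))"
    unfolding has_slope_def eventually_at_right_field using h
    by (intro exI[of _ "exit_length - h"]) auto
  then show "slope (e, t + d * h, d) = slope (e, t, d)" by (rule out_slope_eq)
  have "\<psi> (chart G e (t + d * h + - d * k)) = \<psi> (chart G e (t + d * h)) + real_of_int (- slope (e, t, d)) * k"
    if "0 < k" "k < h" for k
    using v[of h] v[of "h - k"] h that by (simp add: algebra_simps)
  then have "has_slope G \<psi> e (t + d * h) (- d) (- slope (e, t, d))"
    unfolding has_slope_def eventually_at_right_field using h
    by (intro exI[of _ h]) auto
  then show "slope (e, t + d * h, - d) = - slope (e, t, d)" by (rule out_slope_eq)
qed

text \<open>Inside a ray the two outgoing slopes of \<open>\<psi>\<close> are opposite and cancel.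
  Truncation flattens only the upward one exactly at height \<open>t\<close>, which leaves
  \<open>slope \<tau>\<close> chips there.\<close>

lemma div_trunc_exit:
  assumes \<tau>: "\<tau> \<in> exits" and h: "0 < h" "h < exit_length"
  shows "div_of G (trunc t) (along G \<tau> h) = (if of_int (slope \<tau>) * h = t then slope \<tau> else 0)"
    and "\<psi> (along G \<tau> h) = of_int (slope \<tau>) * h" and "along G \<tau> h \<notin> supp D"
    and "valence G (along G \<tau> h) = 2"
proof -
  obtain e u d where eq: "\<tau> = (e, u, d)" by (cases \<tau>)
  let ?v = "u + d * h"
  have \<tau>': "(e, u, d) \<in> exits" using \<tau> eq by simp
  have x: "along G \<tau> h = chart G e ?v" by (simp add: along_def eq)
  note int = exit_dir(1)[OF \<tau>'] along_exit(1,2)[OF \<tau>' h]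
  have "tangents G (chart G e ?v) = {(e, ?v, d), (e, ?v, - d)}"
    unfolding tangents_interior[OF int] using exit_dir(4)[OF \<tau>'] by auto
  moreover have "d \<noteq> - d" using exit_dir(4)[OF \<tau>'] by auto
  ultimately have "div_of G (trunc t) (chart G e ?v) =
      - out_slope G (trunc t) (e, ?v, d) - out_slope G (trunc t) (e, ?v, - d)"
    and t: "(e, ?v, d) \<in> tangents G (chart G e ?v)" "(e, ?v, - d) \<in> tangents G (chart G e ?v)"
    unfolding div_of_def by simp_all
  moreover show val: "\<psi> (along G \<tau> h) = of_int (slope \<tau>) * h"
    using along_exit(3)[OF \<tau>' h] x eq by simp
  ultimately show "div_of G (trunc t) (along G \<tau> h) = (if of_int (slope \<tau>) * h = t then slope \<tau> else 0)"
    using slope_along_exit[OF \<tau>' h] exit_dir(5)[OF \<tau>'] unfolding x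
    by (simp add: out_slope_trunc eq)
  show "along G \<tau> h \<notin> supp D" using along_exit(4)[OF \<tau>' h] x by simp
  show "valence G (along G \<tau> h) = 2" unfolding x by (rule valence_interior[OF int])
qed

lemma tip_height:
  assumes "small t" "\<tau> \<in> exits"
  shows "0 < t / of_int (slope \<tau>)" "t / of_int (slope \<tau>) < exit_length" "t / of_int (slope \<tau>) \<le> t"
    "0 < slope \<tau>"
proof -
  show s: "0 < slope \<tau>" using assms(2) unfolding exits_def by auto
  then show "0 < t / of_int (slope \<tau>)" using assms(1) unfolding small_def by simp
  have "t / of_int (slope \<tau>) \<le> t / 1" using s assms(1) unfolding small_def by (intro divide_left_mono) auto
  then show "t / of_int (slope \<tau>) \<le> t" by simp
  then show "t / of_int (slope \<tau>) < exit_length" using assms(1) unfolding small_def by simp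
qed

lemma tip:
  assumes "small t" "\<tau> \<in> exits"
  shows "div_of G (trunc t) (tip t \<tau>) = slope \<tau>" "\<psi> (tip t \<tau>) = t" "tip t \<tau> \<notin> supp D"
    "valence G (tip t \<tau>) = 2"
  using div_trunc_exit[OF assms(2) tip_height(1,2)[OF assms]] tip_height(4)[OF assms] unfolding tip_def by auto

lemma dist_tip:
  assumes "small t" "\<tau> \<in> exits"
  shows "dist (base G \<tau>) (tip t \<tau>) \<le> t"
proof -
  obtain e u d where eq: "\<tau> = (e, u, d)" by (cases \<tau>)
  let ?h = "t / of_int (slope \<tau>)"
  have \<tau>': "(e, u, d) \<in> exits" using assms eq by simp
  have "dist (chart G e u) (chart G e (u + d * ?h)) \<le> \<bar>u + d * ?h - u\<bar>"
    using exit_dir(1-3)[OF \<tau>'] along_exit(1,2)[OF \<tau>' tip_height(1,2)[OF assms]] by (intro dist_chart_le) auto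
  also have "\<dots> = ?h" using exit_dir(4)[OF \<tau>'] less_imp_le[OF tip_height(1)[OF assms]]
    by (auto simp only: add_diff_cancel_left' mult_1 mult_minus1 abs_minus_cancel abs_of_nonneg)
  finally show ?thesis using tip_height(3)[OF assms] by (simp add: tip_def along_def base_def eq)
qed

lemma inj_tip:
  assumes "small t"
  shows "inj_on (tip t) exits"
proof (rule inj_onI)
  fix \<sigma> \<tau> assume *: "\<sigma> \<in> exits" "\<tau> \<in> exits" "tip t \<sigma> = tip t \<tau>"
  obtain e u d e' u' d' where eq: "\<sigma> = (e, u, d)" "\<tau> = (e', u', d')" by (cases \<sigma>, cases \<tau>)
  have "chart G e (u + d * (t / of_int (slope \<sigma>))) = chart G e' (u' + d' * (t / of_int (slope \<tau>)))"
    using *(3) unfolding tip_def along_def eq prod.case .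
  from along_inj[OF _ _ _ _ _ _ this] show "\<sigma> = \<tau>"
    using tip_height(1,2)[OF assms *(1)] tip_height(1,2)[OF assms *(2)] * eq by auto
qed

lemma div_trunc_other:
  assumes "small t" "\<psi> x \<noteq> 0" "x \<notin> tip t ` exits"
  shows "div_of G (trunc t) x = 0"
proof (cases "t < \<psi> x")
  case False
  then have "on_exit x" using assms(1,2) unfolding small_def not_less by blast
  then obtain \<tau> h where h: "\<tau> \<in> exits" "0 < h" "h < exit_length" "x = along G \<tau> h"
    unfolding on_exit_def by blast
  have "of_int (slope \<tau>) * h \<noteq> t"
  proof
    assume "of_int (slope \<tau>) * h = t"
    then have "h = t / of_int (slope \<tau>)" using tip_height(4)[OF assms(1) h(1)] by (simp add: field_simps)
    then show False using assms(3) h(1,4) unfolding tip_def by auto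
  qed
  then show ?thesis using div_trunc_exit(1)[OF h(1-3), of t] h(4) by simp
qed (rule div_trunc_above)

text \<open>The outcome of chip firing: each exit carries \<open>slope \<tau>\<close> chips from its
  base to its tip and nothing else changes, as \<open>moved_zero\<close>, \<open>moved_tip\<close>
  and \<open>moved_other\<close> make precise.\<close>

definition moved :: "real \<Rightarrow> 'p \<Rightarrow> int" where
  "moved t = (\<lambda>x. D x + div_of G (trunc t) x)"

lemma moved_zero:
  assumes "small t" "\<psi> x = 0"
  shows "moved t x = D x - (\<Sum>\<tau> | \<tau> \<in> exits \<and> base G \<tau> = x. slope \<tau>)"
  unfolding moved_def using div_trunc_zero[of t x] assms by (simp add: small_def)

lemma moved_tip:
  assumes "small t" "\<tau> \<in> exits"
  shows "moved t (tip t \<tau>) = slope \<tau>"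
  unfolding moved_def using tip[OF assms] by (simp add: supp_def)

lemma moved_other:
  assumes "small t" "\<psi> x \<noteq> 0" "x \<notin> tip t ` exits"
  shows "moved t x = D x"
  unfolding moved_def using div_trunc_other[OF assms] by simp

lemma moved_le:
  assumes "small t" "x \<notin> tip t ` exits"
  shows "moved t x \<le> D x"
proof (cases "\<psi> x = 0")
  case True
  have "0 \<le> (\<Sum>\<tau> | \<tau> \<in> exits \<and> base G \<tau> = x. slope \<tau>)" by (intro sum_nonneg) (auto simp: exits_def)
  then show ?thesis using moved_zero[OF assms(1) True] by simp
qed (use moved_other[OF assms(1)] assms(2) in simp)

lemma base_in_zero: "\<tau> \<in> exits \<Longrightarrow> \<psi> (base G \<tau>) = 0"
  unfolding exits_def by simp

lemma supp_moved:
  assumes "small t"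
  shows "supp (moved t) = {p \<in> supp D. moved t p \<noteq> 0} \<union> tip t ` exits"
proof -
  have "p \<in> tip t ` exits" if p: "moved t p \<noteq> 0" "p \<notin> supp D" for p
  proof (rule ccontr)
    assume n: "p \<notin> tip t ` exits"
    have e: "{\<tau>. \<tau> \<in> exits \<and> base G \<tau> = p} = {}" using base_exits p(2) by auto
    have "moved t p = D p"
      using moved_zero[OF assms, of p] moved_other[OF assms _ n] unfolding e by (cases "\<psi> p = 0") auto
    then show False using p by (simp add: supp_def)
  qed
  moreover have "moved t (tip t \<tau>) \<noteq> 0" if "\<tau> \<in> exits" for \<tau>
    using moved_tip[OF assms that] tip_height(4)[OF assms that] by simp
  ultimately show ?thesis unfolding supp_def by auto
qed

text \<open>Only bases of exits can lose their last chip, while the tips are new points, one for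
  each exit. So the loss is at most the number of bases and the gain is the number of exits, which
  is larger as soon as two exits share a base.\<close>

lemma card_supp_moved:
  assumes t: "small t" and eff: "\<And>p. 0 \<le> D p"
  shows "finite (supp (moved t))" "card (supp D) \<le> card (supp (moved t))"
    "\<not> inj_on (base G) exits \<Longrightarrow> card (supp D) < card (supp (moved t))"
proof -
  let ?A = "{p \<in> supp D. moved t p \<noteq> 0}"
  show "finite (supp (moved t))" unfolding supp_moved[OF t] using finite_supp finite_exits by simp
  have "card (supp (moved t)) = card ?A + card (tip t ` exits)"
    unfolding supp_moved[OF t] using finite_supp finite_exits tip(3)[OF t] by (intro card_Un_disjoint) auto
  also have "card (tip t ` exits) = card exits" by (rule card_image[OF inj_tip[OF t]])
  finally have c: "card (supp (moved t)) = card ?A + card exits" .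
  have "p \<in> base G ` exits" if p: "p \<in> supp D" "moved t p = 0" for p
  proof (rule ccontr)
    assume n: "p \<notin> base G ` exits"
    then have e: "{\<tau>. \<tau> \<in> exits \<and> base G \<tau> = p} = {}" by auto
    have "p \<notin> tip t ` exits" using tip(3)[OF t] p(1) by auto
    then have "moved t p = D p"
      using moved_zero[OF t, of p] moved_other[OF t, of p] unfolding e by (cases "\<psi> p = 0") auto
    then show False using p by (simp add: supp_def)
  qed
  then have "supp D \<subseteq> ?A \<union> base G ` exits" by auto
  then have "card (supp D) \<le> card (?A \<union> base G ` exits)"
    using finite_supp finite_exits by (intro card_mono) auto
  also have "\<dots> \<le> card ?A + card (base G ` exits)" by (rule card_Un_le)
  finally have d: "card (supp D) \<le> card ?A + card (base G ` exits)" .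
  have i: "card (base G ` exits) \<le> card exits" using finite_exits by (rule card_image_le)
  show "card (supp D) \<le> card (supp (moved t))" using c d i by simp
  assume "\<not> inj_on (base G) exits"
  then have "card (base G ` exits) \<noteq> card exits" using eq_card_imp_inj_on[OF finite_exits] by blast
  then show "card (supp D) < card (supp (moved t))" using c d i by simp
qed

end

section \<open>Chips near a nondegenerate divisor\<close>

text \<open>Bookkeeping for lifting \<open>moved t\<close> to a tuple:
  \<open>f i = Some \<tau>\<close> sends the chip with index \<open>i\<close> along the exit
  \<open>\<tau>\<close>, \<open>None\<close> leaves it in place.\<close>

lemma split_indices:
  fixes x :: "nat \<Rightarrow> 'p" and b :: "'a \<Rightarrow> 'p" and s :: "'a \<Rightarrow> nat"
  assumes "finite T" "\<And>p. (\<Sum>\<tau> | \<tau> \<in> T \<and> b \<tau> = p. s \<tau>) \<le> card {i. i < d \<and> x i = p}"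
  shows "\<exists>f. (\<forall>i<d. \<forall>\<tau>. f i = Some \<tau> \<longrightarrow> \<tau> \<in> T \<and> x i = b \<tau>) \<and>
     (\<forall>\<tau>\<in>T. card {i. i < d \<and> f i = Some \<tau>} = s \<tau>) \<and>
     (\<forall>p. card {i. i < d \<and> x i = p \<and> f i = None} + (\<Sum>\<tau> | \<tau> \<in> T \<and> b \<tau> = p. s \<tau>) = card {i. i < d \<and> x i = p})"
  using assms
proof (induction T)
  case empty
  then show ?case by (intro exI[of _ "\<lambda>_. None"]) simp
next
  case (insert \<tau> T)
  have S: "(\<Sum>\<sigma> | \<sigma> \<in> insert \<tau> T \<and> b \<sigma> = p. s \<sigma>) = (\<Sum>\<sigma> | \<sigma> \<in> T \<and> b \<sigma> = p. s \<sigma>) + (if b \<tau> = p then s \<tau> else 0)" for p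
  proof (cases "b \<tau> = p")
    case True
    then have "{\<sigma>. \<sigma> \<in> insert \<tau> T \<and> b \<sigma> = p} = insert \<tau> {\<sigma>. \<sigma> \<in> T \<and> b \<sigma> = p}" by auto
    then show ?thesis using insert.hyps True by simp
  next
    case False
    then have "{\<sigma>. \<sigma> \<in> insert \<tau> T \<and> b \<sigma> = p} = {\<sigma>. \<sigma> \<in> T \<and> b \<sigma> = p}" by auto
    then show ?thesis using False by simp
  qed
  have "(\<Sum>\<tau> | \<tau> \<in> T \<and> b \<tau> = p. s \<tau>) \<le> card {i. i < d \<and> x i = p}" for p
    using insert.prems[of p] S[of p] by simp
  from insert.IH[OF this] obtain f where f': "\<forall>i<d. \<forall>\<tau>. f i = Some \<tau> \<longrightarrow> \<tau> \<in> T \<and> x i = b \<tau>"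
    "\<forall>\<tau>\<in>T. card {i. i < d \<and> f i = Some \<tau>} = s \<tau>"
    "\<forall>p. card {i. i < d \<and> x i = p \<and> f i = None} + (\<Sum>\<tau> | \<tau> \<in> T \<and> b \<tau> = p. s \<tau>) = card {i. i < d \<and> x i = p}"
    by (elim exE conjE)
  then have f: "\<And>i \<sigma>. i < d \<Longrightarrow> f i = Some \<sigma> \<Longrightarrow> \<sigma> \<in> T \<and> x i = b \<sigma>"
    "\<And>\<sigma>. \<sigma> \<in> T \<Longrightarrow> card {i. i < d \<and> f i = Some \<sigma>} = s \<sigma>"
    "\<And>p. card {i. i < d \<and> x i = p \<and> f i = None} + (\<Sum>\<tau> | \<tau> \<in> T \<and> b \<tau> = p. s \<tau>) = card {i. i < d \<and> x i = p}"
    by simp_all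
  \<comment> \<open>The indices at the base of \<open>\<tau>\<close> that are still unassigned; the
    count for \<open>T\<close> leaves at least \<open>s \<tau>\<close> of them.\<close>
  let ?J = "{i. i < d \<and> x i = b \<tau> \<and> f i = None}"
  have "s \<tau> \<le> card ?J" using insert.prems[of "b \<tau>"] S[of "b \<tau>"] f(3)[of "b \<tau>"] by simp
  then obtain K where K: "K \<subseteq> ?J" "card K = s \<tau>" by (rule obtain_subset_with_card_n)
  have finK: "finite K" using K(1) finite_subset by fastforce
  let ?f = "\<lambda>i. if i \<in> K then Some \<tau> else f i"
  show ?case
  proof (intro exI[of _ ?f] conjI allI impI ballI)
    fix i \<sigma> assume "i < d" "?f i = Some \<sigma>"
    then show "\<sigma> \<in> insert \<tau> T" "x i = b \<sigma>" using f(1)[of i \<sigma>] K(1) by (auto split: if_splits)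
  next
    fix \<sigma> assume \<sigma>: "\<sigma> \<in> insert \<tau> T"
    show "card {i. i < d \<and> ?f i = Some \<sigma>} = s \<sigma>"
    proof (cases "\<sigma> = \<tau>")
      case True
      have "{i. i < d \<and> ?f i = Some \<sigma>} = K" using True K(1) f(1) insert.hyps(2) by auto
      then show ?thesis using K(2) True by simp
    next
      case False
      then have "{i. i < d \<and> ?f i = Some \<sigma>} = {i. i < d \<and> f i = Some \<sigma>}" using K(1) by auto
      then show ?thesis using f(2)[of \<sigma>] \<sigma> False by auto
    qed
  next
    fix p
    show "card {i. i < d \<and> x i = p \<and> ?f i = None} + (\<Sum>\<sigma> | \<sigma> \<in> insert \<tau> T \<and> b \<sigma> = p. s \<sigma>) = card {i. i < d \<and> x i = p}"
    proof (cases "b \<tau> = p")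
      case True
      have "{i. i < d \<and> x i = p \<and> ?f i = None} = ?J - K" using True by auto
      moreover have "card (?J - K) + card K = card ?J"
        using card_Diff_subset[OF finK K(1)] card_mono[OF _ K(1)] by simp
      ultimately show ?thesis using S[of p] f(3)[of p] K(2) True by simp
    next
      case False
      have "{i. i < d \<and> x i = p \<and> ?f i = None} = {i. i < d \<and> x i = p \<and> f i = None}" using False K(1) by auto
      then show ?thesis using S[of p] f(3)[of p] False by simp
    qed
  qed
qed

lemma topspace_power [simp]: "topspace (power_topology d) = PiE {..<d} (\<lambda>_. UNIV)"
  by (simp add: power_topology_def)

lemma divisor_of_tuple_alt: "divisor_of_tuple d x p = int (card {i. i < d \<and> x i = p})"
  by (simp add: divisor_of_tuple_def)

lemma Sym_open_contains_near:
  fixes x :: "nat \<Rightarrow> 'p::metric_space"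
  assumes W: "openin (Sym_topology d) W" and x: "x \<in> topspace (power_topology d)" "divisor_of_tuple d x \<in> W"
  shows "\<exists>\<delta>>0. \<forall>y\<in>topspace (power_topology d). (\<forall>i<d. dist (x i) (y i) < \<delta>) \<longrightarrow> divisor_of_tuple d y \<in> W"
proof -
  let ?P = "{x \<in> topspace (power_topology d). divisor_of_tuple d x \<in> W}"
  have "openin (product_topology (\<lambda>_. euclidean) {..<d}) ?P"
    using W unfolding openin_Sym_topology power_topology_def by blast
  moreover have "x \<in> ?P" using x by simp
  ultimately have "\<exists>U. (\<forall>i\<in>{..<d}. open (U i)) \<and> x \<in> PiE {..<d} U \<and> PiE {..<d} U \<subseteq> ?P"
    unfolding openin_product_topology_alt by (auto simp del: topspace_power)
  then obtain U where U: "\<And>i. i \<in> {..<d} \<Longrightarrow> open (U i)" "x \<in> PiE {..<d} U" "PiE {..<d} U \<subseteq> ?P"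
    by blast
  have "\<forall>\<^sub>F \<delta> in at_right 0. \<forall>i\<in>{..<d}. \<forall>z. dist (x i) z < \<delta> \<longrightarrow> z \<in> U i"
  proof (rule eventually_ball_finite, simp, rule ballI)
    fix i assume i: "i \<in> {..<d}"
    have "x i \<in> U i" using U(2) i by (rule PiE_mem)
    then obtain e where "e > 0" "ball (x i) e \<subseteq> U i" using U(1)[OF i] openE by blast
    then show "\<forall>\<^sub>F \<delta> in at_right 0. \<forall>z. dist (x i) z < \<delta> \<longrightarrow> z \<in> U i"
      unfolding eventually_at_right_field by (intro exI[of _ e]) (auto simp: subset_iff)
  qed
  then obtain b where b: "b > 0" "\<And>\<delta>. 0 < \<delta> \<Longrightarrow> \<delta> < b \<Longrightarrow> \<forall>i\<in>{..<d}. \<forall>z. dist (x i) z < \<delta> \<longrightarrow> z \<in> U i"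
    unfolding eventually_at_right_field by blast
  show ?thesis
  proof (intro exI[of _ "b / 2"] conjI ballI impI)
    show "0 < b / 2" using b(1) by simp
    fix y assume y: "y \<in> topspace (power_topology d)" "\<forall>i<d. dist (x i) (y i) < b / 2"
    have "y \<in> PiE {..<d} U" using y b(1) b(2)[of "b / 2"] by (auto simp: PiE_iff)
    then show "divisor_of_tuple d y \<in> W" using U(3) by auto
  qed
qed

text \<open>Effectivity says that no base gives away more chips than it holds, which is the counting
  hypothesis of \<open>split_indices\<close>. A chip that moves travels at most \<open>t\<close>,
  because slopes at exits are at least 1.\<close>

lemma (in truncation) moved_near:
  assumes t: "small t" and D: "D = divisor_of_tuple d x" and eff: "effective (moved t)"
  shows "\<exists>y\<in>topspace (power_topology d). divisor_of_tuple d y = moved t \<and> (\<forall>i<d. dist (x i) (y i) \<le> t)"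
proof -
  let ?s = "\<lambda>\<tau>. nat (slope \<tau>)"
  have s: "int (\<Sum>\<tau> | \<tau> \<in> exits \<and> base G \<tau> = p. ?s \<tau>) = (\<Sum>\<tau> | \<tau> \<in> exits \<and> base G \<tau> = p. slope \<tau>)" for p
    unfolding int_sum by (intro sum.cong) (auto simp: exits_def)
  have none: "{\<tau>. \<tau> \<in> exits \<and> base G \<tau> = p} = {}" if "\<psi> p \<noteq> 0" for p using base_in_zero that by auto
  have "(\<Sum>\<tau> | \<tau> \<in> exits \<and> base G \<tau> = p. ?s \<tau>) \<le> card {i. i < d \<and> x i = p}" for p
  proof (cases "\<psi> p = 0")
    case True
    have "0 \<le> moved t p" using eff by (simp add: effective_def)
    then have "int (\<Sum>\<tau> | \<tau> \<in> exits \<and> base G \<tau> = p. ?s \<tau>) \<le> D p" using moved_zero[OF t True] s[of p] by simp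
    then show ?thesis unfolding D divisor_of_tuple_alt of_nat_le_iff .
  qed (simp add: none)
  from split_indices[OF finite_exits this] obtain f where
    "\<forall>i<d. \<forall>\<tau>. f i = Some \<tau> \<longrightarrow> \<tau> \<in> exits \<and> x i = base G \<tau>"
    "\<forall>\<tau>\<in>exits. card {i. i < d \<and> f i = Some \<tau>} = ?s \<tau>"
    "\<forall>p. card {i. i < d \<and> x i = p \<and> f i = None} + (\<Sum>\<tau> | \<tau> \<in> exits \<and> base G \<tau> = p. ?s \<tau>) = card {i. i < d \<and> x i = p}"
    by (elim exE conjE)
  then have f:
    "\<And>i \<tau>. i < d \<Longrightarrow> f i = Some \<tau> \<Longrightarrow> \<tau> \<in> exits \<and> x i = base G \<tau>"
    "\<And>\<tau>. \<tau> \<in> exits \<Longrightarrow> card {i. i < d \<and> f i = Some \<tau>} = ?s \<tau>"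
    "\<And>p. card {i. i < d \<and> x i = p \<and> f i = None} + (\<Sum>\<tau> | \<tau> \<in> exits \<and> base G \<tau> = p. ?s \<tau>) = card {i. i < d \<and> x i = p}"
    by (simp_all del: split_paired_All)
  \<comment> \<open>The value \<open>undefined\<close> beyond the index range keeps \<open>y\<close>
    extensional, as points of the product topology must be.\<close>
  define y where "y i = (if i < d then case f i of None \<Rightarrow> x i | Some \<tau> \<Rightarrow> tip t \<tau> else undefined)" for i
  have "divisor_of_tuple d y q = moved t q" for q
  proof (cases "q \<in> tip t ` exits")
    case True
    then obtain \<tau> where \<tau>: "\<tau> \<in> exits" "q = tip t \<tau>" by blast
    have "card {i. i < d \<and> x i = q} = 0"
      using tip(3)[OF t \<tau>(1)] \<tau>(2) unfolding supp_def D divisor_of_tuple_alt by simp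
    then have nx: "x i \<noteq> q" if "i < d" for i using that by auto
    have "{i. i < d \<and> y i = q} = {i. i < d \<and> f i = Some \<tau>}"
    proof (intro Collect_cong conj_cong refl)
      fix i assume i: "i < d"
      show "(y i = q) = (f i = Some \<tau>)"
      proof (cases "f i")
        case None
        then show ?thesis using nx[OF i] i by (simp add: y_def)
      next
        case (Some \<sigma>)
        then have "\<sigma> \<in> exits" using f(1) i by blast
        then show ?thesis using Some i \<tau> inj_onD[OF inj_tip[OF t], of \<sigma> \<tau>] by (auto simp: y_def)
      qed
    qed simp
    then show ?thesis
      using f(2)[OF \<tau>(1)] moved_tip[OF t \<tau>(1)] \<tau>(2) tip_height(4)[OF t \<tau>(1)] by (simp add: divisor_of_tuple_alt)
  next
    case False
    have "{i. i < d \<and> y i = q} = {i. i < d \<and> x i = q \<and> f i = None}"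
    proof (intro Collect_cong conj_cong refl)
      fix i assume i: "i < d"
      show "(y i = q) = (x i = q \<and> f i = None)"
        using False f(1)[OF i] i by (cases "f i") (auto simp: y_def)
    qed simp
    then have "divisor_of_tuple d y q = D q - (\<Sum>\<tau> | \<tau> \<in> exits \<and> base G \<tau> = q. slope \<tau>)"
      using arg_cong[OF f(3)[of q], of int] unfolding of_nat_add s D divisor_of_tuple_alt by simp
    then show ?thesis
      using moved_zero[OF t, of q] moved_other[OF t _ False] none[of q] by (cases "\<psi> q = 0") auto
  qed
  then have "divisor_of_tuple d y = moved t" by auto
  moreover have "dist (x i) (y i) \<le> t" if "i < d" for i
    using that f(1)[OF that] dist_tip[OF t] t by (cases "f i") (auto simp: y_def small_def)
  moreover have "y \<in> topspace (power_topology d)" by (auto simp: y_def PiE_iff extensional_def)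
  ultimately show ?thesis by blast
qed

section \<open>Nondegenerate divisors\<close>

locale nondegenerate_point = graph G for G :: "('p::metric_space, 'e) mgraph" +
  fixes D :: "'p \<Rightarrow> int" and \<Sigma> :: "('p \<Rightarrow> real) set" and \<phi> :: "'p \<Rightarrow> real"
  assumes submodule: "tropical_submodule G D \<Sigma>" and nondeg: "\<phi> \<in> nondegenerate_locus G D \<Sigma>"
begin

abbreviation "D\<phi> \<equiv> plus_div G D \<phi>"

lemma \<phi>_mem: "\<phi> \<in> \<Sigma>" using nondeg by (simp add: nondegenerate_locus_def)

lemma series_PL: "\<theta> \<in> \<Sigma> \<Longrightarrow> \<theta> \<in> PL G"
  and series_effective: "\<theta> \<in> \<Sigma> \<Longrightarrow> 0 \<le> plus_div G D \<theta> p"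
  using submodule unfolding tropical_submodule_def RD_def effective_def by auto

lemma series_min: "\<theta> \<in> \<Sigma> \<Longrightarrow> \<theta>' \<in> \<Sigma> \<Longrightarrow> (\<lambda>x. min (\<theta> x) (\<theta>' x)) \<in> \<Sigma>"
  and series_shift: "\<theta> \<in> \<Sigma> \<Longrightarrow> (\<lambda>x. \<theta> x + c) \<in> \<Sigma>"
  using submodule unfolding tropical_submodule_def by simp_all

lemma maxE:
  obtains U where "openin (subtopology (Sym_topology (nat (degree D))) (linear_system G D \<Sigma>)) U" "D\<phi> \<in> U"
    "\<And>E. E \<in> U \<Longrightarrow> card (supp E) \<le> card (supp D\<phi>)"
  using nondeg unfolding nondegenerate_locus_def nondegenerate_def local_max_on_def by auto

lemma minE:
  obtains U where "openin (subtopology (Sym_topology (nat (degree D))) (linear_system G D \<Sigma>)) U" "D\<phi> \<in> U"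
    "\<And>E. E \<in> U \<Longrightarrow> (\<Sum>p | valence G p = 1. D\<phi> p) \<le> (\<Sum>p | valence G p = 1. E p)"
  using nondeg unfolding nondegenerate_locus_def nondegenerate_def local_min_on_def by auto

text \<open>That \<open>D + div \<phi>\<close> is a sum of \<open>degree D\<close> points is read
  off from nondegeneracy, which places it in an open set of \<open>Sym_topology\<close>.\<close>

lemma tuple:
  obtains x where "x \<in> topspace (power_topology (nat (degree D)))" "D\<phi> = divisor_of_tuple (nat (degree D)) x"
proof -
  obtain U where U: "openin (subtopology (Sym_topology (nat (degree D))) (linear_system G D \<Sigma>)) U" "D\<phi> \<in> U"
    using maxE by metis
  then have "D\<phi> \<in> topspace (Sym_topology (nat (degree D)))"
    using openin_subset[OF U(1)] by auto
  then show ?thesis using that unfolding topspace_Sym_topology by blast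
qed

lemma finite_supp_D\<phi>: "finite (supp D\<phi>)"
proof -
  obtain x where x: "D\<phi> = divisor_of_tuple (nat (degree D)) x" using tuple by metis
  have "supp D\<phi> \<subseteq> x ` {..<nat (degree D)}"
  proof
    fix p assume "p \<in> supp D\<phi>"
    then have "card {i. i < nat (degree D) \<and> x i = p} \<noteq> 0" unfolding supp_def x divisor_of_tuple_alt by simp
    then have "{i. i < nat (degree D) \<and> x i = p} \<noteq> {}" by (metis card.empty)
    then show "p \<in> x ` {..<nat (degree D)}" by auto
  qed
  then show ?thesis by (rule finite_subset) simp
qed

lemma plus_div_add:
  assumes "\<And>e t d p. (e, t, d) \<in> tangents G p \<Longrightarrow> has_slope G \<psi> e t d (out_slope G \<psi> (e, t, d))"
  shows "plus_div G D (\<lambda>x. \<phi> x + \<psi> x) p = D\<phi> p + div_of G \<psi> p"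
  unfolding plus_div_def using div_of_add[OF PL_has_slope[OF series_PL[OF \<phi>_mem]] assms] by simp

lemma shifted_PL:
  assumes "\<psi> \<in> shifted_series \<Sigma> \<phi>"
  shows "\<psi> \<in> PL G"
  using PL_diff[OF series_PL series_PL, of "\<lambda>x. \<phi> x + \<psi> x" \<phi>] assms \<phi>_mem by (simp add: shifted_series_def)

lemma truncationI:
  assumes \<psi>: "\<psi> \<in> shifted_series \<Sigma> \<phi>" "\<And>x. 0 \<le> \<psi> x"
  shows "truncation G D\<phi> \<psi>"
proof unfold_locales
  fix x assume "x \<notin> supp D\<phi>"
  moreover have "plus_div G D (\<lambda>x. \<phi> x + \<psi> x) x = D\<phi> x + div_of G \<psi> x"
    by (rule plus_div_add[OF PL_has_slope[OF shifted_PL[OF \<psi>(1)]]])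
  ultimately show "0 \<le> div_of G \<psi> x"
    using series_effective[of "\<lambda>x. \<phi> x + \<psi> x" x] \<psi> by (simp add: shifted_series_def supp_def)
qed (use finite_supp_D\<phi> shifted_PL[OF \<psi>(1)] \<psi>(2) in auto)

lemma trunc_mem:
  assumes \<psi>: "\<psi> \<in> shifted_series \<Sigma> \<phi>"
  shows "(\<lambda>x. \<phi> x + min (\<psi> x) t) \<in> \<Sigma>"
proof -
  have "(\<lambda>x. min (\<phi> x + \<psi> x) (\<phi> x + t)) \<in> \<Sigma>"
    using \<psi> unfolding shifted_series_def by (intro series_min series_shift \<phi>_mem) simp
  moreover have "min (\<phi> x + \<psi> x) (\<phi> x + t) = \<phi> x + min (\<psi> x) t" for x by (simp add: min_def)
  ultimately show ?thesis by simp
qed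

lemma moved_eq:
  assumes \<psi>: "\<psi> \<in> shifted_series \<Sigma> \<phi>" "\<And>x. 0 \<le> \<psi> x"
  shows "truncation.moved G D\<phi> \<psi> t = plus_div G D (\<lambda>x. \<phi> x + min (\<psi> x) t)"
proof -
  interpret truncation G D\<phi> \<psi> by (rule truncationI[OF \<psi>])
  have "has_slope G (trunc t) e u d (out_slope G (trunc t) (e, u, d))" if "(e, u, d) \<in> tangents G p" for e u d p
    using trunc_has_slope[OF that, of t] out_slope_eq by metis
  then show ?thesis unfolding moved_def using plus_div_add[of "trunc t"] by auto
qed

lemma eventually_moved_in:
  assumes \<psi>: "\<psi> \<in> shifted_series \<Sigma> \<phi>" "\<And>x. 0 \<le> \<psi> x"
    and U: "openin (subtopology (Sym_topology (nat (degree D))) (linear_system G D \<Sigma>)) U" "D\<phi> \<in> U"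
  shows "\<forall>\<^sub>F t in at_right 0. truncation.small G D\<phi> \<psi> t \<and> plus_div G D (\<lambda>x. \<phi> x + min (\<psi> x) t) \<in> U"
proof -
  interpret truncation G D\<phi> \<psi> by (rule truncationI[OF \<psi>])
  obtain W where W: "openin (Sym_topology (nat (degree D))) W" "U = W \<inter> linear_system G D \<Sigma>"
    using U(1) unfolding openin_subtopology by blast
  obtain x where x: "x \<in> topspace (power_topology (nat (degree D)))" "D\<phi> = divisor_of_tuple (nat (degree D)) x"
    by (rule tuple)
  have "divisor_of_tuple (nat (degree D)) x \<in> W" using U(2) W(2) x(2) by simp
  from Sym_open_contains_near[OF W(1) x(1) this] obtain \<delta> where \<delta>: "\<delta> > 0"
    "\<And>y. y \<in> topspace (power_topology (nat (degree D))) \<Longrightarrow> (\<forall>i<nat (degree D). dist (x i) (y i) < \<delta>) \<Longrightarrow>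
       divisor_of_tuple (nat (degree D)) y \<in> W" by blast
  have "\<forall>\<^sub>F t in at_right 0. t < \<delta>" using \<delta>(1) unfolding eventually_at_right_field by auto
  with eventually_small show ?thesis
  proof eventually_elim
    case (elim t)
    have eq: "moved t = plus_div G D (\<lambda>x. \<phi> x + min (\<psi> x) t)" by (rule moved_eq[OF \<psi>])
    have mem: "(\<lambda>x. \<phi> x + min (\<psi> x) t) \<in> \<Sigma>" by (rule trunc_mem[OF \<psi>(1)])
    then have "effective (moved t)" unfolding eq effective_def using series_effective by blast
    then obtain y where y: "y \<in> topspace (power_topology (nat (degree D)))"
      "divisor_of_tuple (nat (degree D)) y = moved t" "\<forall>i<nat (degree D). dist (x i) (y i) \<le> t"
      using moved_near[OF elim(1) x(2)] by blast
    have "moved t \<in> W" using \<delta>(2)[OF y(1)] y(2,3) elim(2) by fastforce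
    then show ?case using elim(1) mem unfolding W(2) eq linear_system_def by blast
  qed
qed

text \<open>The moved divisor has at least as many support points as \<open>D\<phi>\<close>, which
  is maximal on \<open>U\<close>, so it is maximal on \<open>U\<close> too. Likewise for leaves:
  tips have valence 2, so no leaf gains chips and the sum stays minimal on
  \<open>U'\<close>.\<close>

lemma eventually_trunc_nondegenerate:
  assumes \<psi>: "\<psi> \<in> shifted_series \<Sigma> \<phi>" "\<And>x. 0 \<le> \<psi> x"
  shows "\<forall>\<^sub>F t in at_right 0. (\<lambda>x. \<phi> x + min (\<psi> x) t) \<in> nondegenerate_locus G D \<Sigma>"
proof -
  interpret truncation G D\<phi> \<psi> by (rule truncationI[OF \<psi>])
  obtain U where U: "openin (subtopology (Sym_topology (nat (degree D))) (linear_system G D \<Sigma>)) U" "D\<phi> \<in> U"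
    "\<And>E. E \<in> U \<Longrightarrow> card (supp E) \<le> card (supp D\<phi>)" using maxE by metis
  obtain U' where U': "openin (subtopology (Sym_topology (nat (degree D))) (linear_system G D \<Sigma>)) U'" "D\<phi> \<in> U'"
    "\<And>E. E \<in> U' \<Longrightarrow> (\<Sum>p | valence G p = 1. D\<phi> p) \<le> (\<Sum>p | valence G p = 1. E p)" using minE by metis
  show ?thesis using eventually_moved_in[OF \<psi> U(1,2)] eventually_moved_in[OF \<psi> U'(1,2)]
  proof eventually_elim
    case (elim t)
    let ?\<theta> = "\<lambda>x. \<phi> x + min (\<psi> x) t"
    have t: "small t" using elim by blast
    have eq: "moved t = plus_div G D ?\<theta>" by (rule moved_eq[OF \<psi>])
    have mem: "?\<theta> \<in> \<Sigma>" by (rule trunc_mem[OF \<psi>(1)])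
    have ls: "plus_div G D ?\<theta> \<in> linear_system G D \<Sigma>" using mem by (simp add: linear_system_def)
    have 1: "card (supp D\<phi>) \<le> card (supp (plus_div G D ?\<theta>))"
      using card_supp_moved(2)[OF t series_effective[OF \<phi>_mem]] eq by simp
    have "(\<Sum>p | valence G p = 1. moved t p) \<le> (\<Sum>p | valence G p = 1. D\<phi> p)"
      using tip(4)[OF t] by (intro sum_mono moved_le[OF t]) auto
    then have 2: "(\<Sum>p | valence G p = 1. plus_div G D ?\<theta> p) \<le> (\<Sum>p | valence G p = 1. D\<phi> p)" using eq by simp
    have "local_max_on (Sym_topology (nat (degree D))) (linear_system G D \<Sigma>) (\<lambda>E. card (supp E)) (plus_div G D ?\<theta>)"
      unfolding local_max_on_def using ls U(1) elim(1) order_trans[OF U(3) 1] by blast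
    moreover have "local_min_on (Sym_topology (nat (degree D))) (linear_system G D \<Sigma>)
       (\<lambda>E. \<Sum>p | valence G p = 1. E p) (plus_div G D ?\<theta>)"
      unfolding local_min_on_def using ls U'(1) elim(2) order_trans[OF 2 U'(3)] by blast
    ultimately show ?case unfolding nondegenerate_locus_def nondegenerate_def using mem by blast
  qed
qed

text \<open>If all zeros were chips, firing would split a chip or push a chip off a leaf.\<close>

lemma zero_off_support:
  assumes \<psi>: "\<psi> \<in> shifted_series \<Sigma> \<phi>" "\<And>x. 0 \<le> \<psi> x" and p: "\<psi> p = 0"
    and tangents: "p \<in> supp D\<phi> \<Longrightarrow> tangents G p \<noteq> {}"
  shows "\<exists>x. x \<notin> supp D\<phi> \<and> \<psi> x = 0"
proof (rule ccontr)
  assume "\<nexists>x. x \<notin> supp D\<phi> \<and> \<psi> x = 0"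
  then have zs: "x \<in> supp D\<phi>" if "\<psi> x = 0" for x using that by blast
  interpret truncation G D\<phi> \<psi> by (rule truncationI[OF \<psi>])
  have base: "base G \<tau> = p" if "\<tau> \<in> tangents G p" for \<tau> using that by (auto simp: tangents_def base_def)
  have ex: "\<tau> \<in> exits" if \<tau>: "\<tau> \<in> tangents G p" for \<tau>
  proof (rule ccontr)
    assume n: "\<tau> \<notin> exits"
    obtain e u d where eq: "\<tau> = (e, u, d)" by (cases \<tau>)
    have tan: "(e, u, d) \<in> tangents G p" and up: "chart G e u = p" using \<tau> eq by (auto simp: tangents_def)
    have "slope \<tau> = 0"
      using n slope_nonneg_at_zero[OF p \<tau>] \<tau> p base[OF \<tau>] unfolding exits_def by auto
    \<comment> \<open>A direction of slope zero would carry a whole interval of zeros, all of them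
      chips, while the support is finite; so every direction at \<open>p\<close> is an exit.\<close>
    then have "\<forall>\<^sub>F h in at_right 0. \<psi> (chart G e (u + d * h)) = 0"
      using PL_has_slope[OF PL tan] p up eq unfolding has_slope_def by simp
    moreover have d: "e \<in> edges G" "d = 1 \<and> 0 \<le> u \<and> u < len G e \<or> d = -1 \<and> 0 < u \<and> u \<le> len G e"
      using tan by (auto simp: tangents_def)
    have "\<forall>\<^sub>F h in at_right (0::real). 0 < h \<and> h < (if d = 1 then len G e - u else u)"
      unfolding eventually_at_right_field using d by (intro exI[of _ "if d = 1 then len G e - u else u"]) auto
    ultimately have "\<forall>\<^sub>F h in at_right 0. chart G e (u + d * h) \<in> supp D\<phi> \<and> 0 < u + d * h \<and> u + d * h < len G e"
      by eventually_elim (use d zs in auto)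
    then obtain b where b: "b > 0" "\<And>h. 0 < h \<Longrightarrow> h < b \<Longrightarrow> chart G e (u + d * h) \<in> supp D\<phi> \<and> 0 < u + d * h \<and> u + d * h < len G e"
      unfolding eventually_at_right_field by blast
    have "inj_on (\<lambda>h. chart G e (u + d * h)) {0<..<b}"
    proof (rule inj_onI)
      fix h k assume "h \<in> {0<..<b}" "k \<in> {0<..<b}" "chart G e (u + d * h) = chart G e (u + d * k)"
      then have "u + d * k = u + d * h"
        using chart_eqD[OF d(1), of "u + d * h" e "u + d * k"] b(2)[of h] b(2)[of k] d(1) by auto
      then show "h = k" using d(2) by auto
    qed
    moreover have "(\<lambda>h. chart G e (u + d * h)) ` {0<..<b} \<subseteq> supp D\<phi>" using b(2) by auto
    ultimately have "finite {0<..<b}" using finite_supp inj_on_finite by blast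
    then show False using b(1) infinite_Ioo by blast
  qed
  obtain U where U: "openin (subtopology (Sym_topology (nat (degree D))) (linear_system G D \<Sigma>)) U" "D\<phi> \<in> U"
    "\<And>E. E \<in> U \<Longrightarrow> card (supp E) \<le> card (supp D\<phi>)" using maxE by metis
  obtain U' where U': "openin (subtopology (Sym_topology (nat (degree D))) (linear_system G D \<Sigma>)) U'" "D\<phi> \<in> U'"
    "\<And>E. E \<in> U' \<Longrightarrow> (\<Sum>p | valence G p = 1. D\<phi> p) \<le> (\<Sum>p | valence G p = 1. E p)" using minE by metis
  have "\<exists>t. (small t \<and> plus_div G D (\<lambda>x. \<phi> x + min (\<psi> x) t) \<in> U) \<and>
      (small t \<and> plus_div G D (\<lambda>x. \<phi> x + min (\<psi> x) t) \<in> U')"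
    using eventually_conj[OF eventually_moved_in[OF \<psi> U(1,2)] eventually_moved_in[OF \<psi> U'(1,2)]]
    by (rule eventually_happens'[rotated]) simp
  then obtain t where t: "small t" and inU: "moved t \<in> U" and inU': "moved t \<in> U'"
    unfolding moved_eq[OF \<psi>] by blast
  obtain \<tau> where \<tau>: "\<tau> \<in> tangents G p" using tangents[OF zs[OF p]] by blast
  \<comment> \<open>With one direction, \<open>p\<close> is a leaf that loses chips while no leaf
    gains any, against the local minimum. With two, two exits share the base \<open>p\<close>,
    against the local maximum.\<close>
  show False
  proof (cases "tangents G p = {\<tau>}")
    case True
    then have v: "valence G p = 1" by (simp add: valence_def)
    have "\<sigma> = \<tau>" if "\<sigma> \<in> exits" "base G \<sigma> = p" for \<sigma>
    proof -
      have "\<sigma> \<in> tangents G p" using that unfolding exits_def by simp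
      then show ?thesis unfolding True by simp
    qed
    then have "{\<sigma>. \<sigma> \<in> exits \<and> base G \<sigma> = p} = {\<tau>}" using ex[OF \<tau>] base[OF \<tau>] by blast
    then have "moved t p < D\<phi> p" using moved_zero[OF t p] tip_height(4)[OF t ex[OF \<tau>]] by simp
    moreover have "moved t q \<le> D\<phi> q" if "valence G q = 1" for q
      using that tip(4)[OF t] by (intro moved_le[OF t]) auto
    ultimately have "(\<Sum>p | valence G p = 1. moved t p) < (\<Sum>p | valence G p = 1. D\<phi> p)"
      using v finite_valence_1 by (intro sum_strict_mono_ex1) auto
    then show False using U'(3)[OF inU'] by simp
  next
    case False
    then obtain \<sigma> where \<sigma>: "\<sigma> \<in> tangents G p" "\<sigma> \<noteq> \<tau>" using \<tau> by blast
    then have "\<not> inj_on (base G) exits" using ex \<tau> base[OF \<tau>] base[OF \<sigma>(1)] by (metis inj_onD)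
    then show False using card_supp_moved(3)[OF t series_effective[OF \<phi>_mem]] U(3)[OF inU] by simp
  qed
qed

lemma component_zero_iff:
  assumes \<psi>: "\<psi> \<in> shifted_series \<Sigma> \<phi>" "\<And>x. 0 \<le> \<psi> x"
    and S: "S \<in> components (- supp D\<phi>)" "x \<in> S" "y \<in> S"
  shows "\<psi> x = 0 \<longleftrightarrow> \<psi> y = 0"
proof -
  interpret truncation G D\<phi> \<psi> by (rule truncationI[OF \<psi>])
  show ?thesis using zero_set_component[OF S(1)] S(2,3) by blast
qed

end

section \<open>The local matroid\<close>

lemma (in graph) series_bounded:
  assumes "tropical_submodule G D \<Sigma>" "\<theta> \<in> \<Sigma>"
  shows "\<theta> \<in> PL G" "continuous_on UNIV \<theta>" "bounded (range \<theta>)"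
proof -
  show "\<theta> \<in> PL G" using assms unfolding tropical_submodule_def RD_def by blast
  then show "continuous_on UNIV \<theta>" unfolding PL_def by simp
  then show "bounded (range \<theta>)" by (rule continuous_bounded)
qed

locale matroidal_point = nondegenerate_point G D \<Sigma> \<phi> + parametrized V \<pi> \<Sigma>
  for G :: "('p::metric_space, 'e) mgraph" and D \<Sigma> \<phi>
    and V :: "('n::finite \<Rightarrow> ereal) set" and \<pi> :: "('n \<Rightarrow> ereal) \<Rightarrow> 'p \<Rightarrow> ereal" +
  fixes r :: int
  assumes BN: "is_r_BN G D \<Sigma> r" and ind: "is_r_ind \<Sigma> (r + 1)" and rank: "int (vm_rank V) = r + 1"
begin

abbreviation "n \<equiv> nat (r + 1)"
abbreviation "w \<equiv> least_section \<phi>"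
abbreviation "F \<equiv> live_coords V - kernel_coords"
abbreviation "M \<equiv> initial_on V w F"
abbreviation "E \<equiv> components (- supp D\<phi>)"

definition point_of :: "'p set \<Rightarrow> 'p" where
  "point_of S = (SOME x. x \<in> S)"

definition J :: "'p set \<Rightarrow> 'n set" where
  "J S = support_coords w (point_of S)"

lemma point_of: "S \<in> E \<Longrightarrow> point_of S \<in> S" "S \<in> E \<Longrightarrow> point_of S \<notin> supp D\<phi>"
proof -
  assume S: "S \<in> E"
  then show "point_of S \<in> S"
    unfolding point_of_def using in_components_nonempty by (metis someI_ex ex_in_conv)
  then show "point_of S \<notin> supp D\<phi>" using in_components_subset[OF S] by blast
qed

lemma section_hom: "\<pi> w = embed \<phi>"
  by (rule hom_least_section[OF \<phi>_mem])

lemma section_least: "v \<in> V \<Longrightarrow> embed \<phi> \<le> \<pi> v \<Longrightarrow> i \<in> F \<Longrightarrow> w i \<le> v i"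
  using least_section_le[OF bounded[OF \<phi>_mem]] by simp

sublocale initial V w F
  by unfold_locales (use least_section_mem least_section_finite in auto)

section \<open>Dictionary between flats and functions\<close>

lemma J_subset_iff:
  assumes u: "u \<in> V" "\<And>i. i \<in> F \<Longrightarrow> w i \<le> u i"
  shows "J S \<subseteq> {i \<in> F. w i < u i} \<longleftrightarrow> ereal (\<phi> (point_of S)) < \<pi> u (point_of S)"
proof -
  have "J S \<subseteq> F" unfolding J_def support_coords_def by blast
  then have "J S \<subseteq> {i \<in> F. w i < u i} \<longleftrightarrow> (\<forall>i\<in>J S. w i < u i)" by blast
  also have "\<dots> \<longleftrightarrow> \<pi> w (point_of S) < \<pi> u (point_of S)" unfolding J_def
    by (rule support_coords_greater[OF least_section_mem _ u(1) u(2) w_finite, symmetric])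
       (simp_all add: section_hom embed_def)
  finally show ?thesis by (simp add: section_hom embed_def)
qed

lemma J_ground: "S \<in> E \<Longrightarrow> J S \<subseteq> F" "J S \<noteq> {}"
proof -
  show "J S \<subseteq> F" unfolding J_def support_coords_def by blast
  show "J S \<noteq> {}" unfolding J_def
    by (rule support_coords_nonempty[OF least_section_mem _ w_finite]) (simp_all add: section_hom embed_def)
qed

text \<open>The least preimage of \<open>\<phi> + \<psi>\<close> lies above \<open>w\<close> on
  \<open>F\<close> and so cuts out a flat, which contains \<open>J S\<close> exactly where
  evaluation at the chosen point increases.\<close>

lemma flat_of_function:
  assumes \<psi>: "\<psi> \<in> shifted_series \<Sigma> \<phi>" "\<And>x. 0 \<le> \<psi> x"
  shows "\<exists>H\<in>flats M. \<forall>S. J S \<subseteq> H \<longleftrightarrow> \<psi> (point_of S) \<noteq> 0"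
proof -
  have mem: "(\<lambda>x. \<phi> x + \<psi> x) \<in> \<Sigma>" using \<psi>(1) by (simp add: shifted_series_def)
  let ?u = "least_section (\<lambda>x. \<phi> x + \<psi> x)"
  have h: "\<pi> ?u = embed (\<lambda>x. \<phi> x + \<psi> x)" by (rule hom_least_section[OF mem])
  have "embed \<phi> \<le> \<pi> ?u" unfolding h using \<psi>(2) by (simp add: embed_def le_fun_def)
  then have le: "w i \<le> ?u i" if "i \<in> F" for i
    using section_least[OF least_section_mem _ that] by blast
  have "J S \<subseteq> {i \<in> F. w i < ?u i} \<longleftrightarrow> \<psi> (point_of S) \<noteq> 0" for S
    using J_subset_iff[OF least_section_mem le, of S] \<psi>(2)[of "point_of S"] unfolding h
    by (auto simp: embed_def)
  then show ?thesis using flatI[OF least_section_mem le] by blast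
qed

lemma function_of_flat:
  assumes H: "H \<in> flats M" and F: "F \<noteq> {}"
  shows "\<exists>\<psi>\<in>shifted_series \<Sigma> \<phi>. (\<forall>x. 0 \<le> \<psi> x) \<and> (\<forall>S. J S \<subseteq> H \<longleftrightarrow> \<psi> (point_of S) \<noteq> 0)"
proof -
  obtain u where u: "u \<in> V" "\<And>i. i \<in> F \<Longrightarrow> w i \<le> u i" "\<And>i. i \<in> F \<Longrightarrow> u i \<noteq> \<infinity>"
    "H = {i \<in> F. w i < u i}" by (rule flatE[OF H]) (rule that)
  have le: "\<pi> w \<le> \<pi> u"
  proof (rule hom_mono_off_kernel[OF least_section_mem u(1)])
    fix i assume i: "i \<notin> kernel_coords"
    show "w i \<le> u i"
    proof (cases "i \<in> live_coords V")
      case False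
      then have "u i = \<infinity>" using u(1) unfolding live_coords_def by blast
      then show ?thesis by simp
    qed (use i u(2) in simp)
  qed
  obtain i where i: "i \<in> F" using F by blast
  \<comment> \<open>A finite entry of \<open>u\<close> off the kernel keeps \<open>u\<close> from
    being a kernel vector; this uses a coordinate in \<open>F\<close>.\<close>
  have "\<pi> u \<noteq> (\<lambda>_. \<infinity>)" using i u(1) u(3)[OF i] unfolding kernel_coords_def by blast
  then obtain \<theta> where \<theta>: "\<theta> \<in> \<Sigma>" "\<pi> u = embed \<theta>" using hom_cases[OF u(1)] by metis
  have ge: "\<phi> x \<le> \<theta> x" for x using le unfolding section_hom \<theta>(2) by (simp add: embed_def le_fun_def)
  show ?thesis
  proof (intro bexI[of _ "\<lambda>x. \<theta> x - \<phi> x"] conjI allI)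
    show "(\<lambda>x. \<theta> x - \<phi> x) \<in> shifted_series \<Sigma> \<phi>" using \<theta>(1) by (simp add: shifted_series_def)
    show "0 \<le> \<theta> x - \<phi> x" for x using ge[of x] by simp
    show "J S \<subseteq> H \<longleftrightarrow> \<theta> (point_of S) - \<phi> (point_of S) \<noteq> 0" for S
      using J_subset_iff[OF u(1,2), of S] ge[of "point_of S"] unfolding \<theta>(2) u(4)
      by (auto simp: embed_def)
  qed
qed

text \<open>A point without tangent directions is the whole graph. With a chip on it the
  Baker-Norine rank is at least \<open>D p\<close>, hence at least 1, so some independent set has
  two functions; but on a single point any two functions agree after shifts.\<close>

lemma supp_tangents:
  assumes p: "p \<in> supp D\<phi>"
  shows "tangents G p \<noteq> {}"
proof
  assume t: "tangents G p = {}"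
  have U: "x = p" for x using single_point[OF t] by blast
  have dv: "div_of G \<theta> p = 0" for \<theta> unfolding div_of_def t by simp
  have "D p > 0" using p series_effective[OF \<phi>_mem, of p] dv[of \<phi>] by (simp add: supp_def plus_div_def)
  have "bn_property G D \<Sigma> (D p)"
    unfolding bn_property_def
  proof (intro allI impI)
    fix D' :: "'p \<Rightarrow> int" assume D': "divisor D' \<and> effective D' \<and> degree D' = D p"
    have "supp D' \<subseteq> {p}" using U by blast
    then have "degree D' = (\<Sum>x\<in>{p}. D' x)"
      unfolding degree_def by (intro sum.mono_neutral_left) (auto simp: supp_def)
    then have "degree D' = D' p" by simp
    then have "D x - D' x + div_of G \<phi> x = 0" for x using D' dv U[of x] by simp
    then show "\<exists>\<phi>\<in>\<Sigma>. effective (\<lambda>p. D p - D' p + div_of G \<phi> p)"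
      using \<phi>_mem unfolding effective_def by (intro bexI[of _ \<phi>]) auto
  qed
  then have r: "1 \<le> r" using BN \<open>D p > 0\<close> unfolding is_r_BN_def by force
  obtain T where T: "T \<subseteq> \<Sigma>" "finite T" "\<not> tropically_dependent T" "int (card T) = r + 1"
    using ind unfolding is_r_ind_def by blast
  have "\<not> card T \<le> Suc 0" using T(4) r by simp
  then obtain f g where fg: "f \<in> T" "g \<in> T" "f \<noteq> g" using card_le_Suc0_iff_eq[OF T(2)] by blast
  have "tropically_dependent T"
    unfolding tropically_dependent_def
  proof (intro exI[of _ "\<lambda>f. - f p"] allI)
    fix x
    have "f x + - f p = g x + - g p \<and> (\<forall>\<theta>\<in>T. f x + - f p \<le> \<theta> x + - \<theta> p)" using U[of x] by simp
    then show "\<exists>\<phi>\<in>T. \<exists>\<psi>\<in>T. \<phi> \<noteq> \<psi> \<and> \<phi> x + - \<phi> p = \<psi> x + - \<psi> p \<and> (\<forall>\<theta>\<in>T. \<phi> x + - \<phi> p \<le> \<theta> x + - \<theta> p)"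
      using fg by blast
  qed
  then show False using T(3) by simp
qed

lemma component_of_point:
  assumes "x \<notin> supp D\<phi>"
  obtains S where "S \<in> E" "x \<in> S"
proof -
  have "x \<in> \<Union>E" using assms by (simp add: Union_components)
  then show ?thesis using that by blast
qed

lemma zero_component:
  assumes \<psi>: "\<psi> \<in> shifted_series \<Sigma> \<phi>" "\<And>x. 0 \<le> \<psi> x" "\<psi> y = 0"
  shows "\<exists>S\<in>E. \<psi> (point_of S) = 0"
proof -
  obtain x where x: "x \<notin> supp D\<phi>" "\<psi> x = 0" using zero_off_support[OF \<psi> supp_tangents] by blast
  obtain S where S: "S \<in> E" "x \<in> S" using component_of_point[OF x(1)] by metis
  then show ?thesis using component_zero_iff[OF \<psi>(1,2) S(1,2) point_of(1)[OF S(1)]] x(2) by blast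
qed

lemma zero_mem_shifted: "(\<lambda>_. 0) \<in> shifted_series \<Sigma> \<phi>"
  using \<phi>_mem by (simp add: shifted_series_def)

lemma E_nonempty: "E \<noteq> {}"
  using zero_component[OF zero_mem_shifted] by auto

lemma shift_shifted: "\<psi> \<in> shifted_series \<Sigma> \<phi> \<Longrightarrow> (\<lambda>x. \<psi> x - c) \<in> shifted_series \<Sigma> \<phi>"
  using series_shift[of "\<lambda>x. \<phi> x + \<psi> x" "- c"] by (simp add: shifted_series_def add_diff_eq)

lemma normalize:
  assumes \<psi>: "\<psi> \<in> shifted_series \<Sigma> \<phi>"
  shows "\<exists>y. (\<lambda>x. \<psi> x - \<psi> y) \<in> shifted_series \<Sigma> \<phi> \<and> (\<forall>x. 0 \<le> \<psi> x - \<psi> y)"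
proof -
  have "continuous_on UNIV \<psi>" using shifted_PL[OF \<psi>] unfolding PL_def by simp
  then obtain y where "\<forall>x\<in>UNIV. \<psi> y \<le> \<psi> x"
    using continuous_attains_inf[OF compact_graph, of \<psi>] by auto
  then show ?thesis using shift_shifted[OF \<psi>] by (intro exI[of _ y]) simp
qed

text \<open>Demand a chip at the chosen point of each \<open>S\<close> in \<open>\<S>\<close>. If
  the normalized difference \<open>\<psi>\<close> vanished at such a point, it would be a minimum,
  so \<open>div \<psi>\<close> would be at most 0 there, and as \<open>D\<phi>\<close> has no chip
  there the demand would fail. A zero of \<open>\<psi>\<close> forces one on some other component,
  whose \<open>J S\<close> leaves the flat.\<close>

lemma bn_flat:
  assumes \<S>: "\<S> \<subseteq> E" "finite \<S>" "card \<S> < n"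
  shows "\<exists>H\<in>flats M. (\<forall>S\<in>\<S>. J S \<subseteq> H) \<and> (\<exists>S\<in>E. \<not> J S \<subseteq> H)"
proof -
  obtain S0 where S0: "S0 \<in> E" using E_nonempty by blast
  let ?P = "point_of ` \<S>" and ?x0 = "point_of S0"
  \<comment> \<open>The Baker-Norine condition is about degree exactly \<open>r\<close>, so the
    chips left over are placed at \<open>?x0\<close>.\<close>
  define D0 :: "'p \<Rightarrow> int" where
    "D0 p = (if p \<in> ?P then 1 else 0) + (if p = ?x0 then r - int (card ?P) else 0)" for p
  have fP: "finite ?P" using \<S>(2) by simp
  have cP: "int (card ?P) \<le> r" using card_image_le[OF \<S>(2), of point_of] \<S>(3) by linarith
  have sub: "supp D0 \<subseteq> insert ?x0 ?P" unfolding supp_def D0_def by auto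
  have "divisor D0" unfolding divisor_def using sub fP finite_subset by blast
  moreover have "effective D0" unfolding effective_def D0_def using cP by simp
  moreover have "degree D0 = r"
  proof -
    have "degree D0 = sum D0 (insert ?x0 ?P)" unfolding degree_def
      using sub fP by (intro sum.mono_neutral_left) (auto simp: supp_def)
    also have "\<dots> = (\<Sum>p\<in>insert ?x0 ?P. if p \<in> ?P then 1 else 0) + (\<Sum>p\<in>insert ?x0 ?P. if p = ?x0 then r - int (card ?P) else 0)"
      unfolding D0_def by (rule sum.distrib)
    also have "(\<Sum>p\<in>insert ?x0 ?P. if p \<in> ?P then 1 else 0 :: int) = int (card ?P)"
    proof -
      have "(\<Sum>p\<in>insert ?x0 ?P. if p \<in> ?P then 1 else 0 :: int) = (\<Sum>p\<in>?P. 1)"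
        using fP by (intro sum.mono_neutral_cong_right) auto
      then show ?thesis by simp
    qed
    also have "(\<Sum>p\<in>insert ?x0 ?P. if p = ?x0 then r - int (card ?P) else 0) = r - int (card ?P)"
      using fP by (simp add: sum.delta)
    finally show ?thesis by simp
  qed
  ultimately obtain \<theta> where \<theta>: "\<theta> \<in> \<Sigma>" "effective (\<lambda>p. D p - D0 p + div_of G \<theta> p)"
    using BN unfolding is_r_BN_def bn_property_def by blast
  have "(\<lambda>x. \<theta> x - \<phi> x) \<in> shifted_series \<Sigma> \<phi>" using \<theta>(1) by (simp add: shifted_series_def)
  from normalize[OF this] obtain y where y: "(\<lambda>x. \<theta> x - \<phi> x - (\<theta> y - \<phi> y)) \<in> shifted_series \<Sigma> \<phi>"
    "\<forall>x. 0 \<le> \<theta> x - \<phi> x - (\<theta> y - \<phi> y)" by (elim exE conjE)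
  define c where "c = \<theta> y - \<phi> y"
  have \<psi>: "(\<lambda>x. \<theta> x - \<phi> x - c) \<in> shifted_series \<Sigma> \<phi>" "\<And>x. 0 \<le> \<theta> x - \<phi> x - c" "\<theta> y - \<phi> y - c = 0"
    using y unfolding c_def by simp_all
  define \<psi> where "\<psi> = (\<lambda>x. \<theta> x - \<phi> x - c)"
  have PL\<psi>: "\<psi> \<in> PL G" using shifted_PL[OF \<psi>(1)] unfolding \<psi>_def .
  have pos: "\<psi> (point_of S) \<noteq> 0" if S: "S \<in> \<S>" for S
  proof
    let ?p = "point_of S"
    assume z: "\<psi> ?p = 0"
    have "div_of G \<psi> ?p \<le> 0" using z \<psi>(2) unfolding \<psi>_def by (intro div_of_minimum[OF PL\<psi>[unfolded \<psi>_def]]) simp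
    moreover have "plus_div G D (\<lambda>x. \<phi> x + \<psi> x) ?p = D\<phi> ?p + div_of G \<psi> ?p"
      by (rule plus_div_add[OF PL_has_slope[OF PL\<psi>]])
    moreover have "D\<phi> ?p = 0" using point_of(2)[of S] S \<S>(1) by (auto simp: supp_def)
    moreover have "div_of G (\<lambda>x. \<phi> x + \<psi> x) ?p = div_of G \<theta> ?p"
    proof -
      have "has_slope G \<theta> e t d (out_slope G \<theta> (e, t, d))" if "(e, t, d) \<in> tangents G ?p" for e t d
        by (rule PL_has_slope[OF series_PL[OF \<theta>(1)] that])
      moreover have sc: "has_slope G (\<lambda>_. - c) e t d 0" for e t d by (simp add: has_slope_def)
      have s0: "out_slope G (\<lambda>_. - c) (e, t, d) = 0" for e t d by (rule out_slope_eq[OF sc])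
      ultimately have "div_of G (\<lambda>x. \<theta> x + - c) ?p = div_of G \<theta> ?p + div_of G (\<lambda>_. - c) ?p"
        using sc by (intro div_of_add) (simp_all only: s0)
      moreover have "div_of G (\<lambda>_. - c) ?p = 0"
        unfolding div_of_def using s0 by (intro sum.neutral) auto
      ultimately show ?thesis unfolding \<psi>_def by simp
    qed
    moreover have "1 \<le> D0 ?p" using S cP unfolding D0_def by simp
    moreover have "0 \<le> D ?p - D0 ?p + div_of G \<theta> ?p" using \<theta>(2) by (simp add: effective_def)
    ultimately show False by (simp add: plus_div_def)
  qed
  obtain H where H: "H \<in> flats M" "\<forall>S. J S \<subseteq> H \<longleftrightarrow> \<psi> (point_of S) \<noteq> 0"
    using flat_of_function[of \<psi>] \<psi>(1,2) unfolding \<psi>_def by blast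
  have "\<psi> y = 0" using \<psi>(3) unfolding \<psi>_def .
  then have "\<exists>S\<in>E. \<psi> (point_of S) = 0" using zero_component[of \<psi> y] \<psi>(1,2) unfolding \<psi>_def by blast
  then show ?thesis using H pos by (intro bexI[of _ H]) simp_all
qed

sublocale indexed_matroid M E J n
proof
  fix I assume "mindep M I"
  then show "card I \<le> n"
    using mindep_card_le_vm_rank[OF mindep_underlying] rank by (metis nat_int)
next
  fix \<S> assume "\<S> \<subseteq> E" "finite \<S>" "card \<S> < n"
  then show "\<exists>H\<in>flats M. (\<forall>S\<in>\<S>. J S \<subseteq> H) \<and> (\<exists>S\<in>E. \<not> J S \<subseteq> H)" by (rule bn_flat)
qed (use J_ground in auto)

lemma F_nonempty: "F \<noteq> {}"
  using E_nonempty J_ground by blast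

text \<open>A kernel coordinate would extend a basis of \<open>M\<close> to an independent set of size \<open>r + 2\<close>.\<close>

lemma kernel_empty: "kernel_coords = {}"
proof (rule ccontr)
  assume "kernel_coords \<noteq> {}"
  then obtain k where k: "k \<in> kernel_coords" by blast
  obtain B where B: "mbasis M B" "card B = n" using rep_basis by metis
  have indB: "mindep M B" using B(1) by (simp add: mbasis_def)
  then have BF: "B \<subseteq> F" by (simp add: mindep_def)
  then have kB: "k \<notin> B" using k by blast
  obtain a where a: "a \<in> V" "\<pi> a = (\<lambda>_. \<infinity>)" "\<forall>i. a i \<noteq> \<infinity> \<longleftrightarrow> i \<in> kernel_coords" using absorber by metis
  have aB: "a i = \<infinity>" if "i \<in> B" for i using a(3) that BF by blast
  have "mindep (underlying_matroid V) (insert k B)"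
    unfolding mindep_def
  proof (intro conjI ballI)
    show "insert k B \<subseteq> ground (underlying_matroid V)" by (simp add: underlying_matroid_def)
    fix x assume x: "x \<in> insert k B"
    have "\<exists>u\<in>V. u x \<noteq> \<infinity> \<and> (\<forall>j\<in>insert k B - {x}. u j = \<infinity>)"
    proof (cases "x = k")
      case True
      then show ?thesis using a k aB by (intro bexI[of _ a]) auto
    next
      case False
      then have xB: "x \<in> B" using x by simp
      then have "x \<notin> mclosure (underlying_matroid V) (B - {x})"
        using mindep_underlying[OF indB] by (simp add: mindep_def)
      then obtain u where u: "u \<in> V" "u x \<noteq> \<infinity>" "\<And>j. j \<in> B - {x} \<Longrightarrow> u j = \<infinity>"
        by (auto simp: mclosure_underlying)
      show ?thesis
      proof (cases "u k = \<infinity>")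
        case True
        then show ?thesis using u by (intro bexI[of _ u]) auto
      next
        case False
        obtain s where s: "u k = ereal s" using value_cases[OF u(1) False] by blast
        have "a k \<noteq> \<infinity>" using a(3) k by blast
        then obtain t where t: "a k = ereal t" using value_cases[OF a(1)] by metis
        \<comment> \<open>The shifted absorber is infinite on \<open>B\<close>, so eliminating
          \<open>k\<close> with it leaves the finite entry at \<open>x\<close> and the infinite ones
          on the rest of \<open>B\<close> as they are.\<close>
        let ?a = "\<lambda>i. a i + ereal (s - t)"
        have "u k = ?a k" using s t by simp
        from elim[OF u(1) shift_mem[OF a(1)] this] obtain v where v: "v \<in> V" "v k = \<infinity>"
          "\<And>j. j \<noteq> k \<Longrightarrow> min (u j) (?a j) \<le> v j" "\<And>j. j \<noteq> k \<Longrightarrow> u j \<noteq> ?a j \<Longrightarrow> v j = min (u j) (?a j)"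
          by metis
        have "v x = u x" using v(4)[OF \<open>x \<noteq> k\<close>] aB[OF xB] u(2) by simp
        moreover have "v j = \<infinity>" if "j \<in> B - {x}" for j
          using v(3)[of j] u(3)[OF that] aB[of j] that kB by auto
        ultimately show ?thesis using v(1,2) u(2) by (intro bexI[of _ v]) auto
      qed
    qed
    then show "x \<notin> mclosure (underlying_matroid V) (insert k B - {x})" by (simp add: mclosure_underlying)
  qed
  from mindep_card_le_vm_rank[OF this] show False using kB B(2) rank finite[of B] by simp
qed

lemma initial_matroid_section: "initial_matroid V w = M"
  by (simp add: initial_matroid_eq kernel_empty)

lemma section_finite: "i \<in> live_coords V \<Longrightarrow> w i \<noteq> \<infinity>"
  using least_section_finite kernel_empty by simp

lemma flats_local_matroid:
  "flats (local_matroid D\<phi> (shifted_series \<Sigma> \<phi>)) = {{S \<in> E. J S \<subseteq> H} | H. H \<in> flats M}"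
proof -
  have flat: "{S \<in> E. \<not> S \<subseteq> min_set \<psi>} = {S \<in> E. \<psi> (point_of S) \<noteq> \<psi> y}"
    if \<psi>: "(\<lambda>x. \<psi> x - \<psi> y) \<in> shifted_series \<Sigma> \<phi>" "\<And>x. 0 \<le> \<psi> x - \<psi> y" for \<psi> y
  proof -
    have m: "min_set \<psi> = {x. \<psi> x = \<psi> y}"
    proof -
      have "x \<in> min_set \<psi> \<longleftrightarrow> \<psi> x = \<psi> y" for x
        unfolding min_set_def mem_Collect_eq using \<psi>(2) by (metis diff_ge_0_iff_ge order_antisym)
      then show ?thesis by blast
    qed
    have c: "S \<subseteq> min_set \<psi> \<longleftrightarrow> \<psi> (point_of S) = \<psi> y" if S: "S \<in> E" for S
    proof -
      have "\<psi> x = \<psi> y \<longleftrightarrow> \<psi> (point_of S) = \<psi> y" if "x \<in> S" for x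
        using component_zero_iff[OF \<psi> S that point_of(1)[OF S]] by simp
      then show ?thesis unfolding m subset_iff mem_Collect_eq using point_of(1)[OF S] by metis
    qed
    show ?thesis by (intro Collect_cong conj_cong arg_cong[where f = Not] c) simp_all
  qed
  have 1: "\<exists>H\<in>flats M. X = {S \<in> E. J S \<subseteq> H}" if X: "X \<in> flats (local_matroid D\<phi> (shifted_series \<Sigma> \<phi>))" for X
  proof (cases "X = E")
    case True
    \<comment> \<open>The flat \<open>E\<close> of the local matroid comes from
      \<open>w + 1\<close>, which exceeds \<open>w\<close> on all of \<open>F\<close>.\<close>
    have "F \<in> flats M"
    proof -
      have "{i \<in> F. w i < w i + ereal 1} \<in> flats M"
        by (rule flatI[OF shift_mem[OF least_section_mem]]) (simp add: ereal_le_add_self)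
      moreover have "w i < w i + ereal 1" if "i \<in> F" for i
        using value_cases[OF least_section_mem w_finite[OF that]] by fastforce
      then have "{i \<in> F. w i < w i + ereal 1} = F" by blast
      ultimately show ?thesis by simp
    qed
    then show ?thesis using True J_ground(1) by (intro bexI[of _ F]) auto
  next
    case False
    then obtain \<psi> where \<psi>: "\<psi> \<in> shifted_series \<Sigma> \<phi>" "X = {S \<in> E. \<not> S \<subseteq> min_set \<psi>}"
      using X unfolding local_matroid_def by auto
    obtain y where y: "(\<lambda>x. \<psi> x - \<psi> y) \<in> shifted_series \<Sigma> \<phi>" "\<And>x. 0 \<le> \<psi> x - \<psi> y"
      using normalize[OF \<psi>(1)] by blast
    obtain H where H: "H \<in> flats M" "\<forall>S. J S \<subseteq> H \<longleftrightarrow> \<psi> (point_of S) - \<psi> y \<noteq> 0"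
      using flat_of_function[OF y] by blast
    then show ?thesis unfolding \<psi>(2) flat[OF y] by (intro bexI[of _ H]) auto
  qed
  have 2: "{S \<in> E. J S \<subseteq> H} \<in> flats (local_matroid D\<phi> (shifted_series \<Sigma> \<phi>))" if H: "H \<in> flats M" for H
  proof -
    obtain \<psi> where \<psi>: "\<psi> \<in> shifted_series \<Sigma> \<phi>" "\<And>x. 0 \<le> \<psi> x" "\<And>S. J S \<subseteq> H \<longleftrightarrow> \<psi> (point_of S) \<noteq> 0"
      using function_of_flat[OF H F_nonempty] by blast
    show ?thesis
    proof (cases "\<exists>y. \<psi> y = 0")
      case True
      then obtain y where y: "\<psi> y = 0" by blast
      then have "{S \<in> E. \<not> S \<subseteq> min_set \<psi>} = {S \<in> E. \<psi> (point_of S) \<noteq> 0}"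
        using flat[of \<psi> y] \<psi>(1,2) by simp
      then have "{S \<in> E. J S \<subseteq> H} = {S \<in> E. \<not> S \<subseteq> min_set \<psi>}" using \<psi>(3) by simp
      then show ?thesis using \<psi>(1) unfolding local_matroid_def by auto
    next
      case False
      \<comment> \<open>A function without zeros yields all of \<open>E\<close>, which is a flat of
        the local matroid by definition.\<close>
      then have "{S \<in> E. J S \<subseteq> H} = E" using \<psi>(3) by auto
      then show ?thesis unfolding local_matroid_def by simp
    qed
  qed
  show ?thesis using 1 2 by blast
qed

lemma local_matroid_submatroid:
  "\<exists>N. submatroid N (initial_matroid V w) \<and>
     matroid_iso (simplification (local_matroid D\<phi> (shifted_series \<Sigma> \<phi>))) N"
  unfolding initial_matroid_section
  by (rule simplification_iso[OF _ flats_local_matroid]) (simp add: local_matroid_def)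

section \<open>Uniqueness of the section\<close>

lemma series_bcontfun: "\<theta> \<in> \<Sigma> \<Longrightarrow> apply_bcontfun (Bcontfun \<theta>) = \<theta>"
  using series_bounded[OF submodule] by (intro Bcontfun_inverse) (simp add: bcontfun_def)

text \<open>The flat cut out by the value of \<open>\<tau>\<close> need not be \<open>H\<close>, but
  both contain the same representatives, because \<open>min \<psi> t\<close> and
  \<open>\<psi>\<close> have the same zeros and representatives only see the sets
  \<open>J S\<close>. With \<open>j\<close> in that flat, closure would put \<open>b\<close> into
  it, although \<open>b \<notin> H\<close>. So coordinate \<open>j\<close> has not moved from
  \<open>w j\<close>.\<close>

lemma section_eq_along_truncation:
  assumes \<tau>: "continuous_section V \<pi> (nondegenerate_locus G D \<Sigma>) \<tau>"
    and \<psi>: "\<psi> \<in> shifted_series \<Sigma> \<phi>" "\<And>x. 0 \<le> \<psi> x" and H: "\<And>S. J S \<subseteq> H \<longleftrightarrow> \<psi> (point_of S) \<noteq> 0"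
    and HM: "H \<in> flats M" and B: "B \<subseteq> rep ` E" "b \<in> B" "B - {b} \<subseteq> H" "b \<notin> H"
    and j: "b \<in> mclosure M (insert j (B - {b}))" "j \<in> F"
    and t: "0 < t" "(\<lambda>x. \<phi> x + min (\<psi> x) t) \<in> nondegenerate_locus G D \<Sigma>"
  shows "\<tau> (\<lambda>x. \<phi> x + min (\<psi> x) t) j = w j"
proof -
  let ?\<theta> = "\<lambda>x. \<phi> x + min (\<psi> x) t"
  have u: "\<tau> ?\<theta> \<in> V" "\<pi> (\<tau> ?\<theta>) = embed ?\<theta>" using \<tau> t(2) unfolding continuous_section_def by auto
  have "embed \<phi> \<le> \<pi> (\<tau> ?\<theta>)" unfolding u(2) using \<psi>(2) t(1) by (simp add: embed_def le_fun_def)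
  then have le: "w i \<le> \<tau> ?\<theta> i" if "i \<in> F" for i using section_least[OF u(1) _ that] by blast
  let ?H = "{i \<in> F. w i < \<tau> ?\<theta> i}"
  have fl: "?H \<in> flats M" by (rule flatI[OF u(1) le])
  have iff: "J S \<subseteq> ?H \<longleftrightarrow> \<psi> (point_of S) \<noteq> 0" for S
    using J_subset_iff[OF u(1) le, of S] \<psi>(2)[of "point_of S"] t(1) unfolding u(2)
    by (auto simp: embed_def min_def)
  have rep_iff: "rep S \<in> ?H \<longleftrightarrow> rep S \<in> H" if "S \<in> E" for S
    using rep_in_flat_iff[OF that fl] rep_in_flat_iff[OF that HM] iff H by simp
  have "j \<notin> ?H"
  proof
    assume "j \<in> ?H"
    moreover have "B - {b} \<subseteq> ?H"
    proof
      fix i assume i: "i \<in> B - {b}"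
      then obtain S where "S \<in> E" "i = rep S" using B(1) by blast
      then show "i \<in> ?H" using rep_iff i B(3) by blast
    qed
    ultimately have "insert j (B - {b}) \<subseteq> ?H" by blast
    then have "b \<in> ?H" using j(1) fl unfolding mclosure_iff by blast
    moreover obtain S where "S \<in> E" "b = rep S" using B(1,2) by blast
    ultimately show False using rep_iff B(4) by blast
  qed
  then show ?thesis using le[OF j(2)] j(2) by simp
qed

lemma section_unique:
  assumes \<tau>: "continuous_section V \<pi> (nondegenerate_locus G D \<Sigma>) \<tau>"
  shows "\<tau> \<phi> = w"
proof
  fix j
  show "\<tau> \<phi> j = w j"
  proof (cases "j \<in> live_coords V")
    case False
    have "\<tau> \<phi> \<in> V" using \<tau> nondeg unfolding continuous_section_def by blast
    moreover have "v j = \<infinity>" if "v \<in> V" for v using False that unfolding live_coords_def by blast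
    ultimately show ?thesis using least_section_mem by metis
  next
    case True
    then have jF: "j \<in> F" using kernel_empty by simp
    obtain B where B: "B \<subseteq> rep ` E" "mbasis M B" "mclosure M B = ground M" using rep_basis by metis
    have indB: "mindep M B" using B(2) by (simp add: mbasis_def)
    have jB: "j \<in> mclosure M B" using B(3) jF by simp
    obtain b where b: "b \<in> B" "j \<notin> mclosure M (B - {b})" using mindep_exchange_out[OF indB jB] by metis
    obtain H where H: "H \<in> flats M" "B - {b} \<subseteq> H" "j \<notin> H" using b(2) jF by (auto simp: mclosure_iff)
    have ib: "insert b (B - {b}) = B" using b(1) by blast
    have "b \<notin> H"
    proof
      assume "b \<in> H"
      then have "B \<subseteq> H" using H(2) by blast
      then show False using jB H(1,3) by (simp add: mclosure_iff)
    qed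
    have BG: "B \<subseteq> ground M" using indB by (simp add: mindep_def)
    \<comment> \<open>By exchange \<open>j\<close> can replace \<open>b\<close> in the basis, so a
      flat through \<open>j\<close> and \<open>B - {b}\<close> has to contain
      \<open>b\<close>.\<close>
    have ex: "b \<in> mclosure M (insert j (B - {b}))"
      by (rule exchange) (use BG b jB ib in auto)
    obtain \<psi> where \<psi>: "\<psi> \<in> shifted_series \<Sigma> \<phi>" "\<And>x. 0 \<le> \<psi> x" "\<And>S. J S \<subseteq> H \<longleftrightarrow> \<psi> (point_of S) \<noteq> 0"
      using function_of_flat[OF H(1) F_nonempty] by blast
    let ?\<theta> = "\<lambda>t x. \<phi> x + min (\<psi> x) t"
    let ?L = "nondegenerate_locus G D \<Sigma>"
    have ev: "\<forall>\<^sub>F t in at_right 0. 0 < t \<and> ?\<theta> t \<in> ?L"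
      using eventually_at_right_less[of "0::real"] eventually_trunc_nondegenerate[OF \<psi>(1,2)]
      by eventually_elim simp
    have bc: "apply_bcontfun (Bcontfun (?\<theta> t)) = ?\<theta> t" for t
      by (rule series_bcontfun[OF trunc_mem[OF \<psi>(1)]])
    have b\<phi>: "apply_bcontfun (Bcontfun \<phi>) = \<phi>" by (rule series_bcontfun[OF \<phi>_mem])
    have "continuous_on {f :: 'p \<Rightarrow>\<^sub>C real. apply_bcontfun f \<in> ?L} (\<lambda>f. \<tau> (apply_bcontfun f))"
      using \<tau> unfolding continuous_section_def continuous_wrt_uniform_def by blast
    then have cont: "continuous_on {f :: 'p \<Rightarrow>\<^sub>C real. apply_bcontfun f \<in> ?L} (\<lambda>f. \<tau> (apply_bcontfun f) j)"
      by (rule continuous_on_product_then_coordinatewise)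
    \<comment> \<open>The truncations are within uniform distance \<open>t\<close> of
      \<open>\<phi>\<close>, so continuity of \<open>\<tau>\<close> carries the constant value
      \<open>w j\<close> along them to the limit.\<close>
    have "((\<lambda>t. Bcontfun (?\<theta> t)) \<longlongrightarrow> Bcontfun \<phi>) (at_right 0)"
    proof (rule metric_tendsto_imp_tendsto[of "\<lambda>t. t" 0])
      show "((\<lambda>t::real. t) \<longlongrightarrow> 0) (at_right 0)" by (simp add: tendsto_ident_at)
      show "\<forall>\<^sub>F t in at_right 0. dist (Bcontfun (?\<theta> t)) (Bcontfun \<phi>) \<le> dist t 0"
        using eventually_at_right_less[of "0::real"]
      proof eventually_elim
        case (elim t)
        show ?case
        proof (rule dist_bound)
          fix x
          show "dist (apply_bcontfun (Bcontfun (?\<theta> t)) x) (apply_bcontfun (Bcontfun \<phi>) x) \<le> dist t 0"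
            unfolding bc b\<phi> using elim \<psi>(2)[of x] by (simp add: dist_real_def)
        qed
      qed
    qed
    moreover have "Bcontfun \<phi> \<in> {f. apply_bcontfun f \<in> ?L}" using nondeg by (simp add: b\<phi>)
    moreover have "\<forall>\<^sub>F t in at_right 0. Bcontfun (?\<theta> t) \<in> {f. apply_bcontfun f \<in> ?L}"
      using ev by eventually_elim (simp add: bc)
    ultimately have "((\<lambda>t. \<tau> (apply_bcontfun (Bcontfun (?\<theta> t))) j) \<longlongrightarrow> \<tau> (apply_bcontfun (Bcontfun \<phi>)) j) (at_right 0)"
      by (rule continuous_on_tendsto_compose[OF cont])
    then have lim: "((\<lambda>t. \<tau> (?\<theta> t) j) \<longlongrightarrow> \<tau> \<phi> j) (at_right 0)" by (simp only: bc b\<phi>)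
    have "\<forall>\<^sub>F t in at_right 0. \<tau> (?\<theta> t) j = w j"
      using ev
    proof eventually_elim
      case (elim t)
      then show ?case
        using section_eq_along_truncation[OF \<tau> \<psi> H(1) B(1) b(1) H(2) \<open>b \<notin> H\<close> ex jF, of t] by blast
    qed
    then have "((\<lambda>t. \<tau> (?\<theta> t) j) \<longlongrightarrow> w j) (at_right 0)" by (rule tendsto_eventually)
    from tendsto_unique[OF _ lim this] show ?thesis by simp
  qed
qed

end

theorem theorem6p1:
  fixes G :: "('p::metric_space, 'e) mgraph"
    and D :: "'p \<Rightarrow> int"
    and \<Sigma> :: "('p \<Rightarrow> real) set"
    and r :: int
    and V :: "('n::finite \<Rightarrow> ereal) set"
    and \<pi> :: "('n \<Rightarrow> ereal) \<Rightarrow> 'p \<Rightarrow> ereal"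
  assumes "metric_graph G"
    and "divisor D"
    and "tropical_linear_series G D \<Sigma> r"
    and "parametrization V \<pi> \<Sigma> r"
  shows "\<exists>\<sigma>. continuous_section V \<pi> (nondegenerate_locus G D \<Sigma>) \<sigma> \<and>
    (\<forall>\<tau>. continuous_section V \<pi> (nondegenerate_locus G D \<Sigma>) \<tau> \<longrightarrow>
       (\<forall>\<phi>\<in>nondegenerate_locus G D \<Sigma>. \<tau> \<phi> = \<sigma> \<phi>)) \<and>
    (\<forall>\<phi>\<in>nondegenerate_locus G D \<Sigma>.
       (\<forall>i\<in>live_coords V. \<sigma> \<phi> i \<noteq> \<infinity>) \<and>
       (\<exists>N. submatroid N (initial_matroid V (\<sigma> \<phi>)) \<and>
            matroid_iso (simplification (local_matroid (plus_div G D \<phi>) (shifted_series \<Sigma> \<phi>))) N))"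
proof -
  interpret graph G by unfold_locales (rule assms(1))
  have sub: "tropical_submodule G D \<Sigma>" and BN: "is_r_BN G D \<Sigma> r" and ind: "is_r_ind \<Sigma> (r + 1)"
    using assms(3) by (auto simp: tropical_linear_series_def)
  have rank: "int (vm_rank V) = r + 1" using assms(4) by (simp add: parametrization_def)
  interpret parametrized V \<pi> \<Sigma>
    by unfold_locales (use assms(4) series_bounded[OF sub] in \<open>auto simp: parametrization_def\<close>)
  let ?L = "nondegenerate_locus G D \<Sigma>"
  have pt: "matroidal_point G D \<Sigma> \<phi> V \<pi> r" if "\<phi> \<in> ?L" for \<phi>
    by unfold_locales (use sub BN ind rank that in auto)
  have "continuous_section V \<pi> ?L least_section"
    unfolding continuous_section_def
    using least_section_mem hom_least_section least_section_continuous by (auto simp: nondegenerate_locus_def)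
  then show ?thesis
    using matroidal_point.section_unique[OF pt] matroidal_point.section_finite[OF pt]
      matroidal_point.local_matroid_submatroid[OF pt]
    by (intro exI[of _ least_section] conjI allI impI ballI) blast+
qed

end
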